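(* Let $A$ be a locally finite positively graded elementary algebra over a field $\Bbbk$ satisfying the standing hypotheses, and let $M$ be a nonzero perfect graded left $A$-module. Exactly one of the following occurs. (i) Every nonzero pole of every nonzero coordinate of $\mathrm{Hilb}_M$ is a root of unity. Then $M$ has finite GK dimension and $$\operatorname{GKdim}M=\operatorname{pole}_1(\mathrm{Hilb}_M)=\lambda_A^+\bigl(\pi_A^+(q_M(1+t))\bigr).$$ (ii) Some coordinate of $\mathrm{Hilb}_M$ has a nonzero pole that is not a root of unity. Then $M$ has exponential growth.
   Context: All algebras are associative and unital; $\Bbbk$ is an arbitrary field. A locally finite positively graded elementary algebra is a graded algebra $A=\bigoplus_{n\ge0}A_n$ with $\dim_\Bbbk A_n<\infty$ for all $n$ and $A_0=\bigoplus_{i=1}^r\Bbbk e_i$ for primitive orthogonal idempotents $e_1,\ldots,e_r$. Put $J=A_{>0}$. Modules are graded left modules; the vertex simples are $S_j=Ae_j/Je_j$. A graded module is of graded type $\mathrm{FP}_\infty$ if it has a projective resolution by finitely generated graded projectives in every homological degree, and is perfect if it has a finite resolution by finitely generated graded projectives. The matrix Hilbert series $C_A(x)\in M_r(\mathbb Z[[x]])$ has entries $C_A(x)_{ij}=\sum_{n\ge0}\dim_\Bbbk(e_iA_ne_j)x^n$. For a graded module $M$, $\mathrm{Hilb}_M(x)$ is the column vector with $i$-th entry $\sum_n\dim_\Bbbk(e_iM_n)x^n$. Standing hypotheses on $A$: every $S_j$ is of graded type $\mathrm{FP}_\infty$, and $C_A(x)\in M_r(\mathbb Q(x))$. Put $\mathcal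 E_A(x)=C_A(x)^{-1}\in GL_r(\mathbb Q(x))$. Put $t=x-1$, $\Lambda_A=\mathcal E_A(1+t)\,\mathbb Q[[t]]^r\subset\mathbb Q((t))^r$, and $\mathcal G_A^+=\mathbb Q[[t]]^r/(\mathbb Q[[t]]^r\cap\Lambda_A)$, a finite-length $\mathbb Q[[t]]$-module. Let $\pi_A^+:\mathbb Q[[t]]^r\to\mathcal G_A^+$ be the quotient map. For $\xi\in\mathcal G_A^+$ put $\lambda_A^+(\xi)=\min\{d\ge0:t^d\xi=0\}$, and for $h\in\mathbb Q((t))^r$ put $\operatorname{pole}_1(h)=\min\{d\ge0:t^dh\in\mathbb Q[[t]]^r\}$; for a vector of rational functions of $x$, $\operatorname{pole}_1$ is applied to its expansion in $t=x-1$. Euler numerator: a finitely generated graded projective $P$ decomposes as $P\cong\bigoplus_{j=1}^rAe_j\otimes_\Bbbk W_j$ with $W_j\cong e_j(P/JP)$ finite-dimensional graded; put $q_P(x)_j=\sum_m\dim_\Bbbk((W_j)_m)x^m\in\mathbb Z[x,x^{-1}]$. For $M$ perfect with finite resolution $P_\bullet$ by finitely generated graded projectives, $q_M(x)=\sum_n(-1)^nq_{P_n}(x)\in\mathbb Z[x,x^{-1}]^r$; it is independent of the resolution and satisfies $\mathrm{Hilb}_M(x)=C_A(x)q_M(x)$, so the coordinates of $\mathrm{Hilb}_M$ are rational functions; poles are poles in $\mathbb C$, and a nonzero pole is a pole at a point other than $0$. Growth: for a nonzero Laurent series $h(x)=\sum_{n\ge n_0}c_nx^n$ with $c_n\ge0$,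 $\operatorname{GKdim}h=\limsup_{N\to\infty}\log(\sum_{n_0\le n\le N}c_n)/\log N$, and $h$ has exponential growth if $\limsup_{N\to\infty}(\sum_{n_0\le n\le N}c_n)^{1/N}>1$. For a nonzero vector series with nonnegative coefficients these are applied to the sum of the coordinates. The GK dimension and exponential growth of $M$ are those of $\mathrm{Hilb}_M$ (these agree with the ordinary notions, since the standing hypotheses imply that $A$ is finitely generated and $M$ is a finitely generated graded module). *)

theory Defs
  imports
    "HOL-Complex_Analysis.Complex_Analysis"
    "HOL-Computational_Algebra.Computational_Algebra"
    "HOL-Computational_Algebra.Field_as_Ring"
    "HOL-Algebra.AbelCoset"
    "HOL-Algebra.Generated_Groups"
    "Jordan_Normal_Form.Missing_VectorSpace"
begin

unbundle no fps_syntax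

section \<open>Graded algebras and graded left modules\<close>

text \<open>
  One record type serves for graded algebras over a field and for graded left modules over such
  an algebra. Only modules use the \<open>smult\<close> component as the action of a noncommutative ring; their
  ring components \<open>mult\<close> and \<open>one\<close> carry no meaning.
\<close>

record ('a, 'm) graded_module = "('a, 'm) module" +
  grade :: "int \<Rightarrow> 'm set"

definition internal_direct_sum :: "('g, 'x) ring_scheme \<Rightarrow> ('i \<Rightarrow> 'g set) \<Rightarrow> bool" where
  "internal_direct_sum G V \<longleftrightarrow>
     (\<forall>i. additive_subgroup (V i) G) \<and>
     (\<forall>x\<in>carrier G. \<exists>!f. (\<forall>i. f i \<in> V i) \<and> finite {i. f i \<noteq> \<zero>\<^bsub>G\<^esub>} \<and>
        x = finsum G f {i. f i \<noteq> \<zero>\<^bsub>G\<^esub>})"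

definition idempotent :: "('a, 'x) ring_scheme \<Rightarrow> 'a \<Rightarrow> bool" where
  "idempotent R u \<longleftrightarrow> u \<in> carrier R \<and> u \<otimes>\<^bsub>R\<^esub> u = u"

definition orthogonal_elems :: "('a, 'x) ring_scheme \<Rightarrow> 'a \<Rightarrow> 'a \<Rightarrow> bool" where
  "orthogonal_elems R u v \<longleftrightarrow> u \<otimes>\<^bsub>R\<^esub> v = \<zero>\<^bsub>R\<^esub> \<and> v \<otimes>\<^bsub>R\<^esub> u = \<zero>\<^bsub>R\<^esub>"

definition primitive_idempotent :: "('a, 'x) ring_scheme \<Rightarrow> 'a \<Rightarrow> bool" where
  "primitive_idempotent R u \<longleftrightarrow> idempotent R u \<and> u \<noteq> \<zero>\<^bsub>R\<^esub> \<and>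
     (\<forall>v w. idempotent R v \<and> idempotent R w \<and> orthogonal_elems R v w \<and> u = v \<oplus>\<^bsub>R\<^esub> w
        \<longrightarrow> v = \<zero>\<^bsub>R\<^esub> \<or> w = \<zero>\<^bsub>R\<^esub>)"

text \<open>
  The grading is indexed by the integers, with zero components in negative degrees. The index
  type \<open>'r\<close> of the idempotents is finite and nonempty; an empty family would force \<open>A = 0\<close>.
\<close>

locale elementary_algebra = vectorspace K A + ring A
  for K :: "'k ring" and A :: "('k, 'a) graded_module" +
  fixes e :: "'r::finite \<Rightarrow> 'a"
  assumes smult_mult_left:
      "\<lbrakk>c \<in> carrier K; a \<in> carrier A; b \<in> carrier A\<rbrakk>
        \<Longrightarrow> (c \<odot>\<^bsub>A\<^esub> a) \<otimes>\<^bsub>A\<^esub> b = c \<odot>\<^bsub>A\<^esub> (a \<otimes>\<^bsub>A\<^esub> b)"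
    and smult_mult_right:
      "\<lbrakk>c \<in> carrier K; a \<in> carrier A; b \<in> carrier A\<rbrakk>
        \<Longrightarrow> a \<otimes>\<^bsub>A\<^esub> (c \<odot>\<^bsub>A\<^esub> b) = c \<odot>\<^bsub>A\<^esub> (a \<otimes>\<^bsub>A\<^esub> b)"
    and grading: "internal_direct_sum A (grade A)"
    and grade_smult: "\<lbrakk>c \<in> carrier K; a \<in> grade A n\<rbrakk> \<Longrightarrow> c \<odot>\<^bsub>A\<^esub> a \<in> grade A n"
    and grade_mult: "\<lbrakk>a \<in> grade A m; b \<in> grade A n\<rbrakk> \<Longrightarrow> a \<otimes>\<^bsub>A\<^esub> b \<in> grade A (m + n)"
    and grade_one: "\<one>\<^bsub>A\<^esub> \<in> grade A 0"
    and grade_neg: "n < 0 \<Longrightarrow> grade A n = {\<zero>\<^bsub>A\<^esub>}"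
    and locally_finite: "vectorspace.fin_dim K (A\<lparr>carrier := grade A n\<rparr>)"
    and primitive: "primitive_idempotent A (e i)"
    and orthogonal: "i \<noteq> j \<Longrightarrow> orthogonal_elems A (e i) (e j)"
    and grade_zero:
      "internal_direct_sum (A\<lparr>carrier := grade A 0\<rparr>) (\<lambda>i. {c \<odot>\<^bsub>A\<^esub> e i | c. c \<in> carrier K})"

text \<open>The locale \<^locale>\<open>module\<close> of HOL-Algebra needs a commutative ring of scalars.\<close>

locale left_module = R?: ring R + M?: abelian_group M
  for R :: "('a, 'x) ring_scheme" (structure) and M :: "('a, 'm, 'y) module_scheme" (structure) +
  assumes smult_closed: "\<lbrakk>a \<in> carrier R; x \<in> carrier M\<rbrakk> \<Longrightarrow> a \<odot>\<^bsub>M\<^esub> x \<in> carrier M"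
    and smult_l_distr:
      "\<lbrakk>a \<in> carrier R; b \<in> carrier R; x \<in> carrier M\<rbrakk>
        \<Longrightarrow> (a \<oplus> b) \<odot>\<^bsub>M\<^esub> x = a \<odot>\<^bsub>M\<^esub> x \<oplus>\<^bsub>M\<^esub> b \<odot>\<^bsub>M\<^esub> x"
    and smult_r_distr:
      "\<lbrakk>a \<in> carrier R; x \<in> carrier M; y \<in> carrier M\<rbrakk>
        \<Longrightarrow> a \<odot>\<^bsub>M\<^esub> (x \<oplus>\<^bsub>M\<^esub> y) = a \<odot>\<^bsub>M\<^esub> x \<oplus>\<^bsub>M\<^esub> a \<odot>\<^bsub>M\<^esub> y"
    and smult_assoc:
      "\<lbrakk>a \<in> carrier R; b \<in> carrier R; x \<in> carrier M\<rbrakk>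
        \<Longrightarrow> (a \<otimes> b) \<odot>\<^bsub>M\<^esub> x = a \<odot>\<^bsub>M\<^esub> (b \<odot>\<^bsub>M\<^esub> x)"
    and smult_one: "x \<in> carrier M \<Longrightarrow> \<one> \<odot>\<^bsub>M\<^esub> x = x"

locale graded_left_module = left_module A M
  for A :: "('k, 'a) graded_module" and M :: "('a, 'm) graded_module" +
  assumes grading: "internal_direct_sum M (grade M)"
    and grade_smult: "\<lbrakk>a \<in> grade A m; x \<in> grade M n\<rbrakk> \<Longrightarrow> a \<odot>\<^bsub>M\<^esub> x \<in> grade M (m + n)"

text \<open>Homomorphisms are homogeneous of degree 0.\<close>

definition graded_hom ::
    "('k, 'a) graded_module \<Rightarrow> ('a, 'm) graded_module \<Rightarrow> ('a, 'n) graded_module \<Rightarrow> ('m \<Rightarrow> 'n) set"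
  where
  "graded_hom A M N = {f \<in> carrier M \<rightarrow> carrier N.
     (\<forall>x\<in>carrier M. \<forall>y\<in>carrier M. f (x \<oplus>\<^bsub>M\<^esub> y) = f x \<oplus>\<^bsub>N\<^esub> f y) \<and>
     (\<forall>a\<in>carrier A. \<forall>x\<in>carrier M. f (a \<odot>\<^bsub>M\<^esub> x) = a \<odot>\<^bsub>N\<^esub> f x) \<and>
     (\<forall>n. f ` grade M n \<subseteq> grade N n)}"

text \<open>The ideal \<open>J = A\<^bsub>>0\<^esub>\<close> and the submodule \<open>J M\<close>.\<close>

definition positive_part :: "('k, 'a) graded_module \<Rightarrow> 'a set" where
  "positive_part A = generate (add_monoid A) (\<Union>n\<in>{1..}. grade A n)"

definition positive_part_mult :: "('k, 'a) graded_module \<Rightarrow> ('a, 'm) graded_module \<Rightarrow> 'm set" where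
  "positive_part_mult A M =
     generate (add_monoid M) {a \<odot>\<^bsub>M\<^esub> x | a x. a \<in> positive_part A \<and> x \<in> carrier M}"

definition quotient_module :: "('a, 'm, 'x) module_scheme \<Rightarrow> 'm set \<Rightarrow> ('a, 'm set) module" where
  "quotient_module M N =
     \<lparr>carrier = a_rcosets\<^bsub>M\<^esub> N, mult = undefined, one = undefined, zero = N, add = set_add M,
      smult = (\<lambda>a X. \<Union>x\<in>X. N +>\<^bsub>M\<^esub> (a \<odot>\<^bsub>M\<^esub> x))\<rparr>"

definition graded_quotient :: "('a, 'm) graded_module \<Rightarrow> 'm set \<Rightarrow> ('a, 'm set) graded_module" where
  "graded_quotient M N = module.extend (quotient_module M N)
     (graded_module.fields (\<lambda>n. (\<lambda>x. N +>\<^bsub>M\<^esub> x) ` grade M n))"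

definition left_ideal_module :: "('k, 'a) graded_module \<Rightarrow> 'a \<Rightarrow> ('a, 'a) graded_module" where
  "left_ideal_module A u =
     \<lparr>carrier = {a \<otimes>\<^bsub>A\<^esub> u | a. a \<in> carrier A}, mult = undefined, one = undefined,
      zero = \<zero>\<^bsub>A\<^esub>, add = add A, smult = mult A,
      grade = (\<lambda>n. {a \<otimes>\<^bsub>A\<^esub> u | a. a \<in> grade A n})\<rparr>"

definition vertex_simple ::
    "('k, 'a) graded_module \<Rightarrow> ('r \<Rightarrow> 'a) \<Rightarrow> 'r \<Rightarrow> ('a, 'a set) graded_module" where
  "vertex_simple A e j =
     graded_quotient (left_ideal_module A (e j)) {a \<otimes>\<^bsub>A\<^esub> e j | a. a \<in> positive_part A}"


section \<open>Resolutions\<close>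

text \<open>
  The graded free module with basis elements of degrees \<open>s 0, \<dots>, s (l - 1)\<close>, as \<open>l\<close>-tuples that
  are padded by zero.
\<close>

definition graded_free ::
    "('k, 'a) graded_module \<Rightarrow> nat \<Rightarrow> (nat \<Rightarrow> int) \<Rightarrow> ('a, nat \<Rightarrow> 'a) graded_module" where
  "graded_free A l s =
     \<lparr>carrier = {x. (\<forall>i<l. x i \<in> carrier A) \<and> (\<forall>i\<ge>l. x i = \<zero>\<^bsub>A\<^esub>)},
      mult = undefined, one = undefined, zero = (\<lambda>i. \<zero>\<^bsub>A\<^esub>),
      add = (\<lambda>x y i. x i \<oplus>\<^bsub>A\<^esub> y i), smult = (\<lambda>a x i. a \<otimes>\<^bsub>A\<^esub> x i),
      grade = (\<lambda>n. {x. (\<forall>i<l. x i \<in> grade A (n - s i)) \<and> (\<forall>i\<ge>l. x i = \<zero>\<^bsub>A\<^esub>)})\<rparr>"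

text \<open>
  Finitely generated graded projective modules are the graded direct summands of finitely generated
  graded free modules.
\<close>

definition fg_graded_projective :: "('k, 'a) graded_module \<Rightarrow> ('a, 'm) graded_module \<Rightarrow> bool" where
  "fg_graded_projective A P \<longleftrightarrow> graded_left_module A P \<and>
     (\<exists>l s. \<exists>\<iota>\<in>graded_hom A P (graded_free A l s). \<exists>\<rho>\<in>graded_hom A (graded_free A l s) P.
        \<forall>x\<in>carrier P. \<rho> (\<iota> x) = x)"

definition fg_projective_resolution ::
    "('k, 'a) graded_module \<Rightarrow> ('a, 'm) graded_module \<Rightarrow> (nat \<Rightarrow> ('a, 'p) graded_module)
      \<Rightarrow> (nat \<Rightarrow> 'p \<Rightarrow> 'p) \<Rightarrow> ('p \<Rightarrow> 'm) \<Rightarrow> bool" where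
  "fg_projective_resolution A M P d \<epsilon> \<longleftrightarrow>
     (\<forall>n. fg_graded_projective A (P n)) \<and>
     (\<forall>n. d n \<in> graded_hom A (P (Suc n)) (P n)) \<and>
     \<epsilon> \<in> graded_hom A (P 0) M \<and>
     \<epsilon> ` carrier (P 0) = carrier M \<and>
     a_kernel (P 0) M \<epsilon> = d 0 ` carrier (P 1) \<and>
     (\<forall>n. a_kernel (P (Suc n)) (P n) (d n) = d (Suc n) ` carrier (P (Suc (Suc n))))"

definition finite_resolution :: "(nat \<Rightarrow> ('a, 'p) graded_module) \<Rightarrow> bool" where
  "finite_resolution P \<longleftrightarrow> (\<exists>l. \<forall>n>l. carrier (P n) = {\<zero>\<^bsub>P n\<^esub>})"

text \<open>
  Taking the terms of a resolution to consist of elements of type \<^typ>\<open>nat \<Rightarrow> 'a\<close> is no restriction: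
  every finitely generated graded projective module is isomorphic to a submodule of some
  \<^const>\<open>graded_free\<close>.
\<close>

definition graded_FP_infinity :: "('k, 'a) graded_module \<Rightarrow> ('a, 'm) graded_module \<Rightarrow> bool" where
  "graded_FP_infinity A M \<longleftrightarrow>
     (\<exists>(P :: nat \<Rightarrow> ('a, nat \<Rightarrow> 'a) graded_module) d \<epsilon>. fg_projective_resolution A M P d \<epsilon>)"

definition perfect :: "('k, 'a) graded_module \<Rightarrow> ('a, 'm) graded_module \<Rightarrow> bool" where
  "perfect A M \<longleftrightarrow>
     (\<exists>(P :: nat \<Rightarrow> ('a, nat \<Rightarrow> 'a) graded_module) d \<epsilon>.
        fg_projective_resolution A M P d \<epsilon> \<and> finite_resolution P)"


section \<open>Rational functions and their expansions\<close>

type_synonym ratfun = "rat poly fract"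

text \<open>The Laurent expansion of a rational function at \<open>x = a\<close> in the parameter \<open>t = x - a\<close>.\<close>

definition expansion :: "rat \<Rightarrow> ratfun \<Rightarrow> rat fls" where
  "expansion a f =
     fps_to_fls (fps_of_poly (pcompose (fst (quot_of_fract f)) [:a, 1:])) /
     fps_to_fls (fps_of_poly (pcompose (snd (quot_of_fract f)) [:a, 1:]))"

definition rational_series :: "rat fls \<Rightarrow> bool" where
  "rational_series h \<longleftrightarrow> (\<exists>f. expansion 0 f = h)"

definition ratfun_of :: "rat fls \<Rightarrow> ratfun" where
  "ratfun_of h = (THE f. expansion 0 f = h)"

definition ratfun_eval :: "ratfun \<Rightarrow> complex \<Rightarrow> complex" where
  "ratfun_eval f z = poly (map_poly of_rat (fst (quot_of_fract f))) z /
                     poly (map_poly of_rat (snd (quot_of_fract f))) z"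

definition root_of_unity :: "complex \<Rightarrow> bool" where
  "root_of_unity z \<longleftrightarrow> (\<exists>n>0. z ^ n = 1)"

definition ratfun_X :: ratfun where
  "ratfun_X = Fract [:0, 1:] 1"


section \<open>Hilbert series and Euler numerators\<close>

definition restrict_scalars ::
    "('k, 'a) graded_module \<Rightarrow> ('a, 'm) graded_module \<Rightarrow> ('k, 'm) module" where
  "restrict_scalars A M =
     \<lparr>carrier = carrier M, mult = mult M, one = one M, zero = zero M, add = add M,
      smult = (\<lambda>c x. (c \<odot>\<^bsub>A\<^esub> \<one>\<^bsub>A\<^esub>) \<odot>\<^bsub>M\<^esub> x)\<rparr>"

text \<open>The dimension of \<open>e\<^sub>i M\<^sub>n\<close> over the ground field.\<close>

definition graded_dim ::
    "'k ring \<Rightarrow> ('k, 'a) graded_module \<Rightarrow> ('r \<Rightarrow> 'a) \<Rightarrow> ('a, 'm) graded_module \<Rightarrow> 'r \<Rightarrow> int \<Rightarrow> nat"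
  where
  "graded_dim K A e M i n =
     vectorspace.dim K ((restrict_scalars A M)\<lparr>carrier := {e i \<odot>\<^bsub>M\<^esub> x | x. x \<in> grade M n}\<rparr>)"

definition hilbert_matrix ::
    "'k ring \<Rightarrow> ('k, 'a) graded_module \<Rightarrow> ('r::finite \<Rightarrow> 'a) \<Rightarrow> rat fps ^ 'r ^ 'r" where
  "hilbert_matrix K A e = (\<chi> i j. Abs_fps (\<lambda>n. of_nat (vectorspace.dim K
     (A\<lparr>carrier := {e i \<otimes>\<^bsub>A\<^esub> a \<otimes>\<^bsub>A\<^esub> e j | a. a \<in> grade A (int n)}\<rparr>))))"

definition hilbert_series ::
    "'k ring \<Rightarrow> ('k, 'a) graded_module \<Rightarrow> ('r::finite \<Rightarrow> 'a) \<Rightarrow> ('a, 'm) graded_module \<Rightarrow> rat fls ^ 'r"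
  where
  "hilbert_series K A e M = (\<chi> i. Abs_fls (\<lambda>n. of_nat (graded_dim K A e M i n)))"

definition rational_hilbert_matrix ::
    "'k ring \<Rightarrow> ('k, 'a) graded_module \<Rightarrow> ('r::finite \<Rightarrow> 'a) \<Rightarrow> bool" where
  "rational_hilbert_matrix K A e \<longleftrightarrow>
     (\<forall>i j. rational_series (fps_to_fls (hilbert_matrix K A e $ i $ j)))"

definition inverse_hilbert_matrix ::
    "'k ring \<Rightarrow> ('k, 'a) graded_module \<Rightarrow> ('r::finite \<Rightarrow> 'a) \<Rightarrow> ratfun ^ 'r ^ 'r" where
  "inverse_hilbert_matrix K A e =
     matrix_inv (\<chi> i j. ratfun_of (fps_to_fls (hilbert_matrix K A e $ i $ j)))"

text \<open>Laurent polynomials are regarded as rational functions.\<close>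

definition projective_numerator ::
    "'k ring \<Rightarrow> ('k, 'a) graded_module \<Rightarrow> ('r::finite \<Rightarrow> 'a) \<Rightarrow> ('a, 'm) graded_module \<Rightarrow> ratfun ^ 'r"
  where
  "projective_numerator K A e P =
     (let w = graded_dim K A e (graded_quotient P (positive_part_mult A P))
      in \<chi> j. \<Sum>m | w j m \<noteq> 0. of_nat (w j m) * ratfun_X powi m)"

definition euler_numerator ::
    "'k ring \<Rightarrow> ('k, 'a) graded_module \<Rightarrow> ('r::finite \<Rightarrow> 'a) \<Rightarrow> ('a, 'm) graded_module \<Rightarrow> ratfun ^ 'r"
  where
  "euler_numerator K A e M =
     (THE q. \<exists>(P :: nat \<Rightarrow> ('a, nat \<Rightarrow> 'a) graded_module) d \<epsilon>.
        fg_projective_resolution A M P d \<epsilon> \<and> finite_resolution P \<and>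
        q = (\<Sum>n | carrier (P n) \<noteq> {\<zero>\<^bsub>P n\<^esub>}. (-1) ^ n *s projective_numerator K A e (P n)))"


section \<open>The lattice at 1 and its pole invariants\<close>

definition expand_vec :: "rat \<Rightarrow> ratfun ^ 'r \<Rightarrow> rat fls ^ 'r" where
  "expand_vec a q = (\<chi> i. expansion a (q $ i))"

definition expand_matrix :: "rat \<Rightarrow> ratfun ^ 'c ^ 'r \<Rightarrow> rat fls ^ 'c ^ 'r" where
  "expand_matrix a Q = (\<chi> i j. expansion a (Q $ i $ j))"

definition power_series_vecs :: "(rat fls ^ 'r) set" where
  "power_series_vecs = {h. \<forall>i. h $ i \<in> range fps_to_fls}"

definition numerator_lattice ::
    "'k ring \<Rightarrow> ('k, 'a) graded_module \<Rightarrow> ('r::finite \<Rightarrow> 'a) \<Rightarrow> (rat fls ^ 'r) set" where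
  "numerator_lattice K A e = (\<lambda>h. expand_matrix 1 (inverse_hilbert_matrix K A e) *v h) ` power_series_vecs"

definition power_series_module :: "(rat fps, rat fls ^ 'r) module" where
  "power_series_module =
     \<lparr>carrier = power_series_vecs, mult = undefined, one = undefined, zero = 0, add = (+),
      smult = (\<lambda>c h. fps_to_fls c *s h)\<rparr>"

definition growth_module ::
    "'k ring \<Rightarrow> ('k, 'a) graded_module \<Rightarrow> ('r::finite \<Rightarrow> 'a) \<Rightarrow> (rat fps, (rat fls ^ 'r) set) module"
  where
  "growth_module K A e =
     quotient_module power_series_module (power_series_vecs \<inter> numerator_lattice K A e)"

definition growth_proj ::
    "'k ring \<Rightarrow> ('k, 'a) graded_module \<Rightarrow> ('r::finite \<Rightarrow> 'a) \<Rightarrow> rat fls ^ 'r \<Rightarrow> (rat fls ^ 'r) set"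
  where
  "growth_proj K A e h = (power_series_vecs \<inter> numerator_lattice K A e) +>\<^bsub>power_series_module\<^esub> h"

definition torsion_order ::
    "'k ring \<Rightarrow> ('k, 'a) graded_module \<Rightarrow> ('r::finite \<Rightarrow> 'a) \<Rightarrow> (rat fls ^ 'r) set \<Rightarrow> nat" where
  "torsion_order K A e \<xi> =
     (LEAST d. fps_X ^ d \<odot>\<^bsub>growth_module K A e\<^esub> \<xi> = \<zero>\<^bsub>growth_module K A e\<^esub>)"

definition pole_order :: "rat fls ^ 'r \<Rightarrow> nat" where
  "pole_order h = (LEAST d. fls_X ^ d *s h \<in> power_series_vecs)"


section \<open>Growth\<close>

definition partial_sum :: "rat fls \<Rightarrow> nat \<Rightarrow> real" where
  "partial_sum h N = real_of_rat (\<Sum>n = fls_subdegree h..int N. fls_nth h n)"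

definition series_gk_dim :: "rat fls \<Rightarrow> ereal" where
  "series_gk_dim h = limsup (\<lambda>N. ereal (ln (partial_sum h N) / ln (real N)))"

definition series_exponential_growth :: "rat fls \<Rightarrow> bool" where
  "series_exponential_growth h \<longleftrightarrow> limsup (\<lambda>N. ereal (root N (partial_sum h N))) > 1"

definition gk_dim ::
    "'k ring \<Rightarrow> ('k, 'a) graded_module \<Rightarrow> ('r::finite \<Rightarrow> 'a) \<Rightarrow> ('a, 'm) graded_module \<Rightarrow> ereal" where
  "gk_dim K A e M = series_gk_dim (\<Sum>i\<in>UNIV. hilbert_series K A e M $ i)"

definition exponential_growth ::
    "'k ring \<Rightarrow> ('k, 'a) graded_module \<Rightarrow> ('r::finite \<Rightarrow> 'a) \<Rightarrow> ('a, 'm) graded_module \<Rightarrow> bool" where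
  "exponential_growth K A e M \<longleftrightarrow>
     series_exponential_growth (\<Sum>i\<in>UNIV. hilbert_series K A e M $ i)"


section \<open>Hilbert series as rational functions\<close>

definition hilbert_ratfun ::
    "'k ring \<Rightarrow> ('k, 'a) graded_module \<Rightarrow> ('r::finite \<Rightarrow> 'a) \<Rightarrow> ('a, 'm) graded_module \<Rightarrow> ratfun ^ 'r"
  where
  "hilbert_ratfun K A e M = (\<chi> i. ratfun_of (hilbert_series K A e M $ i))"

definition all_poles_roots_of_unity :: "ratfun ^ 'r \<Rightarrow> bool" where
  "all_poles_roots_of_unity h \<longleftrightarrow>
     (\<forall>i z. h $ i \<noteq> 0 \<and> z \<noteq> 0 \<and> is_pole (ratfun_eval (h $ i)) z \<longrightarrow> root_of_unity z)"

definition some_pole_not_root_of_unity :: "ratfun ^ 'r \<Rightarrow> bool" where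
  "some_pole_not_root_of_unity h \<longleftrightarrow>
     (\<exists>i z. z \<noteq> 0 \<and> is_pole (ratfun_eval (h $ i)) z \<and> \<not> root_of_unity z)"

end

theory Submission
  imports Defs "HOL-Real_Asymp.Real_Asymp"
begin

text \<open>
  The proof rests on the identity \<open>Hilb\<^sub>M = C\<^sub>A q\<^sub>M\<close>. For a finitely generated projective module \<open>P\<close> it is
  obtained by counting. Generators of \<open>P\<close> modulo \<open>J P\<close> bound the dimensions of the pieces of \<open>P\<close> from
  above (\<open>vertex_dim_le\<close>, a graded Nakayama argument). Write a free module as \<open>F = P \<oplus> P'\<close>: the
  dimensions and their bounds are additive over this decomposition, and for \<open>F\<close> the bound is an
  equality, so it is an equality for \<open>P\<close> as well (\<open>vertex_dim_summand\<close>). For a perfect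
  module the identity follows because the alternating sum of the dimensions along a resolution is the
  dimension of the module (\<open>resolution_euler\<close>). Since \<open>C\<^sub>A(0)\<close> is the identity matrix, \<open>C\<^sub>A\<close> is invertible over the
  rational functions, and the identity determines \<open>q\<^sub>M\<close>.

  Multiplication by \<open>C\<^sub>A\<close> carries the lattice \<open>\<Lambda>\<^sub>A\<close> onto the power series in \<open>t\<close>. Hence \<open>t\<^sup>d q\<^sub>M\<close> lies in
  \<open>\<Lambda>\<^sub>A\<close> exactly if \<open>t\<^sup>d Hilb\<^sub>M\<close> has no pole at 1, and the torsion order of the class of \<open>q\<^sub>M\<close> is the pole
  order of \<open>Hilb\<^sub>M\<close> (\<open>torsion_order_eq_pole_order\<close>).

  Suppose that all nonzero poles are roots of unity. Then the series converge in the open unit disc,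
  and with \<open>p\<close> the largest pole order at 1 the sum of the coordinates of \<open>Hilb\<^sub>M(x)\<close>, multiplied by
  \<open>(1 - x)\<^sup>p\<close>, has a limit for \<open>x \<rightarrow> 1-\<close>; it is positive because the coefficients are nonnegative, so that
  the leading terms of the coordinates cannot cancel. An elementary Tauberian estimate (\<open>partial_sums_bounds\<close>) then shows that the partial
  sums lie between two constant multiples of \<open>N\<^sup>p\<close>.

  Suppose instead that the growth is not exponential. Then each coordinate converges in the open unit
  disc, so all its nonzero poles satisfy \<open>|z| \<ge> 1\<close>, and they are roots of unity by
  \<open>integer_series_poles\<close>: if \<open>Q\<close> is the denominator, multiplication by \<open>gcd Q Q'\<close> makes every pole
  simple while the set of poles is unchanged and the coefficients remain integers up to one common
  factor. A series with simple poles outside the open disc has bounded coefficients, and a bounded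
  integer sequence that satisfies a linear recurrence takes the same window of values twice, hence is
  eventually periodic. Its generating function is a polynomial divided by \<open>1 - X\<^sup>k\<close>.
\<close>

section \<open>Dimensions of subspaces\<close>

text \<open>
  Dimensions are taken of subsets of a fixed ambient space, so that kernels, images and intersections
  inside one module can be compared without changing the carrier by hand.
\<close>

definition subdim :: "('k, 'x) ring_scheme \<Rightarrow> ('k, 'v, 'y) module_scheme \<Rightarrow> 'v set \<Rightarrow> nat" where
  "subdim K V S = vectorspace.dim K (V\<lparr>carrier := S\<rparr>)"

definition fd_subspace :: "('k, 'x) ring_scheme \<Rightarrow> ('k, 'v, 'y) module_scheme \<Rightarrow> 'v set \<Rightarrow> bool" where
  "fd_subspace K V S \<longleftrightarrow> subspace K S V \<and> vectorspace.fin_dim K (V\<lparr>carrier := S\<rparr>)"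

definition linear_on :: "('k, 'x) ring_scheme \<Rightarrow> ('k, 'v, 'y) module_scheme \<Rightarrow> 'v set
    \<Rightarrow> ('k, 'w, 'z) module_scheme \<Rightarrow> ('v \<Rightarrow> 'w) \<Rightarrow> bool" where
  "linear_on K V S W f \<longleftrightarrow> f \<in> S \<rightarrow> carrier W \<and>
     (\<forall>x\<in>S. \<forall>y\<in>S. f (x \<oplus>\<^bsub>V\<^esub> y) = f x \<oplus>\<^bsub>W\<^esub> f y) \<and>
     (\<forall>c\<in>carrier K. \<forall>x\<in>S. f (c \<odot>\<^bsub>V\<^esub> x) = c \<odot>\<^bsub>W\<^esub> f x)"

lemma linear_on_subset: "linear_on K V S W f \<Longrightarrow> T \<subseteq> S \<Longrightarrow> linear_on K V T W f"
  unfolding linear_on_def by blast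

lemma subspaceI:
  assumes "vectorspace K V" "S \<subseteq> carrier V" "\<zero>\<^bsub>V\<^esub> \<in> S"
    "\<And>x y. x \<in> S \<Longrightarrow> y \<in> S \<Longrightarrow> x \<oplus>\<^bsub>V\<^esub> y \<in> S"
    "\<And>c x. c \<in> carrier K \<Longrightarrow> x \<in> S \<Longrightarrow> c \<odot>\<^bsub>V\<^esub> x \<in> S"
  shows "subspace K S V"
  using assms unfolding subspace_def submodule_def vectorspace_def by auto

lemma subspaceD:
  assumes "subspace K S V"
  shows "vectorspace K V" "S \<subseteq> carrier V" "\<zero>\<^bsub>V\<^esub> \<in> S"
    "\<And>x y. x \<in> S \<Longrightarrow> y \<in> S \<Longrightarrow> x \<oplus>\<^bsub>V\<^esub> y \<in> S"
    "\<And>c x. c \<in> carrier K \<Longrightarrow> x \<in> S \<Longrightarrow> c \<odot>\<^bsub>V\<^esub> x \<in> S"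
    "\<And>x. x \<in> S \<Longrightarrow> \<ominus>\<^bsub>V\<^esub> x \<in> S"
proof -
  interpret vectorspace K V using assms by (simp add: subspace_def)
  show 1: "vectorspace K V" by (rule vectorspace_axioms)
  from assms have s: "submodule K S V" by (simp add: subspace_def)
  show "S \<subseteq> carrier V" "\<zero>\<^bsub>V\<^esub> \<in> S" 
    "\<And>x y. x \<in> S \<Longrightarrow> y \<in> S \<Longrightarrow> x \<oplus>\<^bsub>V\<^esub> y \<in> S"
    using s by (auto simp: submodule_def)
  show c: "\<And>c x. c \<in> carrier K \<Longrightarrow> x \<in> S \<Longrightarrow> c \<odot>\<^bsub>V\<^esub> x \<in> S"
    using s by (auto simp: submodule_def)
  show "\<ominus>\<^bsub>V\<^esub> x \<in> S" if "x \<in> S" for x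
  proof -
    have x: "x \<in> carrier V" using that \<open>S \<subseteq> carrier V\<close> by auto
    have "(\<ominus>\<^bsub>K\<^esub> \<one>\<^bsub>K\<^esub>) \<odot>\<^bsub>V\<^esub> x \<in> S" by (rule c) (use that in auto)
    then show ?thesis using x by (simp add: smult_minus_1)
  qed
qed

lemma subspace_Int:
  "subspace K S V \<Longrightarrow> subspace K T V \<Longrightarrow> subspace K (S \<inter> T) V"
proof -
  assume S: "subspace K S V" and T: "subspace K T V"
  show ?thesis
    using subspaceD(2,3)[OF S] subspaceD(3)[OF T]
    by (intro subspaceI subspaceD(1)[OF S]) (auto intro: subspaceD(4,5)[OF S] subspaceD(4,5)[OF T])
qed

lemma subspace_vectorspace: "subspace K S V \<Longrightarrow> vectorspace K (V\<lparr>carrier := S\<rparr>)"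
  using subspaceD(1) vectorspace.subspace_is_vs by blast

lemma linear_on_zero:
  assumes "subspace K S V" "vectorspace K W" "linear_on K V S W f"
  shows "f \<zero>\<^bsub>V\<^esub> = \<zero>\<^bsub>W\<^esub>"
proof -
  interpret W: vectorspace K W by fact
  interpret V: vectorspace K V using assms(1) by (rule subspaceD)
  have z: "\<zero>\<^bsub>V\<^esub> \<in> S" using assms(1) by (rule subspaceD)
  then have "f (\<zero>\<^bsub>K\<^esub> \<odot>\<^bsub>V\<^esub> \<zero>\<^bsub>V\<^esub>) = \<zero>\<^bsub>K\<^esub> \<odot>\<^bsub>W\<^esub> f \<zero>\<^bsub>V\<^esub>"
    using assms(3) W.R.zero_closed unfolding linear_on_def by blast
  moreover have "f \<zero>\<^bsub>V\<^esub> \<in> carrier W" using assms(3) z by (auto simp: linear_on_def)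
  ultimately show ?thesis by simp
qed

lemma linear_map_on:
  assumes "subspace K S V" "vectorspace K W" "linear_on K V S W f"
  shows "linear_map K (V\<lparr>carrier := S\<rparr>) W f"
proof -
  have v: "vectorspace K (V\<lparr>carrier := S\<rparr>)" using assms(1) by (rule subspace_vectorspace)
  then show ?thesis
    using assms unfolding linear_map_def mod_hom_def mod_hom_axioms_def module_hom_def linear_on_def vectorspace_def
    by auto
qed

lemma subspace_kernel_on:
  assumes "subspace K S V" "vectorspace K W" "linear_on K V S W f" "subspace K T W"
  shows "subspace K {x \<in> S. f x \<in> T} V"
  using linear_on_zero[OF assms(1-3)] subspaceD(2,3)[OF assms(1)] subspaceD(3)[OF assms(4)] assms(3)
  by (intro subspaceI subspaceD(1)[OF assms(1)])
    (auto simp: linear_on_def intro: subspaceD(4,5)[OF assms(1)] subspaceD(4,5)[OF assms(4)])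

lemma subspace_zero: "vectorspace K V \<Longrightarrow> subspace K {\<zero>\<^bsub>V\<^esub>} V"
proof -
  assume v: "vectorspace K V"
  interpret vectorspace K V by fact
  show ?thesis using v by (intro subspaceI) auto
qed

lemma subspace_carrier: "vectorspace K V \<Longrightarrow> subspace K (carrier V) V"
proof -
  assume v: "vectorspace K V"
  interpret vectorspace K V by fact
  show ?thesis using v by (intro subspaceI) auto
qed

lemma subspace_image_on:
  assumes "subspace K S V" "vectorspace K W" "linear_on K V S W f"
  shows "subspace K (f ` S) W"
proof (rule subspaceI)
  note s = subspaceD[OF assms(1)]
  show "vectorspace K W" by fact
  show "f ` S \<subseteq> carrier W" using assms(3) by (auto simp: linear_on_def)
  show "\<zero>\<^bsub>W\<^esub> \<in> f ` S" using linear_on_zero[OF assms] s(3) by (metis imageI)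
  show "x \<oplus>\<^bsub>W\<^esub> y \<in> f ` S" if "x \<in> f ` S" "y \<in> f ` S" for x y
  proof -
    obtain u v where "u \<in> S" "v \<in> S" "x = f u" "y = f v" using \<open>x \<in> f ` S\<close> \<open>y \<in> f ` S\<close> by blast
    then show ?thesis using assms(3) s(4) by (intro image_eqI[of _ _ "u \<oplus>\<^bsub>V\<^esub> v"]) (auto simp: linear_on_def)
  qed
  show "c \<odot>\<^bsub>W\<^esub> x \<in> f ` S" if "c \<in> carrier K" "x \<in> f ` S" for c x
  proof -
    obtain u where "u \<in> S" "x = f u" using \<open>x \<in> f ` S\<close> by blast
    then show ?thesis using assms(3) s(5) \<open>c \<in> carrier K\<close>
      by (intro image_eqI[of _ _ "c \<odot>\<^bsub>V\<^esub> u"]) (auto simp: linear_on_def)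
  qed
qed

lemma
  assumes "fd_subspace K V S" "vectorspace K W" "linear_on K V S W f"
  shows subdim_rank_nullity: "subdim K V S = subdim K W (f ` S) + subdim K V {x \<in> S. f x = \<zero>\<^bsub>W\<^esub>}"
    and fd_subspace_image: "fd_subspace K W (f ` S)"
proof -
  have S: "subspace K S V" using assms(1) by (simp add: fd_subspace_def)
  have fd: "vectorspace.fin_dim K (V\<lparr>carrier := S\<rparr>)" using assms(1) by (simp add: fd_subspace_def)
  interpret linear_map K "V\<lparr>carrier := S\<rparr>" W f using S assms(2,3) by (rule linear_map_on)
  show "subdim K V S = subdim K W (f ` S) + subdim K V {x \<in> S. f x = \<zero>\<^bsub>W\<^esub>}"
    using rank_nullity[OF fd] by (simp add: subdim_def mod_hom.im_def mod_hom.ker_def im_def ker_def)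
  have im: "subspace K (f ` S) W" using S assms(2,3) by (rule subspace_image_on)
  then have im': "vectorspace K (W\<lparr>carrier := f ` S\<rparr>)" by (rule subspace_vectorspace)
  have "linear_on K V S (W\<lparr>carrier := f ` S\<rparr>) f" using assms(3) by (simp add: linear_on_def)
  with S im' interpret r: linear_map K "V\<lparr>carrier := S\<rparr>" "W\<lparr>carrier := f ` S\<rparr>" f by (rule linear_map_on)
  show "fd_subspace K W (f ` S)"
    using im r.surj_fin_dim[OF fd] by (simp add: fd_subspace_def)
qed

text \<open>
  A subspace contained in the span of a finite set has a basis: the size of independent subsets is
  bounded by the exchange lemma, so a maximal one exists. In contrast to the definition of finite
  dimension, this criterion does not refer to generators inside the subspace, and it makes the
  inheritance by smaller subspaces immediate.
\<close>

lemma fd_subspace_iff: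
  "fd_subspace K V S \<longleftrightarrow>
     subspace K S V \<and> (\<exists>B. finite B \<and> B \<subseteq> carrier V \<and> S \<subseteq> module.span K V B)" (is "_ \<longleftrightarrow> _ \<and> ?R")
proof (cases "subspace K S V")
  case True
  interpret V: vectorspace K V using True by (rule subspaceD)
  interpret S: vectorspace K "V\<lparr>carrier := S\<rparr>" using True by (rule subspace_vectorspace)
  have sm: "submodule K S V" using True by (simp add: subspace_def)
  have "S.fin_dim \<longleftrightarrow> ?R"
  proof
    assume "S.fin_dim"
    then obtain B where "finite B" "B \<subseteq> S" "S.span B = S" unfolding S.fin_dim_def by auto
    moreover have "S.span B = V.span B" using V.span_li_not_depend(1)[OF \<open>B \<subseteq> S\<close> sm] .
    ultimately show ?R using subspaceD(2)[OF True] by blast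
  next
    assume ?R
    then obtain B where B: "finite B" "B \<subseteq> carrier V" "S \<subseteq> V.span B" by blast
    let ?P = "\<lambda>C. C \<subseteq> S \<and> S.lin_indpt C"
    have P: "finite C \<and> card C \<le> card B" if "?P C" for C
    proof -
      have li: "V.lin_indpt C" using that V.span_li_not_depend(2)[OF _ sm, of C] by simp
      have sp: "subspace K (V.span B) V" using B by (rule_tac V.span_is_subspace)
      interpret B: vectorspace K "V\<lparr>carrier := V.span B\<rparr>" using sp by (rule subspace_vectorspace)
      have smB: "submodule K (V.span B) V" using sp by (simp add: subspace_def)
      have BB: "B \<subseteq> V.span B" using V.in_own_span B by blast
      have spB: "B.span B = V.span B" using V.span_li_not_depend(1)[OF BB smB] .
      have CB: "C \<subseteq> V.span B" using that B by blast
      have fdB: "B.fin_dim" unfolding B.fin_dim_def using spB B BB by auto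
      have liB: "B.lin_indpt C" using li V.span_li_not_depend(2)[OF CB smB] by simp
      have "finite C" using B.fin_dim_li_fin[OF fdB liB] CB by simp
      moreover have "card C \<le> card B"
        using B.li_smaller_than_gen[OF \<open>finite C\<close> B(1) _ _ liB] CB BB spB by simp
      ultimately show ?thesis by simp
    qed
    have "?P {}" by (auto simp: S.lin_dep_def)
    from maximal_exists[of ?P "card B" "{}", OF P this] obtain C where
      C: "finite C" "maximal C ?P" by blast
    then have "S.basis C" by (intro S.max_li_is_basis) simp
    then show "S.fin_dim" using C(1) unfolding S.fin_dim_def S.basis_def by auto
  qed
  then show ?thesis using True by (simp add: fd_subspace_def)
qed (simp add: fd_subspace_def)

lemma fd_subspaceD: "fd_subspace K V S \<Longrightarrow> subspace K S V"
  by (simp add: fd_subspace_def)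

lemma fd_subspace_subset:
  "fd_subspace K V S \<Longrightarrow> subspace K T V \<Longrightarrow> T \<subseteq> S \<Longrightarrow> fd_subspace K V T"
  unfolding fd_subspace_iff by blast

lemma subdim_le_card:
  assumes "subspace K S V" "finite B" "B \<subseteq> carrier V" "S \<subseteq> module.span K V B"
  shows "subdim K V S \<le> card B"
proof -
  interpret V: vectorspace K V using assms(1) by (rule subspaceD)
  have fd: "fd_subspace K V S" using assms unfolding fd_subspace_iff by blast
  interpret S: vectorspace K "V\<lparr>carrier := S\<rparr>" using assms(1) by (rule subspace_vectorspace)
  obtain C where C: "finite C" "S.basis C"
    using S.finite_basis_exists fd unfolding fd_subspace_def by blast
  have sm: "submodule K S V" using assms(1) by (simp add: subspace_def)
  have CS: "C \<subseteq> S" using C by (simp add: S.basis_def)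
  have li: "V.lin_indpt C" using C V.span_li_not_depend(2)[OF CS sm] by (simp add: S.basis_def)
  have "C \<subseteq> V.span B" using CS assms(4) by (rule subset_trans)
  from V.replacement[OF C(1) assms(2,3) li this] have D: "card C \<le> card B"
    by (elim exE conjE) linarith
  have "subdim K V S = card C" unfolding subdim_def by (rule S.dim_basis) (use C in auto)
  then show ?thesis using D by linarith
qed

lemma ex_span_card:
  assumes "fd_subspace K V S"
  shows "\<exists>B. finite B \<and> B \<subseteq> S \<and> module.span K V B = S \<and> card B = subdim K V S"
proof -
  have S: "subspace K S V" using assms by (simp add: fd_subspace_def)
  interpret V: vectorspace K V using S by (rule subspaceD)
  interpret S: vectorspace K "V\<lparr>carrier := S\<rparr>" using S by (rule subspace_vectorspace)
  have sm: "submodule K S V" using S by (simp add: subspace_def)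
  obtain B where B: "finite B" "S.basis B"
    using S.finite_basis_exists assms by (auto simp: fd_subspace_def)
  then have BS: "B \<subseteq> S" by (simp add: S.basis_def)
  have "V.span B = S" using V.span_li_not_depend(1)[OF BS sm] B by (simp add: S.basis_def)
  moreover have "card B = subdim K V S" using S.dim_basis[OF B] by (simp add: subdim_def)
  ultimately show ?thesis using B BS by blast
qed

lemma subdim_mono:
  assumes "fd_subspace K V S" "subspace K T V" "T \<subseteq> S"
  shows "subdim K V T \<le> subdim K V S"
proof -
  obtain B where B: "finite B" "B \<subseteq> S" "LinearCombinations.module.span K V B = S" "card B = subdim K V S"
    using ex_span_card[OF assms(1)] by blast
  have "B \<subseteq> carrier V" using B(2) subspaceD(2)[OF fd_subspaceD[OF assms(1)]] by blast
  then show ?thesis using subdim_le_card[OF assms(2) B(1)] B assms(3) by simp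
qed

lemma subspace_span: "vectorspace K V \<Longrightarrow> B \<subseteq> carrier V \<Longrightarrow> subspace K (module.span K V B) V"
  using vectorspace.span_is_subspace by blast

lemma span_minimal: "subspace K S V \<Longrightarrow> B \<subseteq> S \<Longrightarrow> module.span K V B \<subseteq> S"
proof -
  assume S: "subspace K S V" "B \<subseteq> S"
  interpret V: vectorspace K V using S(1) by (rule subspaceD)
  show ?thesis using V.span_is_subset[of B S] S by (simp add: subspace_def)
qed

lemma span_superset: "vectorspace K V \<Longrightarrow> B \<subseteq> carrier V \<Longrightarrow> B \<subseteq> module.span K V B"
  using module.in_own_span vectorspace_def by blast

lemma subdim_le_sum:
  assumes "vectorspace K V" "subspace K S V" "finite I" "\<And>i. i \<in> I \<Longrightarrow> fd_subspace K V (U i)"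
    "S \<subseteq> module.span K V (\<Union>i\<in>I. U i)"
  shows "fd_subspace K V S" "subdim K V S \<le> (\<Sum>i\<in>I. subdim K V (U i))"
proof -
  have "\<forall>i\<in>I. \<exists>B. finite B \<and> B \<subseteq> U i \<and> module.span K V B = U i \<and> card B = subdim K V (U i)"
    using assms(4) ex_span_card by blast
  then obtain B where B: "\<And>i. i \<in> I \<Longrightarrow> finite (B i) \<and> B i \<subseteq> U i \<and> module.span K V (B i) = U i
      \<and> card (B i) = subdim K V (U i)"
    by metis
  let ?B = "\<Union>i\<in>I. B i"
  have Uc: "U i \<subseteq> carrier V" if "i \<in> I" for i
    using subspaceD(2)[OF fd_subspaceD[OF assms(4)[OF that]]] .
  have Bc: "?B \<subseteq> carrier V" using B Uc by blast
  have sp: "subspace K (module.span K V ?B) V" using assms(1) Bc by (rule subspace_span)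
  have "B i \<subseteq> module.span K V ?B" if "i \<in> I" for i
    using span_superset[OF assms(1) Bc] that by blast
  then have "U i \<subseteq> module.span K V ?B" if "i \<in> I" for i
    using span_minimal[OF sp, of "B i"] B that by simp
  then have "module.span K V (\<Union>i\<in>I. U i) \<subseteq> module.span K V ?B"
    by (intro span_minimal[OF sp]) blast
  then have SB: "S \<subseteq> module.span K V ?B" using assms(5) by blast
  have fin: "finite ?B" using assms(3) B by blast
  show "fd_subspace K V S" using assms(2) fin Bc SB unfolding fd_subspace_iff by blast
  have "subdim K V S \<le> card ?B" by (rule subdim_le_card[OF assms(2) fin Bc SB])
  also have "\<dots> \<le> (\<Sum>i\<in>I. card (B i))" by (rule card_UN_le[OF assms(3)])
  also have "\<dots> = (\<Sum>i\<in>I. subdim K V (U i))" using B by simp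
  finally show "subdim K V S \<le> (\<Sum>i\<in>I. subdim K V (U i))" .
qed

text \<open>
  In the application \<open>T\<close> is the part of \<open>S\<close> that lies in \<open>J M\<close>, and \<open>B\<close> consists of lifts of a basis of
  the quotient \<open>S / T\<close>. A basis of \<open>T\<close> is completed inside \<open>S\<close> by the exchange lemma.
\<close>

lemma complement_generators:
  assumes "fd_subspace K V S" "subspace K T V" "T \<subseteq> S"
  shows "\<exists>B. finite B \<and> B \<subseteq> S \<and> card B \<le> subdim K V S - subdim K V T \<and> S \<subseteq> module.span K V (B \<union> T)"
proof -
  have v: "vectorspace K V" using subspaceD(1)[OF assms(2)] .
  interpret V: vectorspace K V by fact
  have fdT: "fd_subspace K V T" using fd_subspace_subset[OF assms] .
  interpret T: vectorspace K "V\<lparr>carrier := T\<rparr>" using assms(2) by (rule subspace_vectorspace)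
  obtain C where C: "finite C" "T.basis C"
    using T.finite_basis_exists fdT by (auto simp: fd_subspace_def)
  have sm: "submodule K T V" using assms(2) by (simp add: subspace_def)
  have CT: "C \<subseteq> T" using C by (simp add: T.basis_def)
  have li: "V.lin_indpt C" using C V.span_li_not_depend(2)[OF CT sm] by (simp add: T.basis_def)
  have cardC: "subdim K V T = card C" unfolding subdim_def by (rule T.dim_basis) (use C in auto)
  obtain B where B: "finite B" "B \<subseteq> S" "V.span B = S" "card B = subdim K V S"
    using ex_span_card[OF assms(1)] by blast
  have Bc: "B \<subseteq> carrier V" using B(2) subspaceD(2)[OF fd_subspaceD[OF assms(1)]] by blast
  have "C \<subseteq> V.span B" using CT assms(3) B(3) by blast
  from V.replacement[OF C(1) B(1) Bc li this] obtain D where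
    D: "finite D" "D \<subseteq> carrier V" "D \<subseteq> V.span B" "int (card D) \<le> int (card B) - int (card C)"
      "V.span (C \<union> D) = V.span B" by (elim exE conjE)
  have "V.span (C \<union> D) \<subseteq> V.span (D \<union> T)" using CT by (intro V.span_is_monotone) blast
  then have "S \<subseteq> V.span (D \<union> T)" using D B by blast
  then show ?thesis using D B cardC by (intro exI[of _ D]) auto
qed

lemma fd_subspace_extension:
  assumes "subspace K S V" "vectorspace K W" "linear_on K V S W f"
    "fd_subspace K W (f ` S)" "fd_subspace K V {x \<in> S. f x = \<zero>\<^bsub>W\<^esub>}"
  shows "fd_subspace K V S"
proof -
  interpret V: vectorspace K V using assms(1) by (rule subspaceD)
  interpret W: vectorspace K W by fact
  obtain C where C: "finite C" "C \<subseteq> f ` S" "module.span K W C = f ` S"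
    using ex_span_card[OF assms(4)] by blast
  obtain B where B: "B \<subseteq> S" "finite B" "C = f ` B"
    using C(1,2) by (meson finite_subset_image)
  obtain D where D: "finite D" "D \<subseteq> {x \<in> S. f x = \<zero>\<^bsub>W\<^esub>}" "V.span D = {x \<in> S. f x = \<zero>\<^bsub>W\<^esub>}"
    using ex_span_card[OF assms(5)] by blast
  let ?N = "V.span (B \<union> D)"
  have c: "B \<union> D \<subseteq> carrier V" using B D subspaceD(2)[OF assms(1)] by blast
  have N: "subspace K ?N V" using subspace_span[OF _ c] V.vectorspace_axioms by blast
  have NS: "?N \<subseteq> S" using span_minimal[OF assms(1), of "B \<union> D"] B D by blast
  have fN: "subspace K (f ` ?N) W"
    using subspace_image_on[OF N assms(2) linear_on_subset[OF assms(3) NS]] .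
  have sup: "B \<union> D \<subseteq> ?N" using V.in_own_span[OF c] .
  have "f ` S \<subseteq> f ` ?N" using span_minimal[OF fN, of C] C(3) B(3) sup by blast
  have DN: "V.span D \<subseteq> ?N" using span_minimal[OF N, of D] sup by blast
  have "S \<subseteq> ?N"
  proof
    fix x assume x: "x \<in> S"
    then obtain y where y: "y \<in> ?N" "f x = f y" using \<open>f ` S \<subseteq> f ` ?N\<close> by blast
    then have yS: "y \<in> S" using NS by blast
    have cc: "x \<in> carrier V" "y \<in> carrier V" using x yS subspaceD(2)[OF assms(1)] by auto
    have my: "\<ominus>\<^bsub>V\<^esub> y \<in> S" using yS subspaceD(6)[OF assms(1)] by blast
    have "\<zero>\<^bsub>W\<^esub> = f (y \<oplus>\<^bsub>V\<^esub> \<ominus>\<^bsub>V\<^esub> y)"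
      using linear_on_zero[OF assms(1-3)] cc by (simp add: V.r_neg)
    also have "\<dots> = f x \<oplus>\<^bsub>W\<^esub> f (\<ominus>\<^bsub>V\<^esub> y)" using assms(3) yS my y by (simp add: linear_on_def)
    also have "\<dots> = f (x \<oplus>\<^bsub>V\<^esub> \<ominus>\<^bsub>V\<^esub> y)" using assms(3) x my by (simp add: linear_on_def)
    finally have "x \<oplus>\<^bsub>V\<^esub> \<ominus>\<^bsub>V\<^esub> y \<in> V.span D"
      using D(3) x my subspaceD(4)[OF assms(1)] by auto
    then have "x \<oplus>\<^bsub>V\<^esub> \<ominus>\<^bsub>V\<^esub> y \<in> ?N" using DN by blast
    then have "(x \<oplus>\<^bsub>V\<^esub> \<ominus>\<^bsub>V\<^esub> y) \<oplus>\<^bsub>V\<^esub> y \<in> ?N" using y subspaceD(4)[OF N] by blast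
    then show "x \<in> ?N" using cc by (simp add: V.a_assoc V.l_neg)
  qed
  moreover have "finite (B \<union> D)" using B D by simp
  ultimately show ?thesis using assms(1) c unfolding fd_subspace_iff by blast
qed

lemma fd_subspace_zero: "vectorspace K V \<Longrightarrow> fd_subspace K V {\<zero>\<^bsub>V\<^esub>}"
  and subdim_zero: "vectorspace K V \<Longrightarrow> subdim K V {\<zero>\<^bsub>V\<^esub>} = 0"
proof -
  assume v: "vectorspace K V"
  interpret V: vectorspace K V by fact
  have sub: "subspace K {\<zero>\<^bsub>V\<^esub>} V" using v by (rule subspace_zero)
  moreover have "{\<zero>\<^bsub>V\<^esub>} \<subseteq> V.span {}" using V.span_empty by simp
  ultimately show "fd_subspace K V {\<zero>\<^bsub>V\<^esub>}" unfolding fd_subspace_iff by blast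
  show "subdim K V {\<zero>\<^bsub>V\<^esub>} = 0" using subdim_le_card[OF sub, of "{}"] \<open>{\<zero>\<^bsub>V\<^esub>} \<subseteq> V.span {}\<close> by simp
qed

lemma subdim_eq_0_iff:
  assumes "fd_subspace K V S"
  shows "subdim K V S = 0 \<longleftrightarrow> S = {\<zero>\<^bsub>V\<^esub>}"
proof
  have v: "vectorspace K V" using subspaceD(1)[OF fd_subspaceD[OF assms]] .
  interpret V: vectorspace K V by fact
  assume "subdim K V S = 0"
  then obtain B where "finite B" "V.span B = S" "card B = 0" using ex_span_card[OF assms] by auto
  then show "S = {\<zero>\<^bsub>V\<^esub>}" using V.span_empty by auto
next
  assume "S = {\<zero>\<^bsub>V\<^esub>}"
  then show "subdim K V S = 0" using subdim_zero[OF subspaceD(1)[OF fd_subspaceD[OF assms]]] by simp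
qed

lemma subdim_line:
  assumes "vectorspace K V" "v \<in> carrier V" "v \<noteq> \<zero>\<^bsub>V\<^esub>" "S = {c \<odot>\<^bsub>V\<^esub> v | c. c \<in> carrier K}"
  shows "fd_subspace K V S" "subdim K V S = 1"
proof -
  interpret V: vectorspace K V by fact
  have v: "v \<in> S" using assms(2,4) by (auto intro!: exI[of _ "\<one>\<^bsub>K\<^esub>"])
  have S: "subspace K S V"
  proof (rule subspaceI)
    show "\<zero>\<^bsub>V\<^esub> \<in> S" using assms by (auto intro!: exI[of _ "\<zero>\<^bsub>K\<^esub>"])
    show "x \<oplus>\<^bsub>V\<^esub> y \<in> S" if "x \<in> S" "y \<in> S" for x y
      using that assms by (auto simp flip: V.smult_l_distr)
    show "c \<odot>\<^bsub>V\<^esub> x \<in> S" if "c \<in> carrier K" "x \<in> S" for c x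
      using that assms by (auto simp flip: V.smult_assoc1)
  qed (use assms in auto)
  have sp: "V.span {v} = S"
  proof
    show "V.span {v} \<subseteq> S" using span_minimal[OF S] v by blast
    have "v \<in> V.span {v}" using V.in_own_span[of "{v}"] assms(2) by blast
    then show "S \<subseteq> V.span {v}" 
      using subspaceD(5)[OF subspace_span[OF assms(1), of "{v}"]] assms(2,4) by auto
  qed
  then show fd: "fd_subspace K V S" using S assms(2) unfolding fd_subspace_iff by blast
  have "subdim K V S \<le> 1" using subdim_le_card[OF S, of "{v}"] sp assms(2) by simp
  moreover have "subdim K V S \<noteq> 0" using subdim_eq_0_iff[OF fd] v assms(3) by auto
  ultimately show "subdim K V S = 1" by simp
qed

lemma subdim_inj_image:
  assumes "fd_subspace K V S" "vectorspace K W" "linear_on K V S W f"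
    "\<And>x. x \<in> S \<Longrightarrow> f x = \<zero>\<^bsub>W\<^esub> \<Longrightarrow> x = \<zero>\<^bsub>V\<^esub>"
  shows "subdim K W (f ` S) = subdim K V S"
proof -
  have S: "subspace K S V" using assms(1) by (rule fd_subspaceD)
  have "{x \<in> S. f x = \<zero>\<^bsub>W\<^esub>} = {\<zero>\<^bsub>V\<^esub>}"
  proof (intro equalityI subsetI)
    fix x assume "x \<in> {x \<in> S. f x = \<zero>\<^bsub>W\<^esub>}"
    then show "x \<in> {\<zero>\<^bsub>V\<^esub>}" using assms(4) by blast
  next
    fix x assume "x \<in> {\<zero>\<^bsub>V\<^esub>}"
    then have "x = \<zero>\<^bsub>V\<^esub>" by blast
    then show "x \<in> {x \<in> S. f x = \<zero>\<^bsub>W\<^esub>}" using linear_on_zero[OF S assms(2,3)] subspaceD(3)[OF S] by simp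
  qed
  then show ?thesis using subdim_rank_nullity[OF assms(1-3)] subdim_zero[OF subspaceD(1)[OF S]] by simp
qed

text \<open>
  The decomposition \<open>x = \<Sum>\<^sub>i p\<^sub>i x\<close> enters only through the joint injectivity of the projections. This
  form admits an induction over \<open>I\<close> that splits off one kernel at a time.
\<close>

lemma subdim_projections:
  assumes "finite I" "subspace K S V"
    "\<And>i. i \<in> I \<Longrightarrow> linear_on K V S V (p i)"
    "\<And>i x. i \<in> I \<Longrightarrow> x \<in> S \<Longrightarrow> p i x \<in> S"
    "\<And>i x. i \<in> I \<Longrightarrow> x \<in> S \<Longrightarrow> p i (p i x) = p i x"
    "\<And>i j x. i \<in> I \<Longrightarrow> j \<in> I \<Longrightarrow> i \<noteq> j \<Longrightarrow> x \<in> S \<Longrightarrow> p i (p j x) = \<zero>\<^bsub>V\<^esub>"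
    "\<And>x. x \<in> S \<Longrightarrow> (\<And>i. i \<in> I \<Longrightarrow> p i x = \<zero>\<^bsub>V\<^esub>) \<Longrightarrow> x = \<zero>\<^bsub>V\<^esub>"
    "\<And>i. i \<in> I \<Longrightarrow> fd_subspace K V (p i ` S)"
  shows "fd_subspace K V S \<and> subdim K V S = (\<Sum>i\<in>I. subdim K V (p i ` S))"
  using assms
proof (induction I arbitrary: S rule: finite_induct)
  case empty
  then have "S = {\<zero>\<^bsub>V\<^esub>}" using subspaceD(3) by force
  then show ?case using fd_subspace_zero subdim_zero subspaceD(1)[OF empty.prems(1)] by auto
next
  case (insert k I)
  have v: "vectorspace K V" using insert.prems(1) by (rule subspaceD)
  let ?S = "{x \<in> S. p k x = \<zero>\<^bsub>V\<^esub>}"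
  have S': "subspace K ?S V"
    using subspace_kernel_on[OF insert.prems(1) v insert.prems(2)[of k] subspace_zero[OF v]] by simp
  have mem: "p i x \<in> ?S" if "i \<in> I" "x \<in> S" for i x
  proof -
    have "k \<noteq> i" using that insert.hyps(2) by blast
    then have "p k (p i x) = \<zero>\<^bsub>V\<^esub>" using insert.prems(5)[of k i x] that by blast
    then show ?thesis using insert.prems(3)[of i x] that by blast
  qed
  have pS: "p i ` ?S = p i ` S" if "i \<in> I" for i
  proof -
    have "p i x \<in> p i ` ?S" if "x \<in> S" for x
      using insert.prems(4)[of i x] mem[OF \<open>i \<in> I\<close> that] that \<open>i \<in> I\<close>
      by (intro image_eqI[of _ _ "p i x"]) simp_all
    then show ?thesis by blast
  qed
  have IH: "fd_subspace K V ?S \<and> subdim K V ?S = (\<Sum>i\<in>I. subdim K V (p i ` ?S))"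
  proof (rule insert.IH)
    show "subspace K ?S V" by fact
    show "linear_on K V ?S V (p i)" if "i \<in> I" for i
      using linear_on_subset[OF insert.prems(2)[of i], of ?S] that by blast
    show "p i x \<in> ?S" if "i \<in> I" "x \<in> ?S" for i x
      using mem that by blast
    show "p i (p i x) = p i x" if "i \<in> I" "x \<in> ?S" for i x
      using insert.prems(4) that by blast
    show "p i (p j x) = \<zero>\<^bsub>V\<^esub>" if "i \<in> I" "j \<in> I" "i \<noteq> j" "x \<in> ?S" for i j x
      using insert.prems(5)[of i j x] that by blast
    show "fd_subspace K V (p i ` ?S)" if "i \<in> I" for i
      using insert.prems(7)[of i] that unfolding pS[OF that] by blast
    show "x = \<zero>\<^bsub>V\<^esub>" if "x \<in> ?S" "\<And>i. i \<in> I \<Longrightarrow> p i x = \<zero>\<^bsub>V\<^esub>" for x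
      using that insert.prems(6)[of x] by blast
  qed
  have fd: "fd_subspace K V S"
    by (rule fd_subspace_extension[OF insert.prems(1) v insert.prems(2)[of k]])
      (use insert.prems(7)[of k] IH in simp_all)
  have "subdim K V S = subdim K V (p k ` S) + subdim K V ?S"
    by (rule subdim_rank_nullity[OF fd v]) (use insert.prems(2)[of k] in simp)
  then show ?case using IH fd insert.hyps pS by simp
qed

text \<open>
  This gives the vector space structure of the quotient of a module by \<open>J M\<close>, whose operations are
  defined on cosets.
\<close>

lemma vectorspace_surj_image:
  assumes "vectorspace K V" "f ` carrier V = carrier W" 
    "\<And>x y. x \<in> carrier V \<Longrightarrow> y \<in> carrier V \<Longrightarrow> f (x \<oplus>\<^bsub>V\<^esub> y) = f x \<oplus>\<^bsub>W\<^esub> f y"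
    "\<And>c x. c \<in> carrier K \<Longrightarrow> x \<in> carrier V \<Longrightarrow> f (c \<odot>\<^bsub>V\<^esub> x) = c \<odot>\<^bsub>W\<^esub> f x"
    "f \<zero>\<^bsub>V\<^esub> = \<zero>\<^bsub>W\<^esub>"
  shows "vectorspace K W"
proof -
  interpret V: vectorspace K V by fact
  have W: "\<And>w. w \<in> carrier W \<Longrightarrow> \<exists>x\<in>carrier V. w = f x" using assms(2) by auto
  note fs = assms(3)[symmetric] assms(4)[symmetric] assms(5)[symmetric]
  have mem: "\<And>x. x \<in> carrier V \<Longrightarrow> f x \<in> carrier W" using assms(2) by auto
  show ?thesis
  proof (rule vs_criteria; (intro allI ballI impI; (elim conjE)?)?)
    show "field K" by (rule V.field_axioms)
    show "\<zero>\<^bsub>W\<^esub> \<in> carrier W" using mem[of "\<zero>\<^bsub>V\<^esub>"] assms(5) by simp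
    fix v assume "v \<in> carrier W" then obtain x where x: "x \<in> carrier V" "v = f x" using W by blast
    show "\<exists>neg_v\<in>carrier W. v \<oplus>\<^bsub>W\<^esub> neg_v = \<zero>\<^bsub>W\<^esub>"
      using x mem by (intro bexI[of _ "f (\<ominus>\<^bsub>V\<^esub> x)"]) (simp_all add: fs V.r_neg)
    show "v \<oplus>\<^bsub>W\<^esub> \<zero>\<^bsub>W\<^esub> = v" "\<one>\<^bsub>K\<^esub> \<odot>\<^bsub>W\<^esub> v = v" using x by (simp_all add: fs)
  next
    fix c v assume "c \<in> carrier K" "v \<in> carrier W" 
    then obtain x where x: "x \<in> carrier V" "v = f x" using W by blast
    then show "c \<odot>\<^bsub>W\<^esub> v \<in> carrier W" using mem \<open>c \<in> carrier K\<close> by (simp add: fs)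
  next
    fix v w assume "v \<in> carrier W" "w \<in> carrier W"
    then obtain x y where "x \<in> carrier V" "v = f x" "y \<in> carrier V" "w = f y" using W by blast
    then show "v \<oplus>\<^bsub>W\<^esub> w \<in> carrier W" "v \<oplus>\<^bsub>W\<^esub> w = w \<oplus>\<^bsub>W\<^esub> v" using mem by (simp_all add: fs V.a_comm)
  next
    fix v w u assume "v \<in> carrier W" "w \<in> carrier W" "u \<in> carrier W"
    then obtain x y z where "x \<in> carrier V" "v = f x" "y \<in> carrier V" "w = f y" "z \<in> carrier V" "u = f z"
      using W by metis
    then show "(v \<oplus>\<^bsub>W\<^esub> w) \<oplus>\<^bsub>W\<^esub> u = v \<oplus>\<^bsub>W\<^esub> (w \<oplus>\<^bsub>W\<^esub> u)" by (simp add: fs V.a_assoc)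
  next
    fix a b v assume ab: "a \<in> carrier K" "b \<in> carrier K" and "v \<in> carrier W"
    then obtain x where x: "x \<in> carrier V" "v = f x" using W by blast
    show "a \<otimes>\<^bsub>K\<^esub> b \<odot>\<^bsub>W\<^esub> v = a \<odot>\<^bsub>W\<^esub> (b \<odot>\<^bsub>W\<^esub> v)" using x ab by (simp add: fs V.smult_assoc1)
    show "(a \<oplus>\<^bsub>K\<^esub> b) \<odot>\<^bsub>W\<^esub> v = a \<odot>\<^bsub>W\<^esub> v \<oplus>\<^bsub>W\<^esub> b \<odot>\<^bsub>W\<^esub> v" using x ab by (simp add: fs V.smult_l_distr)
  next
    fix a v w assume a: "a \<in> carrier K" and "v \<in> carrier W" "w \<in> carrier W"
    then obtain x y where "x \<in> carrier V" "v = f x" "y \<in> carrier V" "w = f y" using W by blast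
    then show "a \<odot>\<^bsub>W\<^esub> (v \<oplus>\<^bsub>W\<^esub> w) = a \<odot>\<^bsub>W\<^esub> v \<oplus>\<^bsub>W\<^esub> a \<odot>\<^bsub>W\<^esub> w" using a by (simp add: fs V.smult_r_distr)
  qed
qed

section \<open>Homogeneous components\<close>

text \<open>
  The summand of degree \<open>i\<close> of \<open>x\<close>, meaningful if \<open>G\<close> is the internal direct sum of the \<open>V i\<close>.
\<close>

definition component :: "('g, 'x) ring_scheme \<Rightarrow> ('i \<Rightarrow> 'g set) \<Rightarrow> 'i \<Rightarrow> 'g \<Rightarrow> 'g" where
  "component G V i x = (THE f. (\<forall>i. f i \<in> V i) \<and> finite {i. f i \<noteq> \<zero>\<^bsub>G\<^esub>} \<and>
     x = finsum G f {i. f i \<noteq> \<zero>\<^bsub>G\<^esub>}) i"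

locale decomposed_group = abelian_group G for G :: "('g, 'x) ring_scheme" (structure) +
  fixes V :: "'i \<Rightarrow> 'g set"
  assumes decomposition: "internal_direct_sum G V"
begin

lemma summand_subgroup: "additive_subgroup (V i) G"
  using decomposition by (simp add: internal_direct_sum_def)

lemma summand_carrier: "x \<in> V i \<Longrightarrow> x \<in> carrier G"
  using additive_subgroup.a_Hcarr[OF summand_subgroup] .

lemma summand_zero: "\<zero> \<in> V i"
  using additive_subgroup.zero_closed[OF summand_subgroup] .

lemma summand_add: "x \<in> V i \<Longrightarrow> y \<in> V i \<Longrightarrow> x \<oplus> y \<in> V i"
  using additive_subgroup.a_closed[OF summand_subgroup] .

lemma component_properties:
  assumes "x \<in> carrier G"
  shows "component G V i x \<in> V i" "finite {i. component G V i x \<noteq> \<zero>}"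
    "x = finsum G (\<lambda>i. component G V i x) {i. component G V i x \<noteq> \<zero>}"
proof -
  have "\<exists>!f. (\<forall>i. f i \<in> V i) \<and> finite {i. f i \<noteq> \<zero>} \<and> x = finsum G f {i. f i \<noteq> \<zero>}"
    using decomposition assms by (simp add: internal_direct_sum_def)
  from theI'[OF this]
  show "component G V i x \<in> V i" "finite {i. component G V i x \<noteq> \<zero>}"
    "x = finsum G (\<lambda>i. component G V i x) {i. component G V i x \<noteq> \<zero>}"
    unfolding component_def by auto
qed

lemma component_carrier: "x \<in> carrier G \<Longrightarrow> component G V i x \<in> carrier G"
  using component_properties(1) summand_carrier by blast

lemma component_unique:
  assumes "\<And>i. f i \<in> V i" "finite S" "\<And>i. i \<notin> S \<Longrightarrow> f i = \<zero>" "x = finsum G f S"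
  shows "component G V i x = f i"
proof -
  have fc: "\<And>i. f i \<in> carrier G" using assms(1) summand_carrier by blast
  have sub: "{i. f i \<noteq> \<zero>} \<subseteq> S" using assms(3) by blast
  have fin: "finite {i. f i \<noteq> \<zero>}" using sub assms(2) by (rule finite_subset)
  have "x = finsum G f {i. f i \<noteq> \<zero>}"
    unfolding assms(4) using fc sub assms(2)
    by (intro add.finprod_mono_neutral_cong_right) auto
  moreover have "x \<in> carrier G" unfolding assms(4) using fc by (intro finsum_closed) auto
  then have "\<exists>!f. (\<forall>i. f i \<in> V i) \<and> finite {i. f i \<noteq> \<zero>} \<and> x = finsum G f {i. f i \<noteq> \<zero>}"
    using decomposition by (simp add: internal_direct_sum_def)
  ultimately have "(THE f. (\<forall>i. f i \<in> V i) \<and> finite {i. f i \<noteq> \<zero>} \<and>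
     x = finsum G f {i. f i \<noteq> \<zero>}) = f"
    using assms(1) fin by (intro the1_equality) auto
  then show ?thesis by (simp add: component_def)
qed

lemma component_eq_finsum:
  assumes "x \<in> carrier G" "finite S" "{i. component G V i x \<noteq> \<zero>} \<subseteq> S"
  shows "x = finsum G (\<lambda>i. component G V i x) S"
proof -
  have "finsum G (\<lambda>i. component G V i x) {i. component G V i x \<noteq> \<zero>} = finsum G (\<lambda>i. component G V i x) S"
    using assms component_carrier by (intro add.finprod_mono_neutral_cong_left) auto
  then show ?thesis using component_properties(3)[OF assms(1)] by simp
qed

lemma component_add:
  assumes "x \<in> carrier G" "y \<in> carrier G"
  shows "component G V i (x \<oplus> y) = component G V i x \<oplus> component G V i y"
proof -
  let ?S = "{i. component G V i x \<noteq> \<zero>} \<union> {i. component G V i y \<noteq> \<zero>}"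
  have fin: "finite ?S" using component_properties(2) assms by simp
  have c: "\<And>i. component G V i x \<in> carrier G" "\<And>i. component G V i y \<in> carrier G"
    using component_carrier assms by auto
  have "x \<oplus> y = finsum G (\<lambda>i. component G V i x) ?S \<oplus> finsum G (\<lambda>i. component G V i y) ?S"
    using component_eq_finsum[OF assms(1) fin] component_eq_finsum[OF assms(2) fin] by simp
  also have "\<dots> = finsum G (\<lambda>i. component G V i x \<oplus> component G V i y) ?S"
    using c by (intro finsum_addf[symmetric]) auto
  finally show ?thesis
    using fin component_properties(1) assms summand_add by (intro component_unique) auto
qed

lemma component_summand:
  assumes "x \<in> V j"
  shows "component G V i x = (if i = j then x else \<zero>)"
  using assms summand_zero summand_carrier
  by (intro component_unique[of "\<lambda>i. if i = j then x else \<zero>" "{j}"]) auto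

lemma component_zero [simp]: "component G V i \<zero> = \<zero>"
  using component_summand[OF summand_zero] by simp

text \<open>
  Additive statements about a graded group need to be checked on homogeneous elements only. Almost
  every manipulation of sums of components below is an instance of this rule.
\<close>

lemma summand_induct [consumes 1, case_names zero add summand]:
  assumes "x \<in> carrier G" "Q \<zero>"
    "\<And>x y. x \<in> carrier G \<Longrightarrow> y \<in> carrier G \<Longrightarrow> Q x \<Longrightarrow> Q y \<Longrightarrow> Q (x \<oplus> y)"
    "\<And>i x. x \<in> V i \<Longrightarrow> Q x"
  shows "Q x"
proof -
  have "finsum G f S \<in> carrier G \<and> Q (finsum G f S)" if "finite S" "\<And>i. f i \<in> V i" for f :: "'i \<Rightarrow> 'g" and S
    using that
  proof (induction S rule: finite_induct)
    case (insert j S)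
    have "f \<in> S \<rightarrow> carrier G" "f j \<in> carrier G" using insert summand_carrier by auto
    moreover from this(1) have "finsum G f S \<in> carrier G" by (rule finsum_closed)
    ultimately show ?case using insert assms(3)[of "f j" "finsum G f S"] assms(4)[of "f j" j] by simp
  qed (use assms in auto)
  from this[of _ "\<lambda>i. component G V i x"] show ?thesis
    using component_properties[OF assms(1)] by metis
qed

lemma component_0_imp_0: "x \<in> carrier G \<Longrightarrow> (\<And>i. component G V i x = \<zero>) \<Longrightarrow> x = \<zero>"
  using component_properties(3)[of x] by simp

end

section \<open>Modules with homogeneous projections\<close>

lemma (in left_module) smult_zero: "a \<in> carrier R \<Longrightarrow> a \<odot>\<^bsub>M\<^esub> \<zero>\<^bsub>M\<^esub> = \<zero>\<^bsub>M\<^esub>"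
  using smult_r_distr[of a "\<zero>\<^bsub>M\<^esub>" "\<zero>\<^bsub>M\<^esub>"] smult_closed[of a "\<zero>\<^bsub>M\<^esub>"]
  by (metis M.add.l_cancel_one' M.zero_closed M.l_zero)

lemma (in left_module) zero_smult: "x \<in> carrier M \<Longrightarrow> \<zero>\<^bsub>R\<^esub> \<odot>\<^bsub>M\<^esub> x = \<zero>\<^bsub>M\<^esub>"
  using smult_l_distr[of "\<zero>\<^bsub>R\<^esub>" "\<zero>\<^bsub>R\<^esub>" x] smult_closed[of "\<zero>\<^bsub>R\<^esub>" x]
  by (metis M.add.l_cancel_one' R.zero_closed R.l_zero)

lemma (in left_module) neg_smult:
  "a \<in> carrier R \<Longrightarrow> x \<in> carrier M \<Longrightarrow> (\<ominus>\<^bsub>R\<^esub> a) \<odot>\<^bsub>M\<^esub> x = \<ominus>\<^bsub>M\<^esub> (a \<odot>\<^bsub>M\<^esub> x)"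
proof -
  assume a: "a \<in> carrier R" and x: "x \<in> carrier M"
  have "(\<ominus>\<^bsub>R\<^esub> a) \<odot>\<^bsub>M\<^esub> x \<oplus>\<^bsub>M\<^esub> a \<odot>\<^bsub>M\<^esub> x = \<zero>\<^bsub>M\<^esub>"
    using a x by (simp flip: smult_l_distr add: R.l_neg zero_smult)
  then show ?thesis using a x smult_closed M.minus_equality by simp
qed

context elementary_algebra
begin

lemma grade_decomposed: "decomposed_group A (grade A)"
  using is_abelian_group grading by (simp add: decomposed_group_def decomposed_group_axioms_def)

sublocale gr: decomposed_group A "grade A"
  by (rule grade_decomposed)

lemma scalar_carrier [simp]: "c \<in> carrier K \<Longrightarrow> c \<odot>\<^bsub>A\<^esub> \<one>\<^bsub>A\<^esub> \<in> carrier A"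
  by simp

lemma scalar_central:
  "c \<in> carrier K \<Longrightarrow> a \<in> carrier A \<Longrightarrow> (c \<odot>\<^bsub>A\<^esub> \<one>\<^bsub>A\<^esub>) \<otimes>\<^bsub>A\<^esub> a = a \<otimes>\<^bsub>A\<^esub> (c \<odot>\<^bsub>A\<^esub> \<one>\<^bsub>A\<^esub>)"
  by (simp add: smult_mult_left smult_mult_right)

lemma scalar_mult:
  "c \<in> carrier K \<Longrightarrow> a \<in> carrier A \<Longrightarrow> (c \<odot>\<^bsub>A\<^esub> \<one>\<^bsub>A\<^esub>) \<otimes>\<^bsub>A\<^esub> a = c \<odot>\<^bsub>A\<^esub> a"
  by (simp add: smult_mult_left)

lemma e_carrier [simp]: "e i \<in> carrier A"
  using primitive[of i] by (simp add: primitive_idempotent_def idempotent_def)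

lemma e_idem [simp]: "e i \<otimes>\<^bsub>A\<^esub> e i = e i"
  using primitive[of i] by (simp add: primitive_idempotent_def idempotent_def)

lemma e_nonzero: "e i \<noteq> \<zero>\<^bsub>A\<^esub>"
  using primitive[of i] by (simp add: primitive_idempotent_def)

lemma e_orth: "i \<noteq> j \<Longrightarrow> e i \<otimes>\<^bsub>A\<^esub> e j = \<zero>\<^bsub>A\<^esub>"
  using orthogonal[of i j] by (simp add: orthogonal_elems_def)

text \<open>
  The degree 0 part is spanned by the idempotents. Applied to the identity element, the rule plays
  the role of the decomposition of 1 into the sum of the \<open>e i\<close>.
\<close>

lemma grade_zero_induct [consumes 1, case_names zero add line]:
  assumes "u \<in> grade A 0" "Q \<zero>\<^bsub>A\<^esub>"
    "\<And>x y. x \<in> grade A 0 \<Longrightarrow> y \<in> grade A 0 \<Longrightarrow> Q x \<Longrightarrow> Q y \<Longrightarrow> Q (x \<oplus>\<^bsub>A\<^esub> y)"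
    "\<And>i c. c \<in> carrier K \<Longrightarrow> Q (c \<odot>\<^bsub>A\<^esub> e i)"
  shows "Q u"
proof -
  have "abelian_group (A\<lparr>carrier := grade A 0\<rparr>)"
  proof (rule abelian_groupI)
    note m = gr.summand_carrier[of _ 0]
    have neg: "\<ominus>\<^bsub>A\<^esub> x \<in> grade A 0" if "x \<in> grade A 0" for x
      using additive_subgroup.a_inv_closed[OF gr.summand_subgroup] that is_abelian_group by blast
    show "\<exists>y\<in>carrier (A\<lparr>carrier := grade A 0\<rparr>). y \<oplus>\<^bsub>A\<lparr>carrier := grade A 0\<rparr>\<^esub> x = \<zero>\<^bsub>A\<lparr>carrier := grade A 0\<rparr>\<^esub>"
      if "x \<in> carrier (A\<lparr>carrier := grade A 0\<rparr>)" for x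
      using that m neg by (intro bexI[of _ "\<ominus>\<^bsub>A\<^esub> x"]) (auto simp: l_neg)
  qed (use gr.summand_zero gr.summand_add gr.summand_carrier in \<open>auto simp: a_assoc a_comm a_lcomm\<close>)
  then interpret z: decomposed_group "A\<lparr>carrier := grade A 0\<rparr>" "\<lambda>i. {c \<odot>\<^bsub>A\<^esub> e i | c. c \<in> carrier K}"
    using grade_zero by (simp add: decomposed_group_def decomposed_group_axioms_def)
  show ?thesis
    by (rule z.summand_induct[of u Q]) (use assms in auto)
qed

lemma e_grade: "e i \<in> grade A 0"
proof -
  have "additive_subgroup {c \<odot>\<^bsub>A\<^esub> e i | c. c \<in> carrier K} (A\<lparr>carrier := grade A 0\<rparr>)"
    using grade_zero unfolding internal_direct_sum_def by (elim conjE allE)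
  from additive_subgroup.a_subset[OF this] have "\<one>\<^bsub>K\<^esub> \<odot>\<^bsub>A\<^esub> e i \<in> grade A 0"
    by (auto simp del: smult_one)
  then show ?thesis by simp
qed

lemma scalar_grade: "c \<in> carrier K \<Longrightarrow> c \<odot>\<^bsub>A\<^esub> \<one>\<^bsub>A\<^esub> \<in> grade A 0"
  by (rule grade_smult) (simp_all add: grade_one)

lemma positive_part_induct [consumes 1, case_names zero add homogeneous]:
  assumes "a \<in> positive_part A" "Q \<zero>\<^bsub>A\<^esub>"
    "\<And>x y. x \<in> carrier A \<Longrightarrow> y \<in> carrier A \<Longrightarrow> Q x \<Longrightarrow> Q y \<Longrightarrow> Q (x \<oplus>\<^bsub>A\<^esub> y)"
    "\<And>d x. d \<ge> 1 \<Longrightarrow> x \<in> grade A d \<Longrightarrow> Q x"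
  shows "a \<in> carrier A \<and> Q a"
  using assms(1) unfolding positive_part_def
proof (induction a rule: generate.induct)
  case one then show ?case using assms(2) by simp
next
  case (incl h) then show ?case using assms(4) gr.summand_carrier by auto
next
  case (inv h)
  then obtain d where d: "d \<ge> 1" "h \<in> grade A d" by auto
  have "\<ominus>\<^bsub>A\<^esub> h \<in> grade A d"
    using additive_subgroup.a_inv_closed[OF gr.summand_subgroup] d(2) is_abelian_group by blast
  moreover have "inv\<^bsub>add_monoid A\<^esub> h = \<ominus>\<^bsub>A\<^esub> h" by (simp add: a_inv_def)
  ultimately show ?case using assms(4) d gr.summand_carrier by metis
next
  case (eng h1 h2) then show ?case using assms(3) by simp
qed

lemma positive_part_grade: "d \<ge> 1 \<Longrightarrow> x \<in> grade A d \<Longrightarrow> x \<in> positive_part A"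
  unfolding positive_part_def by (rule generate.incl) auto

lemma positive_part_add: "x \<in> positive_part A \<Longrightarrow> y \<in> positive_part A \<Longrightarrow> x \<oplus>\<^bsub>A\<^esub> y \<in> positive_part A"
  unfolding positive_part_def using generate.eng[of x "add_monoid A" _ y] by simp

lemma positive_part_zero: "\<zero>\<^bsub>A\<^esub> \<in> positive_part A"
  unfolding positive_part_def using generate.one[of "add_monoid A"] by simp

lemma positive_part_carrier: "x \<in> positive_part A \<Longrightarrow> x \<in> carrier A"
  using positive_part_induct[of x "\<lambda>_. True"] by simp

lemma positive_part_left:
  assumes "a \<in> carrier A" "b \<in> positive_part A"
  shows "a \<otimes>\<^bsub>A\<^esub> b \<in> positive_part A"
  using assms(1)
proof (induction a rule: gr.summand_induct)
  case zero then show ?case using assms(2) positive_part_zero positive_part_carrier by simp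
next
  case (add x y) then show ?case using assms(2) positive_part_add positive_part_carrier by (simp add: l_distr)
next
  case (summand m x)
  have x: "x \<in> carrier A" using summand gr.summand_carrier by blast
  from assms(2) have "b \<in> carrier A \<and> x \<otimes>\<^bsub>A\<^esub> b \<in> positive_part A"
  proof (induction b rule: positive_part_induct)
    case zero then show ?case using x positive_part_zero by simp
  next
    case (add x y) then show ?case using \<open>x \<in> carrier A\<close> positive_part_add x by (simp add: r_distr)
  next
    case (homogeneous d b)
    then have b: "b \<in> carrier A" using gr.summand_carrier by blast
    show ?case
    proof (cases "m < 0")
      case True
      then have "x = \<zero>\<^bsub>A\<^esub>" using summand grade_neg by blast
      then show ?thesis using b positive_part_zero by simp
    next
      case False
      then show ?thesis using grade_mult[OF summand homogeneous(2)] homogeneous(1)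
        by (intro positive_part_grade[of "m + d"]) auto
    qed
  qed
  then show ?case ..
qed

end

text \<open>
  Of the grading of a module, the counting argument uses only the projections onto the homogeneous
  components. Unlike an internal direct sum decomposition, such projections are inherited
  by the kernel of a retraction without further work.
\<close>

locale projected_module = elementary_algebra K A e + M: left_module A M
  for K :: "'k ring" and A :: "('k, 'a) graded_module" and e :: "'r::finite \<Rightarrow> 'a"
    and M :: "('a, 'm) graded_module" +
  fixes \<pi> :: "int \<Rightarrow> 'm \<Rightarrow> 'm"
  assumes grade_subgroup: "additive_subgroup (grade M n) M"
    and grade_act: "\<lbrakk>a \<in> grade A m; x \<in> grade M n\<rbrakk> \<Longrightarrow> a \<odot>\<^bsub>M\<^esub> x \<in> grade M (m + n)"
    and proj_grade: "x \<in> carrier M \<Longrightarrow> \<pi> n x \<in> grade M n"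
    and proj_add: "\<lbrakk>x \<in> carrier M; y \<in> carrier M\<rbrakk> \<Longrightarrow> \<pi> n (x \<oplus>\<^bsub>M\<^esub> y) = \<pi> n x \<oplus>\<^bsub>M\<^esub> \<pi> n y"
    and proj_id: "x \<in> grade M n \<Longrightarrow> \<pi> n x = x"
    and proj_act: "\<lbrakk>a \<in> grade A m; x \<in> carrier M\<rbrakk> \<Longrightarrow> \<pi> n (a \<odot>\<^bsub>M\<^esub> x) = a \<odot>\<^bsub>M\<^esub> \<pi> (n - m) x"

lemma graded_decomposed: "graded_left_module A M \<Longrightarrow> decomposed_group M (grade M)"
proof -
  assume "graded_left_module A M"
  then interpret M: graded_left_module A M .
  show ?thesis
    using M.M.abelian_group_axioms M.grading by (simp add: decomposed_group_def decomposed_group_axioms_def)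
qed

lemma graded_imp_projected:
  assumes "elementary_algebra K A e" "graded_left_module A M"
  shows "projected_module K A e M (component M (grade M))"
proof -
  interpret elementary_algebra K A e by fact
  interpret M: graded_left_module A M by fact
  interpret D: decomposed_group M "grade M" using assms(2) by (rule graded_decomposed)
  show ?thesis
  proof (intro projected_module.intro projected_module_axioms.intro)
    show "component M (grade M) n (a \<odot>\<^bsub>M\<^esub> x) = a \<odot>\<^bsub>M\<^esub> component M (grade M) (n - m) x"
      if a: "a \<in> grade A m" and x: "x \<in> carrier M" for a m x n
    proof -
      have ac: "a \<in> carrier A" using a gr.summand_carrier by blast
      from x show ?thesis
      proof (induction x rule: D.summand_induct)
        case zero
        then show ?case using ac by (simp add: M.smult_zero)
      next
        case (add x y)
        then show ?case using ac by (simp add: M.smult_r_distr D.component_add M.smult_closed D.component_carrier)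
      next
        case (summand k x)
        then show ?case
          using D.component_summand[OF M.grade_smult[OF a summand]] D.component_summand[OF summand] M.smult_zero[OF ac]
          by auto
      qed
    qed
  qed (auto simp: elementary_algebra_axioms M.left_module_axioms D.summand_subgroup M.grade_smult
      D.component_properties D.component_add D.component_summand)
qed

text \<open>
  The space \<open>e\<^sub>i M\<^sub>n\<close>; \<open>arrow_part\<close> below is the space \<open>e\<^sub>i A\<^sub>n e\<^sub>j\<close>.
\<close>

definition vertex_part :: "('r \<Rightarrow> 'a) \<Rightarrow> ('a, 'm) graded_module \<Rightarrow> 'r \<Rightarrow> int \<Rightarrow> 'm set" where
  "vertex_part e M i n = {e i \<odot>\<^bsub>M\<^esub> x | x. x \<in> grade M n}"

definition arrow_part :: "('k, 'a) graded_module \<Rightarrow> ('r \<Rightarrow> 'a) \<Rightarrow> 'r \<Rightarrow> 'r \<Rightarrow> int \<Rightarrow> 'a set" where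
  "arrow_part A e i j n = {e i \<otimes>\<^bsub>A\<^esub> a \<otimes>\<^bsub>A\<^esub> e j | a. a \<in> grade A n}"

lemma graded_dim_subdim: "graded_dim K A e M i n = subdim K (restrict_scalars A M) (vertex_part e M i n)"
  by (simp add: graded_dim_def subdim_def vertex_part_def)

lemma (in elementary_algebra) restrict_vectorspace:
  assumes "left_module A M"
  shows "vectorspace K (restrict_scalars A M)"
proof -
  interpret M: left_module A M by fact
  have neg: "\<exists>y\<in>carrier M. x \<oplus>\<^bsub>M\<^esub> y = \<zero>\<^bsub>M\<^esub>" if "x \<in> carrier M" for x
    using that M.M.r_neg by (intro bexI[of _ "\<ominus>\<^bsub>M\<^esub> x"]) auto
  have assoc: "(c \<otimes>\<^bsub>K\<^esub> d) \<odot>\<^bsub>A\<^esub> \<one>\<^bsub>A\<^esub> = (c \<odot>\<^bsub>A\<^esub> \<one>\<^bsub>A\<^esub>) \<otimes>\<^bsub>A\<^esub> (d \<odot>\<^bsub>A\<^esub> \<one>\<^bsub>A\<^esub>)"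
    if "c \<in> carrier K" "d \<in> carrier K" for c d
    using that by (simp add: scalar_mult smult_assoc1)
  show ?thesis
    unfolding restrict_scalars_def
    by (rule vs_criteria)
      (auto simp: field_axioms neg M.M.a_ac M.smult_closed M.smult_assoc assoc M.smult_one
         M.smult_l_distr M.smult_r_distr smult_l_distr)
qed

context projected_module
begin

abbreviation "RM \<equiv> restrict_scalars A M"

lemma RM_simps [simp]:
  "carrier RM = carrier M" "zero RM = zero M" "add RM = add M"
  "c \<odot>\<^bsub>RM\<^esub> x = (c \<odot>\<^bsub>A\<^esub> \<one>\<^bsub>A\<^esub>) \<odot>\<^bsub>M\<^esub> x"
  by (simp_all add: restrict_scalars_def)

lemma RM_vectorspace: "vectorspace K RM"
  using restrict_vectorspace M.left_module_axioms by blast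

lemma grade_carrier: "x \<in> grade M n \<Longrightarrow> x \<in> carrier M"
  using additive_subgroup.a_Hcarr[OF grade_subgroup] .

lemma grade_M_zero: "\<zero>\<^bsub>M\<^esub> \<in> grade M n"
  using additive_subgroup.zero_closed[OF grade_subgroup] .

lemma grade_M_add: "x \<in> grade M n \<Longrightarrow> y \<in> grade M n \<Longrightarrow> x \<oplus>\<^bsub>M\<^esub> y \<in> grade M n"
  using additive_subgroup.a_closed[OF grade_subgroup] .

lemma grade_scalar: "c \<in> carrier K \<Longrightarrow> x \<in> grade M n \<Longrightarrow> (c \<odot>\<^bsub>A\<^esub> \<one>\<^bsub>A\<^esub>) \<odot>\<^bsub>M\<^esub> x \<in> grade M n"
  using grade_act[OF scalar_grade, of c x n] by simp

lemma proj_carrier: "x \<in> carrier M \<Longrightarrow> \<pi> n x \<in> carrier M"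
  using proj_grade grade_carrier by blast

lemma proj_zero: "\<pi> n \<zero>\<^bsub>M\<^esub> = \<zero>\<^bsub>M\<^esub>"
  using proj_id grade_M_zero by blast

lemma grade_subspace: "subspace K (grade M n) RM"
  by (rule subspaceI[OF RM_vectorspace]) (auto simp: grade_carrier grade_M_zero grade_M_add grade_scalar)

lemma act_linear: "a \<in> carrier A \<Longrightarrow> S \<subseteq> carrier M \<Longrightarrow> linear_on K RM S RM (\<lambda>x. a \<odot>\<^bsub>M\<^esub> x)"
  unfolding linear_on_def
  by (auto simp: M.smult_closed M.smult_r_distr subset_iff scalar_central simp flip: M.smult_assoc)

lemma vertex_part_image: "vertex_part e M i n = (\<lambda>x. e i \<odot>\<^bsub>M\<^esub> x) ` grade M n"
  unfolding vertex_part_def by blast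

lemma vertex_part_subspace: "subspace K (vertex_part e M i n) RM"
  unfolding vertex_part_image
  by (intro subspace_image_on[OF grade_subspace RM_vectorspace] act_linear) (auto simp: grade_carrier)

lemma e_idem_act: "x \<in> carrier M \<Longrightarrow> e i \<odot>\<^bsub>M\<^esub> (e i \<odot>\<^bsub>M\<^esub> x) = e i \<odot>\<^bsub>M\<^esub> x"
  by (simp flip: M.smult_assoc)

lemma vertex_part_iff: "x \<in> vertex_part e M i n \<longleftrightarrow> x \<in> grade M n \<and> e i \<odot>\<^bsub>M\<^esub> x = x"
proof
  assume "x \<in> vertex_part e M i n"
  then obtain y where y: "y \<in> grade M n" "x = e i \<odot>\<^bsub>M\<^esub> y" by (auto simp: vertex_part_def)
  then show "x \<in> grade M n \<and> e i \<odot>\<^bsub>M\<^esub> x = x"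
    using grade_act[OF e_grade, of y n i] grade_carrier by (auto simp: e_idem_act)
qed (auto simp: vertex_part_def intro: exI[of _ x])

lemma vertex_partI: "x \<in> grade M n \<Longrightarrow> e i \<odot>\<^bsub>M\<^esub> x \<in> vertex_part e M i n"
  by (auto simp: vertex_part_def)

lemma vertex_part_carrier: "x \<in> vertex_part e M i n \<Longrightarrow> x \<in> carrier M"
  using vertex_part_iff grade_carrier by blast

text \<open>
  An additive map takes \<open>x\<close> into a subgroup as soon as it does so for all \<open>c (e\<^sub>i x)\<close>, since \<open>x = 1 x\<close> and
  1 lies in the span of the idempotents.
\<close>

lemma one_induct:
  assumes "x \<in> carrier M" "additive_subgroup N M" "f \<in> carrier M \<rightarrow> carrier M"
    "\<And>x y. x \<in> carrier M \<Longrightarrow> y \<in> carrier M \<Longrightarrow> f (x \<oplus>\<^bsub>M\<^esub> y) = f x \<oplus>\<^bsub>M\<^esub> f y"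
    "f \<zero>\<^bsub>M\<^esub> = \<zero>\<^bsub>M\<^esub>"
    "\<And>i c. c \<in> carrier K \<Longrightarrow> f ((c \<odot>\<^bsub>A\<^esub> \<one>\<^bsub>A\<^esub>) \<odot>\<^bsub>M\<^esub> (e i \<odot>\<^bsub>M\<^esub> x)) \<in> N"
  shows "f x \<in> N"
proof -
  have "f (\<one>\<^bsub>A\<^esub> \<odot>\<^bsub>M\<^esub> x) \<in> N"
    using grade_one
  proof (induction rule: grade_zero_induct)
    case zero then show ?case using assms(1,5) additive_subgroup.zero_closed[OF assms(2)] by (simp add: M.zero_smult)
  next
    case (add u v)
    then have "u \<in> carrier A" "v \<in> carrier A" using gr.summand_carrier by auto
    then show ?case using add assms(1,4) additive_subgroup.a_closed[OF assms(2)]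
      by (simp add: M.smult_l_distr M.smult_closed)
  next
    case (line i c)
    have "(c \<odot>\<^bsub>A\<^esub> e i) \<odot>\<^bsub>M\<^esub> x = (c \<odot>\<^bsub>A\<^esub> \<one>\<^bsub>A\<^esub>) \<odot>\<^bsub>M\<^esub> (e i \<odot>\<^bsub>M\<^esub> x)"
      using line assms(1) by (simp add: scalar_mult flip: M.smult_assoc)
    then show ?case using assms(6)[OF line] by simp
  qed
  then show ?thesis using assms(1) by (simp add: M.smult_one)
qed

abbreviation "JM \<equiv> positive_part_mult A M"

lemma JM_generate: "additive_subgroup JM M"
proof -
  have "subgroup JM (add_monoid M)"
    unfolding positive_part_mult_def
    by (rule group.generate_is_subgroup[OF M.M.a_group])
      (auto dest: positive_part_carrier intro!: M.smult_closed)
  then show ?thesis by (simp add: additive_subgroup_def)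
qed

lemma JM_mult: "a \<in> positive_part A \<Longrightarrow> x \<in> carrier M \<Longrightarrow> a \<odot>\<^bsub>M\<^esub> x \<in> JM"
  unfolding positive_part_mult_def by (rule generate.incl) auto

lemma JM_induct [consumes 1, case_names zero add mult]:
  assumes "y \<in> JM" "Q \<zero>\<^bsub>M\<^esub>"
    "\<And>x y. x \<in> JM \<Longrightarrow> y \<in> JM \<Longrightarrow> Q x \<Longrightarrow> Q y \<Longrightarrow> Q (x \<oplus>\<^bsub>M\<^esub> y)"
    "\<And>d a x. d \<ge> 1 \<Longrightarrow> a \<in> grade A d \<Longrightarrow> x \<in> carrier M \<Longrightarrow> Q (a \<odot>\<^bsub>M\<^esub> x)"
  shows "Q y"
proof -
  have mult: "Q (a \<odot>\<^bsub>M\<^esub> x)" if "a \<in> positive_part A" "x \<in> carrier M" for a x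
  proof -
    from that(1) have "a \<in> carrier A \<and> (a \<in> positive_part A \<and> Q (a \<odot>\<^bsub>M\<^esub> x))"
    proof (induction a rule: positive_part_induct)
      case zero then show ?case using that assms(2) positive_part_zero by (simp add: M.zero_smult)
    next
      case (add u v) then show ?case using that assms(3) positive_part_add JM_mult by (simp add: M.smult_l_distr)
    next
      case (homogeneous d u) then show ?case using that assms(4) positive_part_grade by blast
    qed
    then show ?thesis by blast
  qed
  from assms(1) have "y \<in> JM \<and> Q y"
    unfolding positive_part_mult_def
  proof (induction y rule: generate.induct)
    case one then show ?case using assms(2) generate.one[of "add_monoid M"] by simp
  next
    case (incl h)
    then obtain a x where "a \<in> positive_part A" "x \<in> carrier M" "h = a \<odot>\<^bsub>M\<^esub> x" by blast
    then have "Q h" using mult by blast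
    with generate.incl[OF incl] show ?case by blast
  next
    case (inv h)
    then obtain a x where ax: "a \<in> positive_part A" "x \<in> carrier M" "h = a \<odot>\<^bsub>M\<^esub> x" by blast
    have n: "\<ominus>\<^bsub>A\<^esub> a \<in> positive_part A"
      using positive_part_left[of "\<ominus>\<^bsub>A\<^esub> \<one>\<^bsub>A\<^esub>" a] ax(1) positive_part_carrier by (simp add: l_minus)
    have "inv\<^bsub>add_monoid M\<^esub> h = (\<ominus>\<^bsub>A\<^esub> a) \<odot>\<^bsub>M\<^esub> x"
      using M.neg_smult[OF positive_part_carrier[OF ax(1)] ax(2)] ax(3) by (simp add: a_inv_def)
    then have "Q (inv\<^bsub>add_monoid M\<^esub> h)" using mult[OF n ax(2)] by simp
    with generate.inv[OF inv] show ?case by blast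
  next
    case (eng x y) then show ?case
      using assms(3) generate.eng[of x "add_monoid M" _ y] by (simp add: positive_part_mult_def)
  qed
  then show ?thesis ..
qed

lemma JM_carrier: "y \<in> JM \<Longrightarrow> y \<in> carrier M"
  using additive_subgroup.a_Hcarr[OF JM_generate] .

lemma JM_act: "a \<in> carrier A \<Longrightarrow> y \<in> JM \<Longrightarrow> a \<odot>\<^bsub>M\<^esub> y \<in> JM"
proof -
  assume a: "a \<in> carrier A" and "y \<in> JM"
  from this(2) show "a \<odot>\<^bsub>M\<^esub> y \<in> JM"
  proof (induction rule: JM_induct)
    case zero then show ?case using a additive_subgroup.zero_closed[OF JM_generate] by (simp add: M.smult_zero)
  next
    case (add x y) then show ?case
      using a additive_subgroup.a_closed[OF JM_generate] JM_carrier by (simp add: M.smult_r_distr)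
  next
    case (mult d b x) then show ?case
      using a positive_part_left[OF a positive_part_grade] gr.summand_carrier JM_mult
      by (simp flip: M.smult_assoc)
  qed
qed

lemma JM_subspace: "subspace K JM RM"
  using additive_subgroup.zero_closed[OF JM_generate] additive_subgroup.a_closed[OF JM_generate]
  by (intro subspaceI[OF RM_vectorspace]) (auto simp: JM_carrier JM_act)

end

section \<open>The pieces of the algebra\<close>

context elementary_algebra
begin

lemma algebra_vectorspace: "vectorspace K A" ..

lemma mult_linear: "a \<in> carrier A \<Longrightarrow> b \<in> carrier A \<Longrightarrow> S \<subseteq> carrier A \<Longrightarrow>
    linear_on K A S A (\<lambda>x. a \<otimes>\<^bsub>A\<^esub> x \<otimes>\<^bsub>A\<^esub> b)"
  unfolding linear_on_def
  by (auto simp: subset_iff r_distr l_distr smult_mult_left smult_mult_right)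

lemma grade_fd: "fd_subspace K A (grade A n)"
  unfolding fd_subspace_def
  using locally_finite gr.summand_carrier gr.summand_zero gr.summand_add grade_smult
  by (auto intro!: subspaceI[OF algebra_vectorspace])

lemma arrow_part_image: "arrow_part A e i j n = (\<lambda>a. e i \<otimes>\<^bsub>A\<^esub> a \<otimes>\<^bsub>A\<^esub> e j) ` grade A n"
  unfolding arrow_part_def by blast

lemma arrow_part_fd: "fd_subspace K A (arrow_part A e i j n)"
  unfolding arrow_part_image
  by (intro fd_subspace_image[OF grade_fd algebra_vectorspace] mult_linear) (auto simp: gr.summand_carrier)

lemma arrow_part_iff:
  "x \<in> arrow_part A e i j n \<longleftrightarrow> x \<in> grade A n \<and> e i \<otimes>\<^bsub>A\<^esub> x = x \<and> x \<otimes>\<^bsub>A\<^esub> e j = x"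
proof
  assume "x \<in> arrow_part A e i j n"
  then obtain a where a: "a \<in> grade A n" "x = e i \<otimes>\<^bsub>A\<^esub> a \<otimes>\<^bsub>A\<^esub> e j" by (auto simp: arrow_part_def)
  have c: "a \<in> carrier A" using a gr.summand_carrier by blast
  have "x \<in> grade A n" using grade_mult[OF grade_mult[OF e_grade a(1)] e_grade] a(2) by simp
  moreover have "e i \<otimes>\<^bsub>A\<^esub> x = x" using c by (simp add: a(2) m_assoc[symmetric])
  moreover have "x \<otimes>\<^bsub>A\<^esub> e j = x" using c by (simp add: a(2) m_assoc)
  ultimately show "x \<in> grade A n \<and> e i \<otimes>\<^bsub>A\<^esub> x = x \<and> x \<otimes>\<^bsub>A\<^esub> e j = x" by blast
qed (auto simp: arrow_part_def intro!: exI[of _ x])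

lemma arrow_part_carrier: "x \<in> arrow_part A e i j n \<Longrightarrow> x \<in> carrier A"
  using arrow_part_iff gr.summand_carrier by blast

lemma arrow_part_mult:
  assumes "x \<in> arrow_part A e i j m" "y \<in> arrow_part A e j k n"
  shows "x \<otimes>\<^bsub>A\<^esub> y \<in> arrow_part A e i k (m + n)"
  using assms grade_mult[of x m y n] gr.summand_carrier[of x m] gr.summand_carrier[of y n]
  by (auto simp: arrow_part_iff m_assoc simp flip: m_assoc[of "e i"])

lemma arrow_part_zero:
  "arrow_part A e i i 0 = {c \<odot>\<^bsub>A\<^esub> e i | c. c \<in> carrier K}"
  "i \<noteq> j \<Longrightarrow> arrow_part A e i j 0 = {\<zero>\<^bsub>A\<^esub>}"
proof -
  have *: "e i \<otimes>\<^bsub>A\<^esub> u \<otimes>\<^bsub>A\<^esub> e j \<in> (if i = j then {c \<odot>\<^bsub>A\<^esub> e i | c. c \<in> carrier K} else {\<zero>\<^bsub>A\<^esub>})"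
    if "u \<in> grade A 0" for u i j
    using that
  proof (induction u rule: grade_zero_induct)
    case zero show ?case by (auto intro!: exI[of _ "\<zero>\<^bsub>K\<^esub>"])
  next
    case (add x y)
    then have "x \<in> carrier A" "y \<in> carrier A" using gr.summand_carrier by auto
    then show ?case using add.IH by (auto simp: r_distr l_distr simp flip: smult_l_distr split: if_splits)
  next
    case (line k c)
    show ?case
    proof (cases "i = k")
      case True
      then show ?thesis using line e_orth[of k j] by (auto simp: smult_mult_left smult_mult_right)
    next
      case False
      then show ?thesis using line e_orth[of i k] by (auto simp: smult_mult_left smult_mult_right intro!: exI[of _ "\<zero>\<^bsub>K\<^esub>"])
    qed
  qed
  show "arrow_part A e i i 0 = {c \<odot>\<^bsub>A\<^esub> e i | c. c \<in> carrier K}"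
  proof
    show "arrow_part A e i i 0 \<subseteq> {c \<odot>\<^bsub>A\<^esub> e i | c. c \<in> carrier K}"
      using *[of _ i i] unfolding arrow_part_def by auto
    show "{c \<odot>\<^bsub>A\<^esub> e i | c. c \<in> carrier K} \<subseteq> arrow_part A e i i 0"
      by (auto simp: arrow_part_iff grade_smult e_grade smult_mult_left smult_mult_right)
  qed
  assume "i \<noteq> j"
  then show "arrow_part A e i j 0 = {\<zero>\<^bsub>A\<^esub>}"
    using *[of _ i j] gr.summand_zero[of 0] unfolding arrow_part_def by (auto intro!: exI[of _ "\<zero>\<^bsub>A\<^esub>"])
qed

lemma arrow_dim_zero: "subdim K A (arrow_part A e i j 0) = (if i = j then 1 else 0)"
  using subdim_line(2)[OF algebra_vectorspace e_carrier e_nonzero, of _ i] subdim_zero[OF algebra_vectorspace]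
    arrow_part_zero by auto

lemma arrow_part_neg: "n < 0 \<Longrightarrow> arrow_part A e i j n = {\<zero>\<^bsub>A\<^esub>}"
  using grade_neg[of n] by (auto simp: arrow_part_def)

lemma arrow_dim_neg: "n < 0 \<Longrightarrow> subdim K A (arrow_part A e i j n) = 0"
  using arrow_part_neg subdim_zero[OF algebra_vectorspace] by simp

end

section \<open>Generators modulo the radical\<close>

context projected_module
begin

lemma restrict_act_linear:
  assumes "b \<in> carrier M" "S \<subseteq> carrier A"
  shows "linear_on K A S RM (\<lambda>a. a \<odot>\<^bsub>M\<^esub> b)"
  unfolding linear_on_def
proof (intro conjI ballI)
  show "(\<lambda>a. a \<odot>\<^bsub>M\<^esub> b) \<in> S \<rightarrow> carrier RM" using assms by (auto simp: M.smult_closed)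
  show "(x \<oplus>\<^bsub>A\<^esub> y) \<odot>\<^bsub>M\<^esub> b = x \<odot>\<^bsub>M\<^esub> b \<oplus>\<^bsub>RM\<^esub> y \<odot>\<^bsub>M\<^esub> b" if "x \<in> S" "y \<in> S" for x y
    using that assms by (simp add: subset_iff M.smult_l_distr)
  show "(c \<odot>\<^bsub>A\<^esub> x) \<odot>\<^bsub>M\<^esub> b = c \<odot>\<^bsub>RM\<^esub> (x \<odot>\<^bsub>M\<^esub> b)" if "c \<in> carrier K" "x \<in> S" for c x
    using that assms by (auto simp: subset_iff scalar_mult simp flip: M.smult_assoc)
qed

text \<open>
  The dimension of \<open>e\<^sub>i (M / J M)\<^sub>n\<close>, computed inside \<open>M\<close>.
\<close>

definition top_dim :: "'r \<Rightarrow> int \<Rightarrow> nat" where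
  "top_dim i n = subdim K RM (vertex_part e M i n) - subdim K RM (vertex_part e M i n \<inter> JM)"

text \<open>
  Choose lifts \<open>B j m\<close> of bases of the spaces \<open>e\<^sub>j (M / J M)\<^sub>m\<close>. Since the grading is bounded below, an
  induction on the degree shows that \<open>M\<close> is generated by these elements: an element of \<open>J M\<close> of degree
  \<open>n\<close> is a combination of elements of smaller degree. Hence \<open>e\<^sub>i M\<^sub>n\<close> is the sum of the images of the
  spaces \<open>e\<^sub>i A\<^bsub>n-m\<^esub> e\<^sub>j\<close> under right multiplication by the elements of \<open>B j m\<close>.
\<close>

lemma vertex_dim_le:
  assumes bounded: "\<And>m. m < n0 \<Longrightarrow> grade M m = {\<zero>\<^bsub>M\<^esub>}"
    and fd: "\<And>j m. fd_subspace K RM (vertex_part e M j m)"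
  shows "subdim K RM (vertex_part e M i n) \<le>
           (\<Sum>j\<in>UNIV. \<Sum>m=n0..n. subdim K A (arrow_part A e i j (n - m)) * top_dim j m)"
proof -
  have "\<exists>B. finite B \<and> B \<subseteq> vertex_part e M j m \<and> card B \<le> top_dim j m \<and>
      vertex_part e M j m \<subseteq> LinearCombinations.module.span K RM (B \<union> (vertex_part e M j m \<inter> JM))" for j m
    unfolding top_dim_def
    by (rule complement_generators[OF fd subspace_Int[OF vertex_part_subspace JM_subspace]]) blast
  then obtain B where B: "\<And>j m. finite (B j m)" "\<And>j m. B j m \<subseteq> vertex_part e M j m"
    "\<And>j m. card (B j m) \<le> top_dim j m"
    "\<And>j m. vertex_part e M j m \<subseteq> LinearCombinations.module.span K RM (B j m \<union> (vertex_part e M j m \<inter> JM))"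
    by metis
  have Bc: "\<And>j m b. b \<in> B j m \<Longrightarrow> b \<in> carrier M" using B(2) vertex_part_carrier by blast
  \<comment> \<open>The space \<open>S i n\<close> is spanned by the products of the chosen elements of degree at most \<open>n\<close> with
    elements of \<open>A\<close>. The claim is that it contains \<open>e\<^sub>i M\<^sub>n\<close>.\<close>
  define I where "I n = (SIGMA j:UNIV. SIGMA m:{n0..n}. B j m)" for n
  define U where "U i n = (\<lambda>(j, m, b). (\<lambda>a. a \<odot>\<^bsub>M\<^esub> b) ` arrow_part A e i j (n - m))" for i n
  define S where "S i n = LinearCombinations.module.span K RM (\<Union>p\<in>I n. U i n p)" for i n
  have Uc: "(\<Union>p\<in>I n. U i n p) \<subseteq> carrier RM" for i n
    using Bc by (auto simp: I_def U_def arrow_part_carrier M.smult_closed)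
  have S_sub: "subspace K (S i n) RM" for i n
    unfolding S_def by (rule subspace_span[OF RM_vectorspace Uc])
  have S_gen: "a \<odot>\<^bsub>M\<^esub> b \<in> S i n" if "b \<in> B j m" "m \<in> {n0..n}" "a \<in> arrow_part A e i j (n - m)" for a b i j m n
  proof -
    have "a \<odot>\<^bsub>M\<^esub> b \<in> (\<Union>p\<in>I n. U i n p)"
      using that unfolding I_def U_def by (intro UN_I[of "(j, m, b)"]) auto
    then show ?thesis unfolding S_def using span_superset[OF RM_vectorspace Uc] by blast
  qed
  have S_mult: "a \<odot>\<^bsub>M\<^esub> w \<in> S i n" if "w \<in> S j (n - d)" "a \<in> arrow_part A e i j d" "d \<ge> 0" for a w i j n d
  proof -
    have ac: "a \<in> carrier A" using that(2) arrow_part_carrier by blast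
    have T: "subspace K {w \<in> carrier RM. a \<odot>\<^bsub>M\<^esub> w \<in> S i n} RM"
      by (rule subspace_kernel_on[OF subspace_carrier[OF RM_vectorspace] RM_vectorspace _ S_sub])
        (rule act_linear, use ac in auto)
    have "S j (n - d) \<subseteq> {w \<in> carrier RM. a \<odot>\<^bsub>M\<^esub> w \<in> S i n}"
      unfolding S_def[of j]
    proof (rule span_minimal[OF T], safe)
      fix k m b assume kmb: "(k, m, b) \<in> I (n - d)"
      fix x assume "x \<in> U j (n - d) (k, m, b)"
      then obtain a' where a': "a' \<in> arrow_part A e j k (n - d - m)" "x = a' \<odot>\<^bsub>M\<^esub> b"
        by (auto simp: U_def)
      have b: "b \<in> B k m" "m \<in> {n0..n - d}" using kmb by (auto simp: I_def)
      have c: "a' \<in> carrier A" "b \<in> carrier M" using a' b Bc arrow_part_carrier by auto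
      then show "x \<in> carrier RM" using a' by (simp add: M.smult_closed)
      have "(a \<otimes>\<^bsub>A\<^esub> a') \<odot>\<^bsub>M\<^esub> b \<in> S i n"
        using arrow_part_mult[OF that(2) a'(1)] b that(3) by (intro S_gen[of b k m]) auto
      then show "a \<odot>\<^bsub>M\<^esub> x \<in> S i n" using ac c a' by (simp add: M.smult_assoc)
    qed
    then show ?thesis using that(1) by blast
  qed
  have main: "vertex_part e M i n \<subseteq> S i n" for i n
  \<comment> \<open>The summand 1 keeps the measure positive in degree \<open>n0\<close>, where the smaller degrees are below the bound.\<close>
  proof (induction "nat (n - n0 + 1)" arbitrary: n i rule: less_induct)
    case less
    show ?case
    proof (cases "n < n0")
      case True
      then have "grade M n = {\<zero>\<^bsub>M\<^esub>}" by (rule bounded)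
      then have "vertex_part e M i n \<subseteq> {\<zero>\<^bsub>M\<^esub>}" using vertex_part_iff by blast
      then show ?thesis using subspaceD(3)[OF S_sub[of i n]] by force
    next
      case False
      have "B i n \<subseteq> S i n"
      proof
        fix b assume b: "b \<in> B i n"
        have "e i \<in> arrow_part A e i i (n - n)" by (simp add: arrow_part_iff e_grade)
        then have "e i \<odot>\<^bsub>M\<^esub> b \<in> S i n" using b False by (intro S_gen[of b i n]) auto
        moreover have "e i \<odot>\<^bsub>M\<^esub> b = b" using b B(2) vertex_part_iff by blast
        ultimately show "b \<in> S i n" by simp
      qed
      moreover have "vertex_part e M i n \<inter> JM \<subseteq> S i n"
      proof
        fix y assume y: "y \<in> vertex_part e M i n \<inter> JM"
        \<comment> \<open>An element of \<open>J M\<close> need not be a combination of homogeneous products of degree \<open>n\<close> as it is written;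
          projecting to degree \<open>n\<close> makes the statement additive.\<close>
        let ?f = "\<lambda>y. e i \<odot>\<^bsub>M\<^esub> \<pi> n y"
        have "y \<in> JM" using y by blast
        then have "?f y \<in> S i n"
        proof (induction y rule: JM_induct)
          case zero
          then show ?case using subspaceD(3)[OF S_sub[of i n]] by (simp add: proj_zero M.smult_zero)
        next
          case (add x y)
          then show ?case using subspaceD(4)[OF S_sub[of i n]]
            by (simp add: proj_add JM_carrier M.smult_r_distr proj_carrier)
        next
          case (mult d a x)
          let ?z = "\<pi> (n - d) x"
          have a: "a \<in> carrier A" using mult gr.summand_carrier by blast
          have z: "?z \<in> grade M (n - d)" "?z \<in> carrier M" using mult proj_grade proj_carrier by auto
          have sg: "additive_subgroup (S i n) M"
          proof (rule additive_subgroupI, rule group.subgroupI[OF M.M.a_group])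
            show "S i n \<subseteq> carrier (add_monoid M)" using subspaceD(2)[OF S_sub[of i n]] by simp
            show "S i n \<noteq> {}" using subspaceD(3)[OF S_sub[of i n]] by blast
            show "inv\<^bsub>add_monoid M\<^esub> x \<in> S i n" if "x \<in> S i n" for x
              using subspaceD(6)[OF S_sub[of i n] that] by (simp add: a_inv_def m_inv_def)
            show "x \<otimes>\<^bsub>add_monoid M\<^esub> y \<in> S i n" if "x \<in> S i n" "y \<in> S i n" for x y
              using subspaceD(4)[OF S_sub[of i n] that] by simp
          qed
          have "e i \<odot>\<^bsub>M\<^esub> (a \<odot>\<^bsub>M\<^esub> ?z) \<in> S i n"
          proof (rule one_induct[OF z(2) sg, of "\<lambda>z. e i \<odot>\<^bsub>M\<^esub> (a \<odot>\<^bsub>M\<^esub> z)"])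
            show "(\<lambda>z. e i \<odot>\<^bsub>M\<^esub> (a \<odot>\<^bsub>M\<^esub> z)) \<in> carrier M \<rightarrow> carrier M"
              using a by (auto simp: M.smult_closed)
            show "e i \<odot>\<^bsub>M\<^esub> (a \<odot>\<^bsub>M\<^esub> (x \<oplus>\<^bsub>M\<^esub> y)) =
                e i \<odot>\<^bsub>M\<^esub> (a \<odot>\<^bsub>M\<^esub> x) \<oplus>\<^bsub>M\<^esub> e i \<odot>\<^bsub>M\<^esub> (a \<odot>\<^bsub>M\<^esub> y)"
              if "x \<in> carrier M" "y \<in> carrier M" for x y
              using a that by (simp add: M.smult_r_distr M.smult_closed)
            show "e i \<odot>\<^bsub>M\<^esub> (a \<odot>\<^bsub>M\<^esub> \<zero>\<^bsub>M\<^esub>) = \<zero>\<^bsub>M\<^esub>" using a by (simp add: M.smult_zero)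
            fix j c assume c: "c \<in> carrier K"
            have ez: "e j \<odot>\<^bsub>M\<^esub> ?z \<in> vertex_part e M j (n - d)" using z by (intro vertex_partI)
            have "vertex_part e M j (n - d) \<subseteq> S j (n - d)" 
            proof (rule less)
              show "nat (n - d - n0 + 1) < nat (n - n0 + 1)" using False mult(1) by auto
            qed
            then have w: "e j \<odot>\<^bsub>M\<^esub> ?z \<in> S j (n - d)" using ez by blast
            have "e i \<otimes>\<^bsub>A\<^esub> a \<otimes>\<^bsub>A\<^esub> e j \<in> arrow_part A e i j d"
              using mult(2) by (auto simp: arrow_part_def)
            from S_mult[OF w this] have "(e i \<otimes>\<^bsub>A\<^esub> a \<otimes>\<^bsub>A\<^esub> e j) \<odot>\<^bsub>M\<^esub> (e j \<odot>\<^bsub>M\<^esub> ?z) \<in> S i n"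
              using mult(1) by simp
            then have "(c \<odot>\<^bsub>A\<^esub> \<one>\<^bsub>A\<^esub>) \<odot>\<^bsub>M\<^esub> ((e i \<otimes>\<^bsub>A\<^esub> a \<otimes>\<^bsub>A\<^esub> e j) \<odot>\<^bsub>M\<^esub> (e j \<odot>\<^bsub>M\<^esub> ?z)) \<in> S i n"
              using subspaceD(5)[OF S_sub[of i n] c] by simp
            moreover have "e i \<odot>\<^bsub>M\<^esub> (a \<odot>\<^bsub>M\<^esub> ((c \<odot>\<^bsub>A\<^esub> \<one>\<^bsub>A\<^esub>) \<odot>\<^bsub>M\<^esub> (e j \<odot>\<^bsub>M\<^esub> ?z))) =
                (c \<odot>\<^bsub>A\<^esub> \<one>\<^bsub>A\<^esub>) \<odot>\<^bsub>M\<^esub> ((e i \<otimes>\<^bsub>A\<^esub> a \<otimes>\<^bsub>A\<^esub> e j) \<odot>\<^bsub>M\<^esub> (e j \<odot>\<^bsub>M\<^esub> ?z))"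
              using a c z(2)
              by (simp add: m_assoc smult_mult_left smult_mult_right flip: M.smult_assoc)
            ultimately show "e i \<odot>\<^bsub>M\<^esub> (a \<odot>\<^bsub>M\<^esub> ((c \<odot>\<^bsub>A\<^esub> \<one>\<^bsub>A\<^esub>) \<odot>\<^bsub>M\<^esub> (e j \<odot>\<^bsub>M\<^esub> ?z))) \<in> S i n" by simp
          qed
          then show ?case using mult by (simp add: proj_act)
        qed
        moreover have "?f y = y" using y by (simp add: vertex_part_iff proj_id)
        ultimately show "y \<in> S i n" by simp
      qed
      ultimately have "LinearCombinations.module.span K RM (B i n \<union> (vertex_part e M i n \<inter> JM)) \<subseteq> S i n"
        by (intro span_minimal[OF S_sub]) blast
      then show ?thesis using B(4)[of i n] by blast
    qed
  qed
  have finI: "finite (I n)" unfolding I_def using B(1) by auto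
  have Ufd: "fd_subspace K RM (U i n p)" and Udim:
    "subdim K RM (U i n p) \<le> subdim K A (arrow_part A e i (fst p) (n - fst (snd p)))" if p: "p \<in> I n" for p
  proof -
    obtain j m b where jmb: "p = (j, m, b)" by (cases p)
    have "b \<in> carrier M" using p Bc by (auto simp: jmb I_def)
    then have lin: "linear_on K A (arrow_part A e i j (n - m)) RM (\<lambda>a. a \<odot>\<^bsub>M\<^esub> b)"
      by (rule restrict_act_linear) (auto simp: arrow_part_carrier)
    show "fd_subspace K RM (U i n p)"
      unfolding U_def jmb using fd_subspace_image[OF arrow_part_fd RM_vectorspace lin] by simp
    show "subdim K RM (U i n p) \<le> subdim K A (arrow_part A e i (fst p) (n - fst (snd p)))"
      unfolding U_def jmb using subdim_rank_nullity[OF arrow_part_fd RM_vectorspace lin] by simp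
  qed
  have "subdim K RM (vertex_part e M i n) \<le> (\<Sum>p\<in>I n. subdim K RM (U i n p))"
    by (rule subdim_le_sum(2)[OF RM_vectorspace vertex_part_subspace finI])
      (use Ufd main[of i n] S_def in auto)
  also have "\<dots> \<le> (\<Sum>p\<in>I n. subdim K A (arrow_part A e i (fst p) (n - fst (snd p))))"
    by (intro sum_mono Udim)
  also have "\<dots> = (\<Sum>j\<in>UNIV. \<Sum>m=n0..n. \<Sum>b\<in>B j m. subdim K A (arrow_part A e i j (n - m)))"
  proof -
    have "(\<Sum>m=n0..n. \<Sum>b\<in>B j m. subdim K A (arrow_part A e i j (n - m))) =
        (\<Sum>q\<in>(SIGMA m:{n0..n}. B j m). subdim K A (arrow_part A e i j (n - fst q)))" for j
      using B(1) by (subst sum.Sigma) (auto simp: case_prod_unfold)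
    moreover have "finite (SIGMA m:{n0..n}. B j m)" for j using B(1) by auto
    ultimately show ?thesis unfolding I_def by (simp only:) (subst sum.Sigma; simp add: case_prod_unfold)
  qed
  also have "\<dots> \<le> (\<Sum>j\<in>UNIV. \<Sum>m=n0..n. subdim K A (arrow_part A e i j (n - m)) * top_dim j m)"
    using B(3) by (intro sum_mono) (simp add: mult.commute)
  finally show ?thesis .
qed

end

section \<open>Homomorphisms\<close>

locale projected_hom = M: projected_module K A e M \<pi>M + N: projected_module K A e N \<pi>N
  for K :: "'k ring" and A :: "('k, 'a) graded_module" and e :: "'r::finite \<Rightarrow> 'a"
    and M :: "('a, 'm) graded_module" and \<pi>M and N :: "('a, 'n) graded_module" and \<pi>N +
  fixes f
  assumes hom: "f \<in> graded_hom A M N"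
begin

lemma hom_closed: "x \<in> carrier M \<Longrightarrow> f x \<in> carrier N"
  and hom_add: "x \<in> carrier M \<Longrightarrow> y \<in> carrier M \<Longrightarrow> f (x \<oplus>\<^bsub>M\<^esub> y) = f x \<oplus>\<^bsub>N\<^esub> f y"
  and hom_act: "a \<in> carrier A \<Longrightarrow> x \<in> carrier M \<Longrightarrow> f (a \<odot>\<^bsub>M\<^esub> x) = a \<odot>\<^bsub>N\<^esub> f x"
  and hom_grade: "x \<in> grade M n \<Longrightarrow> f x \<in> grade N n"
  using hom by (auto simp: graded_hom_def image_subset_iff)

lemma hom_linear: "S \<subseteq> carrier M \<Longrightarrow> linear_on K (restrict_scalars A M) S (restrict_scalars A N) f"
  by (auto simp: linear_on_def hom_closed hom_add hom_act subset_iff)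

lemma hom_zero: "f \<zero>\<^bsub>M\<^esub> = \<zero>\<^bsub>N\<^esub>"
  using linear_on_zero[OF subspace_carrier[OF M.RM_vectorspace] N.RM_vectorspace hom_linear] by simp

lemma hom_vertex_part: "x \<in> vertex_part e M i n \<Longrightarrow> f x \<in> vertex_part e N i n"
  using hom_act[of "e i" x] by (auto simp: M.vertex_part_iff N.vertex_part_iff hom_grade M.grade_carrier)

lemma hom_positive_part: 
  assumes "y \<in> positive_part_mult A M" shows "f y \<in> positive_part_mult A N"
  using assms
proof (induction y rule: M.JM_induct)
  case zero then show ?case using hom_zero additive_subgroup.zero_closed[OF N.JM_generate] by simp
next
  case (add x y) then show ?case
    using additive_subgroup.a_closed[OF N.JM_generate] M.JM_carrier by (simp add: hom_add)
next
  case (mult d a x) then show ?case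
    using M.positive_part_grade M.gr.summand_carrier by (simp add: hom_act hom_closed N.JM_mult)
qed

end

section \<open>Direct summands\<close>

text \<open>
  A module \<open>P\<close> that is a direct summand of \<open>F\<close>. The kernel of \<open>\<rho>\<close> is the complementary summand.
\<close>

locale module_splitting = \<rho>: projected_hom K A e F \<pi>F P \<pi>P \<rho> + \<iota>: projected_hom K A e P \<pi>P F \<pi>F \<iota>
  for K :: "'k ring" and A :: "('k, 'a) graded_module" and e :: "'r::finite \<Rightarrow> 'a"
    and F :: "('a, 'm) graded_module" and \<pi>F and P :: "('a, 'n) graded_module" and \<pi>P and \<rho> \<iota> +
  assumes retraction: "y \<in> carrier P \<Longrightarrow> \<rho> (\<iota> y) = y"
    and retraction_proj: "x \<in> carrier F \<Longrightarrow> \<rho> (\<pi>F n x) = \<pi>P n (\<rho> x)"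
    and fdF: "fd_subspace K (restrict_scalars A F) (vertex_part e F i n)"
begin

definition complement :: "('a, 'm) graded_module" where
  "complement = F\<lparr>carrier := {x \<in> carrier F. \<rho> x = \<zero>\<^bsub>P\<^esub>}, 
     grade := (\<lambda>n. {x \<in> grade F n. \<rho> x = \<zero>\<^bsub>P\<^esub>})\<rparr>"

lemma complement_simps [simp]:
  "carrier complement = {x \<in> carrier F. \<rho> x = \<zero>\<^bsub>P\<^esub>}" "zero complement = zero F" "add complement = add F"
  "module.smult complement = module.smult F" "grade complement n = {x \<in> grade F n. \<rho> x = \<zero>\<^bsub>P\<^esub>}"
  by (simp_all add: complement_def)

lemma complement_left_module: "left_module A complement"
proof (intro left_module.intro left_module_axioms.intro)
  show "ring A" by (rule \<rho>.M.ring_axioms)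
  have neg: "\<rho> (\<ominus>\<^bsub>F\<^esub> x) = \<zero>\<^bsub>P\<^esub>" if "x \<in> carrier F" "\<rho> x = \<zero>\<^bsub>P\<^esub>" for x
  proof -
    have "\<ominus>\<^bsub>F\<^esub> x = (\<ominus>\<^bsub>A\<^esub> \<one>\<^bsub>A\<^esub>) \<odot>\<^bsub>F\<^esub> x"
      using that by (simp add: \<rho>.M.M.neg_smult \<rho>.M.M.smult_one)
    then show ?thesis using that by (simp add: \<rho>.hom_act \<rho>.N.M.smult_zero)
  qed
  show "abelian_group complement"
  proof (rule abelian_groupI)
    show "\<exists>y\<in>carrier complement. y \<oplus>\<^bsub>complement\<^esub> x = \<zero>\<^bsub>complement\<^esub>" if "x \<in> carrier complement" for x
      using that neg by (intro bexI[of _ "\<ominus>\<^bsub>F\<^esub> x"]) (auto simp: \<rho>.M.M.M.l_neg)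
  qed (auto simp: \<rho>.M.M.M.a_ac \<rho>.hom_add \<rho>.hom_zero)
qed (auto simp: \<rho>.M.M.smult_closed \<rho>.hom_act \<rho>.N.M.smult_zero \<rho>.M.M.smult_l_distr
    \<rho>.M.M.smult_r_distr \<rho>.M.M.smult_assoc \<rho>.M.M.smult_one)

lemma complement_projected: "projected_module K A e complement \<pi>F"
proof (intro projected_module.intro projected_module_axioms.intro)
  show "elementary_algebra K A e" by (rule \<rho>.M.elementary_algebra_axioms)
  show "left_module A complement" by (rule complement_left_module)
  interpret C: left_module A complement by (rule complement_left_module)
  show "additive_subgroup (grade complement n) complement" for n
  proof (rule additive_subgroupI, rule group.subgroupI[OF C.M.a_group])
    fix x assume x: "x \<in> grade complement n"
    then have "x \<in> carrier complement" by (auto simp: \<rho>.M.grade_carrier)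
    then have "\<ominus>\<^bsub>complement\<^esub> x = (\<ominus>\<^bsub>A\<^esub> \<one>\<^bsub>A\<^esub>) \<odot>\<^bsub>complement\<^esub> x"
      by (simp only: C.neg_smult[OF \<rho>.M.one_closed] C.smult_one)
    moreover have "(\<ominus>\<^bsub>A\<^esub> \<one>\<^bsub>A\<^esub>) \<in> grade A 0"
      using additive_subgroup.a_inv_closed[OF \<rho>.M.gr.summand_subgroup] \<rho>.M.grade_one \<rho>.M.is_abelian_group by blast
    ultimately have "\<ominus>\<^bsub>complement\<^esub> x \<in> grade complement n"
      using x \<rho>.M.grade_act[of "\<ominus>\<^bsub>A\<^esub> \<one>\<^bsub>A\<^esub>" 0 x n]
      by (auto simp: \<rho>.hom_act \<rho>.M.grade_carrier \<rho>.N.M.smult_zero)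
    then show "inv\<^bsub>add_monoid complement\<^esub> x \<in> grade complement n" unfolding a_inv_def .
  next
    have "\<zero>\<^bsub>F\<^esub> \<in> grade complement n" by (simp add: \<rho>.M.grade_M_zero \<rho>.hom_zero)
    then show "grade complement n \<noteq> {}" by blast
  qed (auto simp: \<rho>.M.grade_carrier \<rho>.M.grade_M_add \<rho>.hom_add)
qed (auto simp: \<rho>.M.grade_act \<rho>.M.grade_carrier \<rho>.hom_act \<rho>.N.M.smult_zero \<rho>.M.gr.summand_carrier
    \<rho>.M.proj_grade retraction_proj \<rho>.N.proj_zero \<rho>.M.proj_add \<rho>.M.proj_id \<rho>.M.proj_act)

sublocale C: projected_module K A e complement \<pi>F
  by (rule complement_projected)

lemma subdim_complement: "subdim K (restrict_scalars A complement) S = subdim K (restrict_scalars A F) S"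
  by (simp add: subdim_def restrict_scalars_def complement_def)

lemma vertex_part_complement: "vertex_part e complement i n = {x \<in> vertex_part e F i n. \<rho> x = \<zero>\<^bsub>P\<^esub>}"
  by (auto simp: C.vertex_part_iff \<rho>.M.vertex_part_iff)

lemma retraction_vertex_part: "\<rho> ` vertex_part e F i n = vertex_part e P i n"
proof (intro equalityI subsetI)
  fix x assume "x \<in> vertex_part e P i n"
  then show "x \<in> \<rho> ` vertex_part e F i n"
    using \<iota>.hom_vertex_part retraction \<rho>.N.vertex_part_carrier by (metis imageI)
qed (auto intro: \<rho>.hom_vertex_part)

lemma fd_vertex_part: "fd_subspace K (restrict_scalars A P) (vertex_part e P i n)"
  using fd_subspace_image[OF fdF \<rho>.N.RM_vectorspace \<rho>.hom_linear] \<rho>.M.vertex_part_carrier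
  unfolding retraction_vertex_part by blast

lemma fd_vertex_part_complement: "fd_subspace K (restrict_scalars A complement) (vertex_part e complement i n)"
proof -
  have "subspace K (vertex_part e complement i n) (restrict_scalars A F)"
    unfolding vertex_part_complement
    using subspace_kernel_on[OF \<rho>.M.vertex_part_subspace \<rho>.N.RM_vectorspace \<rho>.hom_linear
        subspace_zero[OF \<rho>.N.RM_vectorspace]] \<rho>.M.vertex_part_carrier
    by (simp add: subset_iff)
  then have "fd_subspace K (restrict_scalars A F) (vertex_part e complement i n)"
    by (rule fd_subspace_subset[OF fdF]) (use vertex_part_complement in blast)
  then have "vectorspace.fin_dim K ((restrict_scalars A F)\<lparr>carrier := vertex_part e complement i n\<rparr>)"
    by (simp add: fd_subspace_def)
  moreover have "(restrict_scalars A F)\<lparr>carrier := vertex_part e complement i n\<rparr> =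
      (restrict_scalars A complement)\<lparr>carrier := vertex_part e complement i n\<rparr>"
    by (simp add: restrict_scalars_def complement_def)
  ultimately show ?thesis using C.vertex_part_subspace by (simp add: fd_subspace_def)
qed

lemma subdim_vertex_part:
  "subdim K (restrict_scalars A F) (vertex_part e F i n) =
     subdim K (restrict_scalars A P) (vertex_part e P i n) +
     subdim K (restrict_scalars A complement) (vertex_part e complement i n)"
  using subdim_rank_nullity[OF fdF \<rho>.N.RM_vectorspace \<rho>.hom_linear] \<rho>.M.vertex_part_carrier
  by (simp add: subset_iff retraction_vertex_part subdim_complement vertex_part_complement)

lemma complement_inclusion: "projected_hom K A e complement \<pi>F F \<pi>F (\<lambda>x. x)"
  by (intro projected_hom.intro projected_hom_axioms.intro complement_projected \<rho>.M.projected_module_axioms)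
    (auto simp: graded_hom_def)

lemma complement_projection: "projected_hom K A e F \<pi>F complement \<pi>F (\<lambda>x. x \<ominus>\<^bsub>F\<^esub> \<iota> (\<rho> x))"
proof (intro projected_hom.intro projected_hom_axioms.intro complement_projected \<rho>.M.projected_module_axioms)
  have c: "\<iota> (\<rho> x) \<in> carrier F" if "x \<in> carrier F" for x using that \<iota>.hom_closed \<rho>.hom_closed by blast
  have neg: "\<ominus>\<^bsub>F\<^esub> x = (\<ominus>\<^bsub>A\<^esub> \<one>\<^bsub>A\<^esub>) \<odot>\<^bsub>F\<^esub> x" if "x \<in> carrier F" for x
    using that by (simp add: \<rho>.M.M.neg_smult \<rho>.M.M.smult_one)
  have neg1: "(\<ominus>\<^bsub>A\<^esub> \<one>\<^bsub>A\<^esub>) \<in> grade A 0"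
    using additive_subgroup.a_inv_closed[OF \<rho>.M.gr.summand_subgroup] \<rho>.M.grade_one \<rho>.M.is_abelian_group by blast
  have ker: "\<rho> (x \<ominus>\<^bsub>F\<^esub> \<iota> (\<rho> x)) = \<zero>\<^bsub>P\<^esub>" if x: "x \<in> carrier F" for x
  proof -
    have "\<rho> (x \<ominus>\<^bsub>F\<^esub> \<iota> (\<rho> x)) = \<rho> x \<oplus>\<^bsub>P\<^esub> (\<ominus>\<^bsub>A\<^esub> \<one>\<^bsub>A\<^esub>) \<odot>\<^bsub>P\<^esub> \<rho> x"
      using x c[OF x] by (simp add: a_minus_def neg \<rho>.hom_add \<rho>.hom_act \<rho>.M.M.smult_closed retraction \<rho>.hom_closed)
    also have "\<dots> = \<zero>\<^bsub>P\<^esub>"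
      using \<rho>.hom_closed[OF x] by (simp add: \<rho>.N.M.neg_smult \<rho>.N.M.smult_one \<rho>.N.M.M.r_neg)
    finally show ?thesis .
  qed
  show "(\<lambda>x. x \<ominus>\<^bsub>F\<^esub> \<iota> (\<rho> x)) \<in> graded_hom A F complement"
    unfolding graded_hom_def
  proof (intro CollectI conjI ballI allI)
    show "(\<lambda>x. x \<ominus>\<^bsub>F\<^esub> \<iota> (\<rho> x)) \<in> carrier F \<rightarrow> carrier complement" using c ker by auto
    show "x \<oplus>\<^bsub>F\<^esub> y \<ominus>\<^bsub>F\<^esub> \<iota> (\<rho> (x \<oplus>\<^bsub>F\<^esub> y)) = x \<ominus>\<^bsub>F\<^esub> \<iota> (\<rho> x) \<oplus>\<^bsub>complement\<^esub> (y \<ominus>\<^bsub>F\<^esub> \<iota> (\<rho> y))"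
      if "x \<in> carrier F" "y \<in> carrier F" for x y
      using that c by (simp add: a_minus_def \<rho>.hom_add \<iota>.hom_add \<rho>.hom_closed \<rho>.M.M.M.minus_add \<rho>.M.M.M.a_ac)
    show "a \<odot>\<^bsub>F\<^esub> x \<ominus>\<^bsub>F\<^esub> \<iota> (\<rho> (a \<odot>\<^bsub>F\<^esub> x)) = a \<odot>\<^bsub>complement\<^esub> (x \<ominus>\<^bsub>F\<^esub> \<iota> (\<rho> x))"
      if "a \<in> carrier A" "x \<in> carrier F" for a x
      using that c[OF that(2)] 
      by (simp add: a_minus_def \<rho>.hom_act \<iota>.hom_act \<rho>.hom_closed \<rho>.M.M.smult_r_distr neg \<rho>.M.M.smult_closed
          \<rho>.M.l_minus \<rho>.M.r_minus flip: \<rho>.M.M.smult_assoc)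
    show "(\<lambda>x. x \<ominus>\<^bsub>F\<^esub> \<iota> (\<rho> x)) ` grade F n \<subseteq> grade complement n" for n
    proof (rule image_subsetI)
      fix x assume x: "x \<in> grade F n"
      then have xc: "x \<in> carrier F" by (rule \<rho>.M.grade_carrier)
      have "\<iota> (\<rho> x) \<in> grade F n" using x \<iota>.hom_grade \<rho>.hom_grade by blast
      then show "x \<ominus>\<^bsub>F\<^esub> \<iota> (\<rho> x) \<in> grade complement n"
        using \<rho>.M.grade_act[OF neg1] x ker[OF xc] c[OF xc] \<rho>.M.grade_M_add by (simp add: a_minus_def neg)
    qed
  qed
qed

text \<open>
  Homomorphisms respect \<open>J\<close>-multiples, so \<open>\<rho>\<close> maps \<open>J F\<close> onto \<open>J P\<close>, and \<open>x \<mapsto> x - \<iota> (\<rho> x)\<close> shows that an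
  element of \<open>J F\<close> in the kernel of \<open>\<rho>\<close> is already a \<open>J\<close>-multiple in the kernel.
\<close>

lemma top_dim_splits: "\<rho>.M.top_dim i n = \<rho>.N.top_dim i n + C.top_dim i n"
proof -
  let ?S = "vertex_part e F i n \<inter> positive_part_mult A F"
  have Sc: "?S \<subseteq> carrier F" using \<rho>.M.vertex_part_carrier by blast
  have fdS: "fd_subspace K (restrict_scalars A F) ?S"
    using fd_subspace_subset[OF fdF subspace_Int[OF \<rho>.M.vertex_part_subspace \<rho>.M.JM_subspace]] by blast
  have img: "\<rho> ` ?S = vertex_part e P i n \<inter> positive_part_mult A P"
  proof (intro equalityI subsetI)
    fix x assume x: "x \<in> vertex_part e P i n \<inter> positive_part_mult A P"
    then have "\<iota> x \<in> ?S" using \<iota>.hom_vertex_part \<iota>.hom_positive_part by blast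
    moreover have "x = \<rho> (\<iota> x)" using x retraction \<rho>.N.vertex_part_carrier by force
    ultimately show "x \<in> \<rho> ` ?S" by blast
  qed (auto intro: \<rho>.hom_vertex_part \<rho>.hom_positive_part)
  have ker: "{x \<in> ?S. \<rho> x = \<zero>\<^bsub>P\<^esub>} = vertex_part e complement i n \<inter> positive_part_mult A complement"
  proof (intro equalityI subsetI)
    fix x assume x: "x \<in> {x \<in> ?S. \<rho> x = \<zero>\<^bsub>P\<^esub>}"
    then have "x \<ominus>\<^bsub>F\<^esub> \<iota> (\<rho> x) \<in> positive_part_mult A complement"
      using projected_hom.hom_positive_part[OF complement_projection] by blast
    moreover have "x \<ominus>\<^bsub>F\<^esub> \<iota> (\<rho> x) = x" using x \<iota>.hom_zero Sc by (auto simp: a_minus_def)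
    ultimately show "x \<in> vertex_part e complement i n \<inter> positive_part_mult A complement"
      using x by (simp add: vertex_part_complement)
  next
    fix x assume x: "x \<in> vertex_part e complement i n \<inter> positive_part_mult A complement"
    then have "x \<in> positive_part_mult A F"
      using projected_hom.hom_positive_part[OF complement_inclusion] by blast
    then show "x \<in> {x \<in> ?S. \<rho> x = \<zero>\<^bsub>P\<^esub>}" using x vertex_part_complement by blast
  qed
  have "subdim K (restrict_scalars A F) ?S =
      subdim K (restrict_scalars A P) (vertex_part e P i n \<inter> positive_part_mult A P) +
      subdim K (restrict_scalars A complement) (vertex_part e complement i n \<inter> positive_part_mult A complement)"
    using subdim_rank_nullity[OF fdS \<rho>.N.RM_vectorspace \<rho>.hom_linear[OF Sc]] ker img
    by (simp add: subdim_complement)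
  moreover have "subdim K (restrict_scalars A P) (vertex_part e P i n \<inter> positive_part_mult A P) \<le>
      subdim K (restrict_scalars A P) (vertex_part e P i n)"
    by (intro subdim_mono fd_vertex_part subspace_Int \<rho>.N.vertex_part_subspace \<rho>.N.JM_subspace) blast
  moreover have "subdim K (restrict_scalars A complement) (vertex_part e complement i n \<inter> positive_part_mult A complement) \<le>
      subdim K (restrict_scalars A complement) (vertex_part e complement i n)"
    by (intro subdim_mono fd_vertex_part_complement subspace_Int C.vertex_part_subspace C.JM_subspace) blast
  ultimately show ?thesis
    using subdim_vertex_part[of i n] by (simp add: \<rho>.M.top_dim_def \<rho>.N.top_dim_def C.top_dim_def)
qed

text \<open>
  Both sides of the bound \<open>vertex_dim_le\<close> are additive over \<open>F = P \<oplus> P'\<close>. If the two bounds for \<open>P\<close> and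
  \<open>P'\<close> add up to at most the dimension of \<open>F\<close>, neither of them is strict.
\<close>

lemma vertex_dim_summand:
  assumes bounded: "\<And>m. m < n0 \<Longrightarrow> grade F m = {\<zero>\<^bsub>F\<^esub>}"
    and F_dim: "(\<Sum>j\<in>UNIV. \<Sum>m=n0..n. subdim K A (arrow_part A e i j (n - m)) * \<rho>.M.top_dim j m)
      \<le> subdim K (restrict_scalars A F) (vertex_part e F i n)"
  shows "subdim K (restrict_scalars A P) (vertex_part e P i n) =
    (\<Sum>j\<in>UNIV. \<Sum>m=n0..n. subdim K A (arrow_part A e i j (n - m)) * \<rho>.N.top_dim j m)"
    "\<And>m. m < n0 \<Longrightarrow> grade P m = {\<zero>\<^bsub>P\<^esub>}"
proof -
  show bP: "grade P m = {\<zero>\<^bsub>P\<^esub>}" if "m < n0" for m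
  proof (intro equalityI subsetI)
    fix x assume x: "x \<in> grade P m"
    then have "\<iota> x = \<zero>\<^bsub>F\<^esub>" using \<iota>.hom_grade bounded[OF that] by blast
    then show "x \<in> {\<zero>\<^bsub>P\<^esub>}" using retraction[of x] x \<rho>.N.grade_carrier \<rho>.hom_zero by force
  qed (auto simp: \<rho>.N.grade_M_zero)
  have bC: "grade complement m = {\<zero>\<^bsub>complement\<^esub>}" if "m < n0" for m
    using bounded[OF that] \<rho>.hom_zero by auto
  have P: "subdim K (restrict_scalars A P) (vertex_part e P i n) \<le>
    (\<Sum>j\<in>UNIV. \<Sum>m=n0..n. subdim K A (arrow_part A e i j (n - m)) * \<rho>.N.top_dim j m)"
    by (rule \<rho>.N.vertex_dim_le[OF bP fd_vertex_part])
  have C: "subdim K (restrict_scalars A complement) (vertex_part e complement i n) \<le>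
    (\<Sum>j\<in>UNIV. \<Sum>m=n0..n. subdim K A (arrow_part A e i j (n - m)) * C.top_dim j m)"
    by (rule C.vertex_dim_le[OF bC fd_vertex_part_complement])
  have "(\<Sum>j\<in>UNIV. \<Sum>m=n0..n. subdim K A (arrow_part A e i j (n - m)) * \<rho>.M.top_dim j m) =
      (\<Sum>j\<in>UNIV. \<Sum>m=n0..n. subdim K A (arrow_part A e i j (n - m)) * \<rho>.N.top_dim j m) +
      (\<Sum>j\<in>UNIV. \<Sum>m=n0..n. subdim K A (arrow_part A e i j (n - m)) * C.top_dim j m)"
    by (simp add: top_dim_splits add_mult_distrib2 sum.distrib)
  with P C F_dim subdim_vertex_part[of i n]
  show "subdim K (restrict_scalars A P) (vertex_part e P i n) =
    (\<Sum>j\<in>UNIV. \<Sum>m=n0..n. subdim K A (arrow_part A e i j (n - m)) * \<rho>.N.top_dim j m)"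
    by linarith
qed

end

section \<open>Graded free modules\<close>

context elementary_algebra
begin

definition left_part :: "'r \<Rightarrow> int \<Rightarrow> 'a set" where
  "left_part i n = {e i \<otimes>\<^bsub>A\<^esub> a | a. a \<in> grade A n}"

lemma left_part_iff: "x \<in> left_part i n \<longleftrightarrow> x \<in> grade A n \<and> e i \<otimes>\<^bsub>A\<^esub> x = x"
proof
  assume "x \<in> left_part i n"
  then obtain a where a: "a \<in> grade A n" "x = e i \<otimes>\<^bsub>A\<^esub> a" by (auto simp: left_part_def)
  have "a \<in> carrier A" using a gr.summand_carrier by blast
  then show "x \<in> grade A n \<and> e i \<otimes>\<^bsub>A\<^esub> x = x"
    using grade_mult[OF e_grade a(1)] by (simp add: a(2) m_assoc[symmetric])
qed (auto simp: left_part_def intro!: exI[of _ x])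

lemma mult_left_linear: "a \<in> carrier A \<Longrightarrow> S \<subseteq> carrier A \<Longrightarrow> linear_on K A S A (\<lambda>x. a \<otimes>\<^bsub>A\<^esub> x)"
  unfolding linear_on_def
  by (auto simp: subset_iff r_distr smult_mult_right)

lemma mult_right_linear: "a \<in> carrier A \<Longrightarrow> S \<subseteq> carrier A \<Longrightarrow> linear_on K A S A (\<lambda>x. x \<otimes>\<^bsub>A\<^esub> a)"
  unfolding linear_on_def
  by (auto simp: subset_iff l_distr smult_mult_left)

lemma left_part_fd: "fd_subspace K A (left_part i n)"
proof -
  have "left_part i n = (\<lambda>a. e i \<otimes>\<^bsub>A\<^esub> a) ` grade A n" unfolding left_part_def by blast
  then show ?thesis
    using fd_subspace_image[OF grade_fd algebra_vectorspace mult_left_linear[OF e_carrier], of n i]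
    by (simp add: gr.summand_carrier subset_iff)
qed

lemma left_part_carrier: "x \<in> left_part i n \<Longrightarrow> x \<in> carrier A"
  using left_part_iff gr.summand_carrier by blast

lemma mult_e_eq_0: 
  assumes "x \<in> carrier A" "\<And>j. x \<otimes>\<^bsub>A\<^esub> e j = \<zero>\<^bsub>A\<^esub>"
  shows "x = \<zero>\<^bsub>A\<^esub>"
proof -
  have "x \<otimes>\<^bsub>A\<^esub> \<one>\<^bsub>A\<^esub> = \<zero>\<^bsub>A\<^esub>"
    using grade_one
  proof (induction rule: grade_zero_induct)
    case (add u v)
    then show ?case using assms(1) gr.summand_carrier[of u 0] gr.summand_carrier[of v 0] by (simp add: r_distr)
  qed (use assms in \<open>simp_all add: smult_mult_right\<close>)
  then show ?thesis using assms(1) by simp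
qed

text \<open>
  The right multiplications by the \<open>e j\<close> are projections onto the summands of \<open>e\<^sub>i A\<^sub>n = \<Oplus>\<^sub>j e\<^sub>i A\<^sub>n e\<^sub>j\<close>.
\<close>

lemma left_part_dim: "subdim K A (left_part i n) = (\<Sum>j\<in>UNIV. subdim K A (arrow_part A e i j n))"
proof -
  have img: "(\<lambda>x. x \<otimes>\<^bsub>A\<^esub> e j) ` left_part i n = arrow_part A e i j n" for j
    unfolding left_part_def arrow_part_def by blast
  have sub: "arrow_part A e i j n \<subseteq> left_part i n" for j
    by (auto simp: left_part_iff arrow_part_iff)
  have "fd_subspace K A (left_part i n) \<and>
      subdim K A (left_part i n) = (\<Sum>j\<in>UNIV. subdim K A ((\<lambda>x. x \<otimes>\<^bsub>A\<^esub> e j) ` left_part i n))"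
  proof (rule subdim_projections)
    show "subspace K (left_part i n) A" using left_part_fd by (rule fd_subspaceD)
    show "linear_on K A (left_part i n) A (\<lambda>x. x \<otimes>\<^bsub>A\<^esub> e j)" for j
      by (rule mult_right_linear) (auto simp: left_part_carrier)
    show "fd_subspace K A ((\<lambda>x. x \<otimes>\<^bsub>A\<^esub> e j) ` left_part i n)" for j
      unfolding img by (rule arrow_part_fd)
    show "x \<otimes>\<^bsub>A\<^esub> e j \<in> left_part i n" if "x \<in> left_part i n" for x j
      using that img sub by blast
    show "x \<otimes>\<^bsub>A\<^esub> e j \<otimes>\<^bsub>A\<^esub> e j = x \<otimes>\<^bsub>A\<^esub> e j" if "x \<in> left_part i n" for x j
      using that left_part_carrier by (simp add: m_assoc)
    show "x \<otimes>\<^bsub>A\<^esub> e k \<otimes>\<^bsub>A\<^esub> e j = \<zero>\<^bsub>A\<^esub>" if "j \<noteq> k" "x \<in> left_part i n" for x j k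
      using that left_part_carrier e_orth[of k j] by (simp add: m_assoc)
    show "x = \<zero>\<^bsub>A\<^esub>" if "x \<in> left_part i n" "\<And>j. j \<in> UNIV \<Longrightarrow> x \<otimes>\<^bsub>A\<^esub> e j = \<zero>\<^bsub>A\<^esub>" for x
      using that left_part_carrier mult_e_eq_0 by blast
  qed simp
  then show ?thesis unfolding img by blast
qed

lemma left_part_dim_zero: "subdim K A (left_part i 0) = 1"
  by (simp add: left_part_dim arrow_dim_zero)

definition free_proj :: "nat \<Rightarrow> (nat \<Rightarrow> int) \<Rightarrow> int \<Rightarrow> (nat \<Rightarrow> 'a) \<Rightarrow> nat \<Rightarrow> 'a" where
  "free_proj l s n x = (\<lambda>i. if i < l then component A (grade A) (n - s i) (x i) else \<zero>\<^bsub>A\<^esub>)"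

lemma free_simps [simp]:
  "carrier (graded_free A l s) = {x. (\<forall>i<l. x i \<in> carrier A) \<and> (\<forall>i\<ge>l. x i = \<zero>\<^bsub>A\<^esub>)}"
  "zero (graded_free A l s) = (\<lambda>i. \<zero>\<^bsub>A\<^esub>)"
  "x \<oplus>\<^bsub>graded_free A l s\<^esub> y = (\<lambda>i. x i \<oplus>\<^bsub>A\<^esub> y i)"
  "a \<odot>\<^bsub>graded_free A l s\<^esub> x = (\<lambda>i. a \<otimes>\<^bsub>A\<^esub> x i)"
  "grade (graded_free A l s) n = {x. (\<forall>i<l. x i \<in> grade A (n - s i)) \<and> (\<forall>i\<ge>l. x i = \<zero>\<^bsub>A\<^esub>)}"
  by (simp_all add: graded_free_def)

lemma free_coord: "x \<in> carrier (graded_free A l s) \<Longrightarrow> x i \<in> carrier A"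
  by (cases "i < l") auto

lemma free_left_module: "left_module A (graded_free A l s)"
proof (intro left_module.intro left_module_axioms.intro)
  show "ring A" by (rule ring_axioms)
  note c = free_coord[of _ l s]
  show "abelian_group (graded_free A l s)"
  proof (rule abelian_groupI)
    show "\<exists>y\<in>carrier (graded_free A l s). y \<oplus>\<^bsub>graded_free A l s\<^esub> x = \<zero>\<^bsub>graded_free A l s\<^esub>"
      if "x \<in> carrier (graded_free A l s)" for x
      using that c[OF that] by (intro bexI[of _ "\<lambda>i. \<ominus>\<^bsub>A\<^esub> x i"]) (auto simp: l_neg)
    show "x \<oplus>\<^bsub>graded_free A l s\<^esub> y \<oplus>\<^bsub>graded_free A l s\<^esub> z = x \<oplus>\<^bsub>graded_free A l s\<^esub> (y \<oplus>\<^bsub>graded_free A l s\<^esub> z)"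
      if "x \<in> carrier (graded_free A l s)" "y \<in> carrier (graded_free A l s)" "z \<in> carrier (graded_free A l s)" for x y z
      using c[OF that(1)] c[OF that(2)] c[OF that(3)] by (simp add: a_assoc)
    show "x \<oplus>\<^bsub>graded_free A l s\<^esub> y = y \<oplus>\<^bsub>graded_free A l s\<^esub> x"
      if "x \<in> carrier (graded_free A l s)" "y \<in> carrier (graded_free A l s)" for x y
      using c[OF that(1)] c[OF that(2)] by (simp add: a_comm)
    show "\<zero>\<^bsub>graded_free A l s\<^esub> \<oplus>\<^bsub>graded_free A l s\<^esub> x = x" if "x \<in> carrier (graded_free A l s)" for x
      using c[OF that] by simp
  qed auto
  show "a \<odot>\<^bsub>graded_free A l s\<^esub> x \<in> carrier (graded_free A l s)"
    if "a \<in> carrier A" "x \<in> carrier (graded_free A l s)" for a x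
    using that by simp
  show "\<one>\<^bsub>A\<^esub> \<odot>\<^bsub>graded_free A l s\<^esub> x = x" if "x \<in> carrier (graded_free A l s)" for x
    using c[OF that] by simp
  show "(a \<oplus>\<^bsub>A\<^esub> b) \<odot>\<^bsub>graded_free A l s\<^esub> x = a \<odot>\<^bsub>graded_free A l s\<^esub> x \<oplus>\<^bsub>graded_free A l s\<^esub> b \<odot>\<^bsub>graded_free A l s\<^esub> x"
    if "a \<in> carrier A" "b \<in> carrier A" "x \<in> carrier (graded_free A l s)" for a b x
    using that c[OF that(3)] by (simp add: l_distr)
  show "a \<otimes>\<^bsub>A\<^esub> b \<odot>\<^bsub>graded_free A l s\<^esub> x = a \<odot>\<^bsub>graded_free A l s\<^esub> (b \<odot>\<^bsub>graded_free A l s\<^esub> x)"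
    if "a \<in> carrier A" "b \<in> carrier A" "x \<in> carrier (graded_free A l s)" for a b x
    using that c[OF that(3)] by (simp add: m_assoc)
  show "a \<odot>\<^bsub>graded_free A l s\<^esub> (x \<oplus>\<^bsub>graded_free A l s\<^esub> y) = a \<odot>\<^bsub>graded_free A l s\<^esub> x \<oplus>\<^bsub>graded_free A l s\<^esub> a \<odot>\<^bsub>graded_free A l s\<^esub> y"
    if "a \<in> carrier A" "x \<in> carrier (graded_free A l s)" "y \<in> carrier (graded_free A l s)" for a x y
    using that c[OF that(2)] c[OF that(3)] by (simp add: r_distr)
qed

lemma component_mult: 
  assumes "a \<in> grade A m" "x \<in> carrier A"
  shows "component A (grade A) n (a \<otimes>\<^bsub>A\<^esub> x) = a \<otimes>\<^bsub>A\<^esub> component A (grade A) (n - m) x"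
  using assms(2)
proof (induction x rule: gr.summand_induct)
  case zero
  then show ?case using assms(1) gr.summand_carrier[OF assms(1)]
    by simp
next
  case (add x y)
  then show ?case using gr.summand_carrier[OF assms(1)]
    by (simp add: r_distr gr.component_add gr.component_carrier)
next
  case (summand k x)
  then show ?case using gr.summand_carrier[OF assms(1)] gr.summand_carrier[OF summand]
    by (auto simp: gr.component_summand[OF grade_mult[OF assms(1) summand]] gr.component_summand[OF summand])
qed

lemma grade_neg_closed: "x \<in> grade A n \<Longrightarrow> \<ominus>\<^bsub>A\<^esub> x \<in> grade A n"
  using additive_subgroup.a_inv_closed[OF gr.summand_subgroup] is_abelian_group by blast

lemma free_projected: "projected_module K A e (graded_free A l s) (free_proj l s)"
proof (intro projected_module.intro projected_module_axioms.intro)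
  show "elementary_algebra K A e" by (rule elementary_algebra_axioms)
  show lm: "left_module A (graded_free A l s)" by (rule free_left_module)
  interpret F: left_module A "graded_free A l s" by (rule lm)
  note c = free_coord[of _ l s]
  show "additive_subgroup (grade (graded_free A l s) n) (graded_free A l s)" for n
  proof (rule additive_subgroupI, rule group.subgroupI[OF F.M.a_group])
    fix x assume x: "x \<in> grade (graded_free A l s) n"
    then have xc: "x \<in> carrier (graded_free A l s)" by (auto simp: gr.summand_carrier)
    have "\<ominus>\<^bsub>graded_free A l s\<^esub> x = (\<lambda>i. \<ominus>\<^bsub>A\<^esub> x i)"
      by (rule F.M.minus_equality) (use xc c[OF xc] in \<open>auto simp: l_neg\<close>)
    then have "\<ominus>\<^bsub>graded_free A l s\<^esub> x \<in> grade (graded_free A l s) n"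
      using x by (simp add: grade_neg_closed)
    then show "inv\<^bsub>add_monoid (graded_free A l s)\<^esub> x \<in> grade (graded_free A l s) n" unfolding a_inv_def .
  next
    have "(\<lambda>i. \<zero>\<^bsub>A\<^esub>) \<in> grade (graded_free A l s) n" by (simp add: gr.summand_zero)
    then show "grade (graded_free A l s) n \<noteq> {}" by blast
  qed (auto simp: gr.summand_carrier gr.summand_add)
  show "a \<odot>\<^bsub>graded_free A l s\<^esub> x \<in> grade (graded_free A l s) (m + n)"
    if "a \<in> grade A m" "x \<in> grade (graded_free A l s) n" for a m x n
    using that grade_mult[of a m _ "n - s _"] gr.summand_carrier[of a m] by (force simp: algebra_simps)
  show "free_proj l s n x \<in> grade (graded_free A l s) n" if "x \<in> carrier (graded_free A l s)" for x n
    using that by (simp add: free_proj_def gr.component_properties)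
  show "free_proj l s n (x \<oplus>\<^bsub>graded_free A l s\<^esub> y) = free_proj l s n x \<oplus>\<^bsub>graded_free A l s\<^esub> free_proj l s n y"
    if "x \<in> carrier (graded_free A l s)" "y \<in> carrier (graded_free A l s)" for x y n
    using that by (auto simp: free_proj_def gr.component_add)
  show "free_proj l s n x = x" if "x \<in> grade (graded_free A l s) n" for x n
    using that by (auto simp: free_proj_def gr.component_summand fun_eq_iff)
  show "free_proj l s n (a \<odot>\<^bsub>graded_free A l s\<^esub> x) = a \<odot>\<^bsub>graded_free A l s\<^esub> free_proj l s (n - m) x"
    if "a \<in> grade A m" "x \<in> carrier (graded_free A l s)" for a m x n
    using that gr.summand_carrier[OF that(1)] by (auto simp: free_proj_def component_mult algebra_simps)
qed

definition delta :: "nat \<Rightarrow> 'a \<Rightarrow> nat \<Rightarrow> 'a" where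
  "delta k a = (\<lambda>i. if i = k then a else \<zero>\<^bsub>A\<^esub>)"

lemma free_induct [consumes 1, case_names zero add homogeneous]:
  assumes "x \<in> carrier (graded_free A l s)" "Q \<zero>\<^bsub>graded_free A l s\<^esub>"
    "\<And>x y. x \<in> carrier (graded_free A l s) \<Longrightarrow> y \<in> carrier (graded_free A l s) \<Longrightarrow> Q x \<Longrightarrow> Q y \<Longrightarrow>
      Q (x \<oplus>\<^bsub>graded_free A l s\<^esub> y)"
    "\<And>n x. x \<in> grade (graded_free A l s) n \<Longrightarrow> Q x"
  shows "Q x"
proof -
  have delta: "Q (delta k a)" if "k < l" "a \<in> carrier A" for k a
    using that(2)
  proof (induction a rule: gr.summand_induct)
    case zero
    have "delta k \<zero>\<^bsub>A\<^esub> = \<zero>\<^bsub>graded_free A l s\<^esub>" by (auto simp: delta_def)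
    then show ?case using assms(2) by simp
  next
    case (add a b)
    have "delta k (a \<oplus>\<^bsub>A\<^esub> b) = delta k a \<oplus>\<^bsub>graded_free A l s\<^esub> delta k b"
      using add by (auto simp: delta_def)
    moreover have "delta k a \<in> carrier (graded_free A l s)" "delta k b \<in> carrier (graded_free A l s)"
      using add \<open>k < l\<close> by (auto simp: delta_def)
    ultimately show ?case using assms(3) add by metis
  next
    case (summand d a)
    have "delta k a \<in> grade (graded_free A l s) (d + s k)"
      using summand \<open>k < l\<close> by (auto simp: delta_def gr.summand_zero)
    then show ?case by (rule assms(4))
  qed
  have "m \<le> l \<longrightarrow> Q (\<lambda>i. if i < m then x i else \<zero>\<^bsub>A\<^esub>)" for m
  proof (induction m)
    case 0 then show ?case using assms(2) by simp
  next
    case (Suc m)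
    show ?case
    proof
      assume m: "Suc m \<le> l"
      have xm: "x m \<in> carrier A" using free_coord[OF assms(1)] .
      have "(\<lambda>i. if i < Suc m then x i else \<zero>\<^bsub>A\<^esub>) = 
          (\<lambda>i. if i < m then x i else \<zero>\<^bsub>A\<^esub>) \<oplus>\<^bsub>graded_free A l s\<^esub> delta m (x m)"
        using free_coord[OF assms(1)] by (auto simp: delta_def less_Suc_eq)
      moreover have "(\<lambda>i. if i < m then x i else \<zero>\<^bsub>A\<^esub>) \<in> carrier (graded_free A l s)"
        "delta m (x m) \<in> carrier (graded_free A l s)"
        using free_coord[OF assms(1)] m by (auto simp: delta_def)
      ultimately show "Q (\<lambda>i. if i < Suc m then x i else \<zero>\<^bsub>A\<^esub>)" 
        using assms(3) Suc m delta[of m "x m"] xm by simp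
    qed
  qed
  moreover have "(\<lambda>i. if i < l then x i else \<zero>\<^bsub>A\<^esub>) = x" using assms(1) by auto
  ultimately show ?thesis using order_refl by metis
qed

end

locale graded_free_module = elementary_algebra K A e
  for K :: "'k ring" and A :: "('k, 'a) graded_module" and e :: "'r::finite \<Rightarrow> 'a" +
  fixes l :: nat and s :: "nat \<Rightarrow> int"
begin

abbreviation "F \<equiv> graded_free A l s"

sublocale F: projected_module K A e F "free_proj l s"
  by (rule free_projected)

lemma vertex_part_free:
  "vertex_part e F i n = {x. (\<forall>k<l. x k \<in> left_part i (n - s k)) \<and> (\<forall>k\<ge>l. x k = \<zero>\<^bsub>A\<^esub>)}"
proof -
  have "(\<lambda>k. e i \<otimes>\<^bsub>A\<^esub> x k) = x \<longleftrightarrow> (\<forall>k<l. e i \<otimes>\<^bsub>A\<^esub> x k = x k)"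
    if "\<forall>k\<ge>l. x k = \<zero>\<^bsub>A\<^esub>" for x
    using that by (auto simp: fun_eq_iff) (metis e_carrier not_le r_null)
  then show ?thesis by (auto simp: F.vertex_part_iff left_part_iff)
qed

text \<open>
  A subspace that is given by conditions on the separate coordinates is the direct sum of the
  coordinate spaces. It is used for \<open>e\<^sub>i F\<^sub>n\<close> and for its intersection with \<open>J F\<close>.
\<close>

lemma coordinates_dim:
  assumes "subspace K S (restrict_scalars A F)"
    "\<And>x. x \<in> S \<longleftrightarrow> (\<forall>k<l. x k \<in> U k) \<and> (\<forall>k\<ge>l. x k = \<zero>\<^bsub>A\<^esub>)"
    "\<And>k. k < l \<Longrightarrow> fd_subspace K A (U k)"
  shows "fd_subspace K (restrict_scalars A F) S \<and>
         subdim K (restrict_scalars A F) S = (\<Sum>k<l. subdim K A (U k))"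
proof -
  have Sc: "S \<subseteq> carrier F" using subspaceD(2)[OF assms(1)] by simp
  have U0: "\<zero>\<^bsub>A\<^esub> \<in> U k" if "k < l" for k using subspaceD(3)[OF fd_subspaceD[OF assms(3)[OF that]]] .
  have Uc: "U k \<subseteq> carrier A" if "k < l" for k using subspaceD(2)[OF fd_subspaceD[OF assms(3)[OF that]]] .
  have deltaS: "delta k a \<in> S" if "k < l" "a \<in> U k" for k a
    using that U0 by (auto simp: assms(2) delta_def)
  have img: "(\<lambda>x. delta k (x k)) ` S = delta k ` U k" if k: "k < l" for k
  proof (intro equalityI subsetI)
    fix y assume "y \<in> delta k ` U k"
    then obtain a where a: "a \<in> U k" "y = delta k a" by blast
    then show "y \<in> (\<lambda>x. delta k (x k)) ` S"
      using deltaS[OF k a(1)] by (intro image_eqI[of _ _ "delta k a"]) (auto simp: delta_def)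
  qed (use k assms(2) in auto)
  have lin: "linear_on K A (U k) (restrict_scalars A F) (delta k)" if k: "k < l" for k
    unfolding linear_on_def
  proof (intro conjI ballI)
    show "delta k \<in> U k \<rightarrow> carrier (restrict_scalars A F)" using deltaS[OF k] Sc by auto
    show "delta k (x \<oplus>\<^bsub>A\<^esub> y) = delta k x \<oplus>\<^bsub>restrict_scalars A F\<^esub> delta k y" for x y
      by (auto simp: delta_def)
    show "delta k (c \<odot>\<^bsub>A\<^esub> x) = c \<odot>\<^bsub>restrict_scalars A F\<^esub> delta k x" if "c \<in> carrier K" "x \<in> U k" for c x
      using that Uc[OF k] by (auto simp: delta_def scalar_mult fun_eq_iff)
  qed
  have fd: "fd_subspace K (restrict_scalars A F) (delta k ` U k)" if "k < l" for k
    by (rule fd_subspace_image[OF assms(3)[OF that] F.RM_vectorspace lin[OF that]])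
  have dim: "subdim K (restrict_scalars A F) (delta k ` U k) = subdim K A (U k)" if "k < l" for k
    by (rule subdim_inj_image[OF assms(3)[OF that] F.RM_vectorspace lin[OF that]])
      (auto simp: delta_def dest: fun_cong[of _ _ k])
  have "fd_subspace K (restrict_scalars A F) S \<and> subdim K (restrict_scalars A F) S =
      (\<Sum>k\<in>{..<l}. subdim K (restrict_scalars A F) ((\<lambda>x. delta k (x k)) ` S))"
  proof (rule subdim_projections)
    show "linear_on K (restrict_scalars A F) S (restrict_scalars A F) (\<lambda>x. delta k (x k))"
      if "k \<in> {..<l}" for k
      unfolding linear_on_def using that Sc by (auto simp: delta_def subset_iff)
    show "delta k (x k) \<in> S" if "k \<in> {..<l}" "x \<in> S" for k x
      using that assms(2) deltaS by auto
    show "fd_subspace K (restrict_scalars A F) ((\<lambda>x. delta k (x k)) ` S)" if "k \<in> {..<l}" for k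
      using that fd img by simp
    show "x = \<zero>\<^bsub>restrict_scalars A F\<^esub>" 
      if "x \<in> S" "\<And>k. k \<in> {..<l} \<Longrightarrow> delta k (x k) = \<zero>\<^bsub>restrict_scalars A F\<^esub>" for x
    proof -
      have "x k = \<zero>\<^bsub>A\<^esub>" for k
      proof (cases "k < l")
        case True
        then have "delta k (x k) k = (\<lambda>i. \<zero>\<^bsub>A\<^esub>) k" using that(2)[of k] by simp
        then show ?thesis by (simp add: delta_def)
      qed (use that(1) assms(2) in auto)
      then show ?thesis by auto
    qed
  qed (use assms(1) in \<open>auto simp: delta_def\<close>)
  then show ?thesis using img dim by simp
qed

lemma vertex_part_dim:
  "fd_subspace K (restrict_scalars A F) (vertex_part e F i n) \<and>
   subdim K (restrict_scalars A F) (vertex_part e F i n) = (\<Sum>k<l. subdim K A (left_part i (n - s k)))"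
  by (rule coordinates_dim[OF F.vertex_part_subspace]) (auto simp: vertex_part_free left_part_fd)

lemma positive_part_coord:
  assumes "x \<in> positive_part_mult A F"
  shows "component A (grade A) 0 (x k) = \<zero>\<^bsub>A\<^esub>"
  using assms
proof (induction x rule: F.JM_induct)
  case zero then show ?case by simp
next
  case (add x y)
  then show ?case using free_coord[OF F.JM_carrier] by (simp add: gr.component_add)
next
  case (mult d a x)
  have x: "x k \<in> carrier A" using free_coord[OF mult(3)] .
  have "component A (grade A) (0 - d) (x k) = \<zero>\<^bsub>A\<^esub>"
    using gr.component_properties(1)[OF x, of "0 - d"] grade_neg[of "0 - d"] mult(1) by auto
  then show ?case using component_mult[OF mult(2) x, of 0] gr.summand_carrier[OF mult(2)] by simp
qed

text \<open>
  An element of \<open>J F\<close> has no coordinate component of degree 0 in \<open>A\<close>, which kills the coordinates with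
  \<open>s k = n\<close>; all other coordinates of an element of degree \<open>n\<close> have positive degree or vanish.
\<close>

lemma vertex_part_Int_positive:
  "x \<in> vertex_part e F i n \<inter> positive_part_mult A F \<longleftrightarrow>
     (\<forall>k<l. x k \<in> (if s k = n then {\<zero>\<^bsub>A\<^esub>} else left_part i (n - s k))) \<and> (\<forall>k\<ge>l. x k = \<zero>\<^bsub>A\<^esub>)"
    (is "_ \<longleftrightarrow> ?R")
proof
  assume x: "x \<in> vertex_part e F i n \<inter> positive_part_mult A F"
  have "x k = \<zero>\<^bsub>A\<^esub>" if "k < l" "s k = n" for k
  proof -
    have "x k \<in> grade A 0" using x that by (auto simp: vertex_part_free left_part_iff)
    then show ?thesis using positive_part_coord[of x k] x gr.component_summand[of "x k" 0] by simp
  qed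
  then show ?R using x by (auto simp: vertex_part_free)
next
  assume R: ?R
  have v: "x \<in> vertex_part e F i n"
    using R subspaceD(3)[OF fd_subspaceD[OF left_part_fd]] by (auto simp: vertex_part_free split: if_splits)
  have J0: "\<zero>\<^bsub>F\<^esub> \<in> positive_part_mult A F" using additive_subgroup.zero_closed[OF F.JM_generate] .
  have coord: "delta k (x k) \<in> positive_part_mult A F" if k: "k < l" for k
  proof (cases "n - s k \<ge> 1")
    case True
    then have xk: "x k \<in> grade A (n - s k)" using R k by (auto simp: left_part_iff)
    have "x k \<odot>\<^bsub>F\<^esub> delta k \<one>\<^bsub>A\<^esub> \<in> positive_part_mult A F"
      using k by (intro F.JM_mult positive_part_grade[OF True xk]) (auto simp: delta_def)
    moreover have "x k \<odot>\<^bsub>F\<^esub> delta k \<one>\<^bsub>A\<^esub> = delta k (x k)"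
      using gr.summand_carrier[OF xk] by (auto simp: delta_def)
    ultimately show ?thesis by simp
  next
    case False
    have "x k = \<zero>\<^bsub>A\<^esub>"
    proof (cases "s k = n")
      case False
      then show ?thesis using R k \<open>\<not> n - s k \<ge> 1\<close> grade_neg[of "n - s k"] by (auto simp: left_part_iff)
    qed (use R k in auto)
    then have "delta k (x k) = \<zero>\<^bsub>F\<^esub>" by (auto simp: delta_def)
    then show ?thesis using J0 by simp
  qed
  have "m \<le> l \<longrightarrow> (\<lambda>i. if i < m then x i else \<zero>\<^bsub>A\<^esub>) \<in> positive_part_mult A F" for m
  proof (induction m)
    case 0 then show ?case using J0 by simp
  next
    case (Suc m)
    show ?case
    proof
      assume m: "Suc m \<le> l"
      have "(\<lambda>i. if i < Suc m then x i else \<zero>\<^bsub>A\<^esub>) = 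
          (\<lambda>i. if i < m then x i else \<zero>\<^bsub>A\<^esub>) \<oplus>\<^bsub>F\<^esub> delta m (x m)"
        using free_coord[OF F.vertex_part_carrier[OF v]] by (auto simp: delta_def less_Suc_eq)
      then show "(\<lambda>i. if i < Suc m then x i else \<zero>\<^bsub>A\<^esub>) \<in> positive_part_mult A F"
        using additive_subgroup.a_closed[OF F.JM_generate] Suc m coord[of m] by simp
    qed
  qed
  then have "(\<lambda>i. if i < l then x i else \<zero>\<^bsub>A\<^esub>) \<in> positive_part_mult A F" by blast
  moreover have "(\<lambda>i. if i < l then x i else \<zero>\<^bsub>A\<^esub>) = x" using R by auto
  ultimately show "x \<in> vertex_part e F i n \<inter> positive_part_mult A F" using v by simp
qed

text \<open>
  Each basis element of degree \<open>n\<close> contributes \<open>e\<^sub>i A\<^sub>0\<close>, which is one-dimensional for every \<open>i\<close>.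
\<close>

lemma top_dim_free: "F.top_dim i n = card {k. k < l \<and> s k = n}"
proof -
  have "subdim K (restrict_scalars A F) (vertex_part e F i n \<inter> positive_part_mult A F) =
      (\<Sum>k<l. subdim K A (if s k = n then {\<zero>\<^bsub>A\<^esub>} else left_part i (n - s k)))"
    by (rule conjunct2[OF coordinates_dim[OF subspace_Int[OF F.vertex_part_subspace F.JM_subspace]
            vertex_part_Int_positive]])
      (auto simp: left_part_fd fd_subspace_zero[OF algebra_vectorspace])
  also have "\<dots> = (\<Sum>k<l. if s k = n then 0 else subdim K A (left_part i (n - s k)))"
    by (rule sum.cong) (auto simp: subdim_zero[OF algebra_vectorspace])
  finally have J: "subdim K (restrict_scalars A F) (vertex_part e F i n \<inter> positive_part_mult A F) = \<dots>" .
  have "subdim K (restrict_scalars A F) (vertex_part e F i n) =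
      (\<Sum>k<l. (if s k = n then 1 else 0) + (if s k = n then 0 else subdim K A (left_part i (n - s k))))"
    unfolding conjunct2[OF vertex_part_dim] by (rule sum.cong) (auto simp: left_part_dim_zero)
  also have "\<dots> = card {k. k < l \<and> s k = n} + (\<Sum>k<l. if s k = n then 0 else subdim K A (left_part i (n - s k)))"
  proof -
    have "(\<Sum>k<l. if s k = n then 1 else 0) = card {k. k < l \<and> s k = n}"
      by (simp flip: sum.inter_filter card_eq_sum)
    then show ?thesis by (simp add: sum.distrib)
  qed
  finally show ?thesis using J by (simp add: F.top_dim_def)
qed

lemma free_dim:
  assumes "\<And>k. k < l \<Longrightarrow> n0 \<le> s k"
  shows "subdim K (restrict_scalars A F) (vertex_part e F i n) =
    (\<Sum>j\<in>UNIV. \<Sum>m=n0..n. subdim K A (arrow_part A e i j (n - m)) * F.top_dim j m)"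
proof -
  have "(\<Sum>m=n0..n. subdim K A (arrow_part A e i j (n - m)) * F.top_dim j m) =
      (\<Sum>k<l. subdim K A (arrow_part A e i j (n - s k)))" for j
  proof -
    have "F.top_dim j m = (\<Sum>k<l. if s k = m then 1 else 0)" for m
      unfolding top_dim_free by (simp flip: sum.inter_filter card_eq_sum)
    then have "(\<Sum>m=n0..n. subdim K A (arrow_part A e i j (n - m)) * F.top_dim j m) =
        (\<Sum>m=n0..n. \<Sum>k<l. if s k = m then subdim K A (arrow_part A e i j (n - m)) else 0)"
      by (simp add: sum_distrib_left if_distrib cong: if_cong)
    also have "\<dots> = (\<Sum>k<l. \<Sum>m=n0..n. if s k = m then subdim K A (arrow_part A e i j (n - m)) else 0)"
      by (rule sum.swap)
    also have "\<dots> = (\<Sum>k<l. subdim K A (arrow_part A e i j (n - s k)))"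
      using assms by (intro sum.cong) (auto simp: arrow_dim_neg)
    finally show ?thesis .
  qed
  then show ?thesis
    unfolding conjunct2[OF vertex_part_dim] left_part_dim by (simp add: sum.swap[of _ UNIV])
qed

lemma free_bounded: "\<lbrakk>\<And>k. k < l \<Longrightarrow> n0 \<le> s k; m < n0\<rbrakk> \<Longrightarrow> grade F m = {\<zero>\<^bsub>F\<^esub>}"
proof -
  assume "\<And>k. k < l \<Longrightarrow> n0 \<le> s k" "m < n0"
  then have z: "grade A (m - s k) = {\<zero>\<^bsub>A\<^esub>}" if "k < l" for k using that by (intro grade_neg) force
  then show ?thesis by (auto simp: fun_eq_iff) (meson not_le)
qed

end

section \<open>The top of a module\<close>

context projected_module
begin

lemma JM_abelian_subgroup: "abelian_subgroup JM M"
  using abelian_subgroupI3[OF JM_generate M.M.abelian_group_axioms] .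

abbreviation "top_module \<equiv> graded_quotient M JM"

lemma top_module_simps:
  "carrier top_module = a_rcosets\<^bsub>M\<^esub> JM" "zero top_module = JM" "add top_module = set_add M"
  "a \<odot>\<^bsub>top_module\<^esub> X = (\<Union>x\<in>X. JM +>\<^bsub>M\<^esub> (a \<odot>\<^bsub>M\<^esub> x))"
  "grade top_module n = (\<lambda>x. JM +>\<^bsub>M\<^esub> x) ` grade M n"
  by (simp_all add: graded_quotient_def quotient_module_def module.extend_def graded_module.fields_def)

text \<open>
  The union over a coset in the definition of the quotient action is constant, because \<open>J M\<close> is closed
  under the action.
\<close>

lemma top_module_act:
  assumes "a \<in> carrier A" "x \<in> carrier M"
  shows "a \<odot>\<^bsub>top_module\<^esub> (JM +>\<^bsub>M\<^esub> x) = JM +>\<^bsub>M\<^esub> (a \<odot>\<^bsub>M\<^esub> x)"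
proof -
  interpret J: abelian_subgroup JM M by (rule JM_abelian_subgroup)
  have "JM +>\<^bsub>M\<^esub> (a \<odot>\<^bsub>M\<^esub> y) = JM +>\<^bsub>M\<^esub> (a \<odot>\<^bsub>M\<^esub> x)" if "y \<in> JM +>\<^bsub>M\<^esub> x" for y
  proof -
    obtain j where j: "j \<in> JM" "y = j \<oplus>\<^bsub>M\<^esub> x" using \<open>y \<in> JM +>\<^bsub>M\<^esub> x\<close> by (auto simp: a_r_coset_def')
    have "a \<odot>\<^bsub>M\<^esub> y = a \<odot>\<^bsub>M\<^esub> j \<oplus>\<^bsub>M\<^esub> a \<odot>\<^bsub>M\<^esub> x"
      using j assms JM_carrier by (simp add: M.smult_r_distr)
    moreover have "a \<odot>\<^bsub>M\<^esub> j \<in> JM" using JM_act[OF assms(1) j(1)] .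
    ultimately have "a \<odot>\<^bsub>M\<^esub> y \<in> JM +>\<^bsub>M\<^esub> (a \<odot>\<^bsub>M\<^esub> x)" by (auto simp: a_r_coset_def')
    then show ?thesis using J.a_repr_independence' assms M.smult_closed by metis
  qed
  moreover have "x \<in> JM +>\<^bsub>M\<^esub> x" using J.a_rcos_self[OF assms(2)] .
  ultimately show ?thesis unfolding top_module_simps by blast
qed

lemma top_module_vectorspace: "vectorspace K (restrict_scalars A top_module)"
  and top_module_proj_linear:
    "S \<subseteq> carrier M \<Longrightarrow> linear_on K RM S (restrict_scalars A top_module) (\<lambda>x. JM +>\<^bsub>M\<^esub> x)"
proof -
  interpret J: abelian_subgroup JM M by (rule JM_abelian_subgroup)
  have add: "JM +>\<^bsub>M\<^esub> (x \<oplus>\<^bsub>M\<^esub> y) = set_add M (JM +>\<^bsub>M\<^esub> x) (JM +>\<^bsub>M\<^esub> y)"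
    if "x \<in> carrier M" "y \<in> carrier M" for x y
    using J.a_rcos_sum[OF that] by simp
  have act: "JM +>\<^bsub>M\<^esub> (c \<odot>\<^bsub>RM\<^esub> x) = c \<odot>\<^bsub>restrict_scalars A top_module\<^esub> (JM +>\<^bsub>M\<^esub> x)"
    if "c \<in> carrier K" "x \<in> carrier M" for c x
    using top_module_act[OF scalar_carrier[OF that(1)] that(2)] by (simp add: restrict_scalars_def)
  have im: "(\<lambda>x. JM +>\<^bsub>M\<^esub> x) ` carrier M = a_rcosets\<^bsub>M\<^esub> JM"
    by (auto simp: A_RCOSETS_def')
  show "vectorspace K (restrict_scalars A top_module)"
  proof (rule vectorspace_surj_image[OF RM_vectorspace, of "\<lambda>x. JM +>\<^bsub>M\<^esub> x"])
    show "(\<lambda>x. JM +>\<^bsub>M\<^esub> x) ` carrier RM = carrier (restrict_scalars A top_module)"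
      using im by (simp add: restrict_scalars_def[of A top_module] top_module_simps)
    show "JM +>\<^bsub>M\<^esub> \<zero>\<^bsub>RM\<^esub> = \<zero>\<^bsub>restrict_scalars A top_module\<^esub>"
      using M.M.a_coset_add_zero J.a_subset by (simp add: restrict_scalars_def[of A top_module] top_module_simps)
    show "JM +>\<^bsub>M\<^esub> (x \<oplus>\<^bsub>RM\<^esub> y) = (JM +>\<^bsub>M\<^esub> x) \<oplus>\<^bsub>restrict_scalars A top_module\<^esub> (JM +>\<^bsub>M\<^esub> y)"
      if "x \<in> carrier RM" "y \<in> carrier RM" for x y
      using add that by (simp add: restrict_scalars_def[of A top_module] top_module_simps)
  qed (use act in simp)
  show "linear_on K RM S (restrict_scalars A top_module) (\<lambda>x. JM +>\<^bsub>M\<^esub> x)" if "S \<subseteq> carrier M"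
    unfolding linear_on_def
  proof (intro conjI ballI)
    show "(\<lambda>x. JM +>\<^bsub>M\<^esub> x) \<in> S \<rightarrow> carrier (restrict_scalars A top_module)"
      using that im by (auto simp: restrict_scalars_def[of A top_module] top_module_simps)
    show "JM +>\<^bsub>M\<^esub> (x \<oplus>\<^bsub>RM\<^esub> y) = (JM +>\<^bsub>M\<^esub> x) \<oplus>\<^bsub>restrict_scalars A top_module\<^esub> (JM +>\<^bsub>M\<^esub> y)"
      if "x \<in> S" "y \<in> S" for x y
      using add that \<open>S \<subseteq> carrier M\<close> by (simp add: restrict_scalars_def[of A top_module] top_module_simps subset_iff)
  qed (use act that in blast)
qed

lemma graded_dim_top:
  assumes "fd_subspace K RM (vertex_part e M i n)"
  shows "graded_dim K A e top_module i n = top_dim i n"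
proof -
  interpret J: abelian_subgroup JM M by (rule JM_abelian_subgroup)
  have c: "vertex_part e M i n \<subseteq> carrier M" using vertex_part_carrier by blast
  have im: "vertex_part e top_module i n = (\<lambda>x. JM +>\<^bsub>M\<^esub> x) ` vertex_part e M i n"
  proof -
    have "vertex_part e top_module i n = (\<lambda>x. e i \<odot>\<^bsub>top_module\<^esub> (JM +>\<^bsub>M\<^esub> x)) ` grade M n"
      unfolding vertex_part_def top_module_simps(5) by blast
    also have "\<dots> = (\<lambda>x. JM +>\<^bsub>M\<^esub> (e i \<odot>\<^bsub>M\<^esub> x)) ` grade M n"
      by (intro image_cong refl top_module_act) (auto simp: grade_carrier)
    also have "\<dots> = (\<lambda>x. JM +>\<^bsub>M\<^esub> x) ` vertex_part e M i n"
      unfolding vertex_part_def by blast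
    finally show ?thesis .
  qed
  have coset_zero: "JM +>\<^bsub>M\<^esub> x = JM \<longleftrightarrow> x \<in> JM" if "x \<in> carrier M" for x
    using J.a_rcos_self[OF that] J.a_rcos_const by blast
  have ker: "{x \<in> vertex_part e M i n. JM +>\<^bsub>M\<^esub> x = \<zero>\<^bsub>restrict_scalars A top_module\<^esub>} = vertex_part e M i n \<inter> JM"
    using coset_zero c by (auto simp: restrict_scalars_def[of A top_module] top_module_simps)
  show ?thesis
    using subdim_rank_nullity[OF assms top_module_vectorspace top_module_proj_linear[OF c]]
    by (simp add: graded_dim_subdim im ker top_dim_def)
qed

end

section \<open>Projective modules\<close>

lemma graded_hom_component:
  assumes "elementary_algebra K A e" "graded_left_module A M" "graded_left_module A N"
    "f \<in> graded_hom A M N" "x \<in> carrier M"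
  shows "f (component M (grade M) n x) = component N (grade N) n (f x)"
proof -
  interpret DM: decomposed_group M "grade M" using assms(2) by (rule graded_decomposed)
  interpret DN: decomposed_group N "grade N" using assms(3) by (rule graded_decomposed)
  interpret f: projected_hom K A e M "component M (grade M)" N "component N (grade N)" f
    using graded_imp_projected[OF assms(1,2)] graded_imp_projected[OF assms(1,3)] assms(4)
    by (simp add: projected_hom_def projected_hom_axioms_def)
  show ?thesis
    using assms(5)
  proof (induction x rule: DM.summand_induct)
    case zero then show ?case by (simp add: f.hom_zero)
  next
    case (add x y)
    then show ?case
      by (simp add: f.hom_add DM.component_add DN.component_add DM.component_carrier f.hom_closed)
  next
    case (summand k x)
    then show ?case
      using DM.component_summand[OF summand] DN.component_summand[OF f.hom_grade[OF summand]] f.hom_zero by simp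
  qed
qed

text \<open>
  This is the structure theorem for finitely generated projectives on the level of dimensions; the last
  statement says \<open>Hilb\<^sub>P = C\<^sub>A q\<^sub>P\<close> coefficientwise.
\<close>

lemma projective_structure:
  assumes "elementary_algebra K A e" "fg_graded_projective A P"
  obtains n0 where
    "\<And>m. m < n0 \<Longrightarrow> grade P m = {\<zero>\<^bsub>P\<^esub>}"
    "\<And>i n. fd_subspace K (restrict_scalars A P) (vertex_part e P i n)"
    "\<And>j. finite {m. graded_dim K A e (graded_quotient P (positive_part_mult A P)) j m \<noteq> 0}"
    "\<And>j m. m < n0 \<Longrightarrow> graded_dim K A e (graded_quotient P (positive_part_mult A P)) j m = 0"
    "\<And>i n. graded_dim K A e P i n =
       (\<Sum>j\<in>UNIV. \<Sum>m=n0..n. subdim K A (arrow_part A e i j (n - m)) *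
          graded_dim K A e (graded_quotient P (positive_part_mult A P)) j m)"
proof -
  have glP: "graded_left_module A P" using assms(2) by (simp add: fg_graded_projective_def)
  from assms(2) obtain l s \<iota> \<rho> where
    \<iota>: "\<iota> \<in> graded_hom A P (graded_free A l s)" and \<rho>: "\<rho> \<in> graded_hom A (graded_free A l s) P"
    and ret: "\<forall>x\<in>carrier P. \<rho> (\<iota> x) = x"
    unfolding fg_graded_projective_def by blast
  interpret graded_free_module K A e l s using assms(1) by (simp add: graded_free_module_def)
  let ?\<pi>P = "component P (grade P)"
  interpret P: projected_module K A e P ?\<pi>P using graded_imp_projected[OF assms(1) glP] .
  interpret DP: decomposed_group P "grade P" using glP by (rule graded_decomposed)
  have h\<rho>: "projected_hom K A e F (free_proj l s) P ?\<pi>P \<rho>"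
    using \<rho> F.projected_module_axioms P.projected_module_axioms
    by (simp add: projected_hom_def projected_hom_axioms_def)
  have h\<iota>: "projected_hom K A e P ?\<pi>P F (free_proj l s) \<iota>"
    using \<iota> F.projected_module_axioms P.projected_module_axioms
    by (simp add: projected_hom_def projected_hom_axioms_def)
  interpret \<rho>: projected_hom K A e F "free_proj l s" P ?\<pi>P \<rho> by (rule h\<rho>)
  have comm: "\<rho> (free_proj l s n x) = ?\<pi>P n (\<rho> x)" if "x \<in> carrier F" for x n
    using that
  proof (induction x rule: free_induct)
    case zero
    then show ?case using F.proj_zero \<rho>.hom_zero DP.component_zero by simp
  next
    case (add x y)
    then show ?case
      by (simp only: F.proj_add \<rho>.hom_add F.proj_carrier DP.component_add \<rho>.hom_closed)
  next
    case (homogeneous k x)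
    have "free_proj l s n x = (if n = k then x else \<zero>\<^bsub>F\<^esub>)"
      using homogeneous by (auto simp: free_proj_def gr.component_summand fun_eq_iff)
    then show ?case
      using DP.component_summand[OF \<rho>.hom_grade[OF homogeneous]] \<rho>.hom_zero by (simp del: free_simps)
  qed
  interpret S: module_splitting K A e F "free_proj l s" P ?\<pi>P \<rho> \<iota>
    using h\<rho> h\<iota> ret comm vertex_part_dim by (simp add: module_splitting_def module_splitting_axioms_def del: free_simps)
  define n0 where "n0 = Min (insert 0 (s ` {..<l}))"
  have n0: "n0 \<le> s k" if "k < l" for k unfolding n0_def using that by (intro Min_le) auto
  have top: "graded_dim K A e (graded_quotient P (positive_part_mult A P)) j m = P.top_dim j m" for j m
    by (rule P.graded_dim_top[OF S.fd_vertex_part])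
  have le: "P.top_dim j m \<le> F.top_dim j m" for j m using S.top_dim_splits[of j m] by simp
  have F0: "F.top_dim j m = 0" if "m \<notin> s ` {..<l}" for j m
  proof -
    have "{k. k < l \<and> s k = m} = {}" using that by auto
    then show ?thesis by (simp add: top_dim_free)
  qed
  show thesis
  proof (rule that[of n0])
    show "grade P m = {\<zero>\<^bsub>P\<^esub>}" if "m < n0" for m
      by (rule S.vertex_dim_summand(2)[OF free_bounded[OF n0] _ that])
        (use free_dim[OF n0] in auto)
    show "fd_subspace K (restrict_scalars A P) (vertex_part e P i n)" for i n by (rule S.fd_vertex_part)
    show "finite {m. graded_dim K A e (graded_quotient P (positive_part_mult A P)) j m \<noteq> 0}" for j
    proof (rule finite_subset)
      show "{m. graded_dim K A e (graded_quotient P (positive_part_mult A P)) j m \<noteq> 0} \<subseteq> s ` {..<l}"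
      proof
        fix m assume "m \<in> {m. graded_dim K A e (graded_quotient P (positive_part_mult A P)) j m \<noteq> 0}"
        then have "F.top_dim j m \<noteq> 0" using le[of j m] by (simp add: top)
        with F0[of m j] show "m \<in> s ` {..<l}" by (cases "m \<in> s ` {..<l}") simp_all
      qed
    qed simp
    show "graded_dim K A e (graded_quotient P (positive_part_mult A P)) j m = 0" if "m < n0" for j m
    proof -
      have "m \<notin> s ` {..<l}" using n0 that by force
      then show ?thesis using F0[of m j] le[of j m] by (simp add: top)
    qed
    show "graded_dim K A e P i n =
       (\<Sum>j\<in>UNIV. \<Sum>m=n0..n. subdim K A (arrow_part A e i j (n - m)) *
          graded_dim K A e (graded_quotient P (positive_part_mult A P)) j m)" for i n
      unfolding top graded_dim_subdim[of K A e P]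
      by (rule S.vertex_dim_summand(1)[OF free_bounded[OF n0]]) (use free_dim[OF n0] in auto)
  qed
qed

section \<open>Resolutions\<close>

text \<open>
  Taking \<open>e\<^sub>i\<close> and the component of degree \<open>n\<close> preserves exactness: a preimage of an element of
  \<open>e\<^sub>i N\<^sub>n\<close> may be replaced by \<open>e\<^sub>i\<close> times its component of degree \<open>n\<close>. What remains is rank-nullity for a
  finite exact sequence of finite-dimensional spaces.
\<close>

lemma resolution_euler:
  assumes A: "elementary_algebra K A e" and M: "graded_left_module A M"
    and res: "fg_projective_resolution A M P d \<epsilon>" and fin: "\<And>n. n > l \<Longrightarrow> carrier (P n) = {\<zero>\<^bsub>P n\<^esub>}"
  shows "fd_subspace K (restrict_scalars A M) (vertex_part e M i n)"
    "int (graded_dim K A e M i n) = (\<Sum>k\<le>l. (-1) ^ k * int (graded_dim K A e (P k) i n))"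
    "\<epsilon> ` vertex_part e (P 0) i n = vertex_part e M i n"
proof -
  have pr: "fg_graded_projective A (P k)" for k using res by (simp add: fg_projective_resolution_def)
  then have gl: "graded_left_module A (P k)" for k by (simp add: fg_graded_projective_def)
  have d: "d k \<in> graded_hom A (P (Suc k)) (P k)" for k using res by (simp add: fg_projective_resolution_def)
  have \<epsilon>: "\<epsilon> \<in> graded_hom A (P 0) M" and surj: "\<epsilon> ` carrier (P 0) = carrier M"
    using res by (simp_all add: fg_projective_resolution_def)
  have ex0: "{x \<in> carrier (P 0). \<epsilon> x = \<zero>\<^bsub>M\<^esub>} = d 0 ` carrier (P 1)"
    using res by (simp add: fg_projective_resolution_def a_kernel_def')
  have ex: "{x \<in> carrier (P (Suc k)). d k x = \<zero>\<^bsub>P k\<^esub>} = d (Suc k) ` carrier (P (Suc (Suc k)))" for k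
    using res by (simp add: fg_projective_resolution_def a_kernel_def')
  have pM: "projected_module K A e M (component M (grade M))" using graded_imp_projected[OF A M] .
  have pP: "projected_module K A e (P k) (component (P k) (grade (P k)))" for k
    using graded_imp_projected[OF A gl] .
  have fdP: "fd_subspace K (restrict_scalars A (P k)) (vertex_part e (P k) i n)" for k
    using projective_structure[OF A pr] by metis
  have image: "f ` vertex_part e X i n = {y \<in> vertex_part e Y i n. y \<in> f ` carrier X}"
    if X: "graded_left_module A X" and Y: "graded_left_module A Y" and f: "f \<in> graded_hom A X Y"
    for X :: "('b, 'x) graded_module" and Y :: "('b, 'y) graded_module" and f
  proof -
    interpret f: projected_hom K A e X "component X (grade X)" Y "component Y (grade Y)" f
      using graded_imp_projected[OF A X] graded_imp_projected[OF A Y] f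
      by (simp add: projected_hom_def projected_hom_axioms_def)
    show ?thesis
    proof (intro equalityI subsetI)
      fix y assume "y \<in> f ` vertex_part e X i n"
      then show "y \<in> {y \<in> vertex_part e Y i n. y \<in> f ` carrier X}"
        using f.hom_vertex_part f.M.vertex_part_carrier by blast
    next
      fix y assume "y \<in> {y \<in> vertex_part e Y i n. y \<in> f ` carrier X}"
      then obtain x where x: "x \<in> carrier X" "y = f x" and y: "y \<in> vertex_part e Y i n" by blast
      let ?z = "e i \<odot>\<^bsub>X\<^esub> component X (grade X) n x"
      have "f ?z = e i \<odot>\<^bsub>Y\<^esub> component Y (grade Y) n y"
        using x graded_hom_component[OF A X Y f x(1)] f.hom_act[of "e i"] f.M.e_carrier f.M.proj_carrier by simp
      also have "\<dots> = y" using y f.N.vertex_part_iff f.N.proj_id by simp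
      finally have "f ?z = y" .
      moreover have "?z \<in> vertex_part e X i n" using f.M.vertex_partI f.M.proj_grade x by blast
      ultimately show "y \<in> f ` vertex_part e X i n" by blast
    qed
  qed
  have lin: "linear_on K (restrict_scalars A X) (vertex_part e X i n) (restrict_scalars A Y) f"
    if X: "graded_left_module A X" and Y: "graded_left_module A Y" and f: "f \<in> graded_hom A X Y"
    for X :: "('b, 'x) graded_module" and Y :: "('b, 'y) graded_module" and f
  proof -
    interpret f: projected_hom K A e X "component X (grade X)" Y "component Y (grade Y)" f
      using graded_imp_projected[OF A X] graded_imp_projected[OF A Y] f
      by (simp add: projected_hom_def projected_hom_axioms_def)
    show ?thesis using f.hom_linear f.M.vertex_part_carrier by blast
  qed
  let ?V = "\<lambda>k. vertex_part e (P k) i n" and ?R = "restrict_scalars A"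
  note vM = projected_module.RM_vectorspace[OF pM] and vP = projected_module.RM_vectorspace[OF pP]
  have zeroR: "zero (?R X) = zero X" for X :: "('b, 'x) graded_module" by (simp add: restrict_scalars_def)
  have V_carrier: "?V k \<subseteq> carrier (P k)" for k using projected_module.vertex_part_carrier[OF pP] by blast
  show im0: "\<epsilon> ` ?V 0 = vertex_part e M i n"
    unfolding image[OF gl M \<epsilon>] surj using projected_module.vertex_part_carrier[OF pM, of _ i n] by auto
  show fdM: "fd_subspace K (?R M) (vertex_part e M i n)"
    using fd_subspace_image[OF fdP vM lin[OF gl M \<epsilon>]] im0 by simp
  \<comment> \<open>The dimension of the kernel in position \<open>k\<close>, which is the image from position \<open>k + 1\<close>.\<close>
  define z where "z k = subdim K (?R (P k)) (d k ` ?V (Suc k))" for k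
  have ker0: "{x \<in> ?V 0. \<epsilon> x = \<zero>\<^bsub>M\<^esub>} = d 0 ` ?V (Suc 0)"
  proof -
    have "d 0 ` ?V (Suc 0) = {y \<in> ?V 0. y \<in> {x \<in> carrier (P 0). \<epsilon> x = \<zero>\<^bsub>M\<^esub>}}"
      unfolding ex0 using image[OF gl gl d, of 0] by simp
    then show ?thesis using V_carrier[of 0] by auto
  qed
  have ker: "{x \<in> ?V (Suc k). d k x = \<zero>\<^bsub>P k\<^esub>} = d (Suc k) ` ?V (Suc (Suc k))" for k
  proof -
    have "d (Suc k) ` ?V (Suc (Suc k)) = {y \<in> ?V (Suc k). y \<in> {x \<in> carrier (P (Suc k)). d k x = \<zero>\<^bsub>P k\<^esub>}}"
      unfolding ex using image[OF gl gl d, of "Suc k"] by simp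
    then show ?thesis using V_carrier[of "Suc k"] by auto
  qed
  have dim0: "graded_dim K A e (P 0) i n = graded_dim K A e M i n + z 0"
    using subdim_rank_nullity[OF fdP vM lin[OF gl M \<epsilon>]] im0 ker0
    by (simp add: graded_dim_subdim zeroR z_def)
  have dimS: "graded_dim K A e (P (Suc k)) i n = z k + z (Suc k)" for k
    using subdim_rank_nullity[OF fdP vP lin[OF gl gl d], of k] ker[of k]
    by (simp add: graded_dim_subdim zeroR z_def)
  have "(\<Sum>k\<le>N. (-1) ^ k * int (graded_dim K A e (P k) i n)) =
      int (graded_dim K A e M i n) + (-1) ^ N * int (z N)" for N
    by (induction N) (simp_all add: dim0 dimS algebra_simps)
  moreover have "z l = 0"
  proof -
    have "subdim K (?R (P (Suc l))) (?V (Suc l)) = 0"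
      using subdim_eq_0_iff[OF fdP] V_carrier[of "Suc l"] fin[of "Suc l"]
        subspaceD(3)[OF fd_subspaceD[OF fdP[of "Suc l"]]] by (auto simp: zeroR)
    then show ?thesis using dimS[of l] by (simp add: graded_dim_subdim)
  qed
  ultimately show "int (graded_dim K A e M i n) = (\<Sum>k\<le>l. (-1) ^ k * int (graded_dim K A e (P k) i n))"
    by simp
qed

lemma nonzero_graded_dim:
  assumes A: "elementary_algebra K A e" and M: "graded_left_module A M" and "carrier M \<noteq> {\<zero>\<^bsub>M\<^esub>}"
    and fd: "\<And>i n. fd_subspace K (restrict_scalars A M) (vertex_part e M i n)"
  shows "\<exists>i n. graded_dim K A e M i n \<noteq> 0"
proof (rule ccontr)
  assume "\<not> ?thesis"
  then have V: "vertex_part e M i n = {\<zero>\<^bsub>M\<^esub>}" for i n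
    using subdim_eq_0_iff[OF fd] by (simp add: graded_dim_subdim restrict_scalars_def)
  interpret M: projected_module K A e M "component M (grade M)" using graded_imp_projected[OF A M] .
  interpret D: decomposed_group M "grade M" using M by (rule graded_decomposed)
  have zero: "additive_subgroup {\<zero>\<^bsub>M\<^esub>} M"
    using group.triv_subgroup[OF M.M.M.a_group] by (simp add: additive_subgroup_def)
  have "x = \<zero>\<^bsub>M\<^esub>" if x: "x \<in> grade M n" for x n
  proof -
    have "x \<in> {\<zero>\<^bsub>M\<^esub>}"
    proof (rule M.one_induct[OF M.grade_carrier[OF x] zero, of "\<lambda>x. x"])
      show "(c \<odot>\<^bsub>A\<^esub> \<one>\<^bsub>A\<^esub>) \<odot>\<^bsub>M\<^esub> (e i \<odot>\<^bsub>M\<^esub> x) \<in> {\<zero>\<^bsub>M\<^esub>}" if "c \<in> carrier K" for i c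
        using M.vertex_partI[OF x, of i] V that M.M.smult_zero by auto
    qed auto
    then show ?thesis by simp
  qed
  then have "x = \<zero>\<^bsub>M\<^esub>" if "x \<in> carrier M" for x
    using D.component_0_imp_0[OF that] D.component_properties(1)[OF that] by blast
  then show False using assms(3) M.M.M.zero_closed by blast
qed

section \<open>Laurent expansions of rational functions\<close>

definition poly_expansion :: "rat \<Rightarrow> rat poly \<Rightarrow> rat fps" where
  "poly_expansion a p = fps_of_poly (pcompose p [:a, 1:])"

lemma poly_expansion_simps:
  "poly_expansion a (p * q) = poly_expansion a p * poly_expansion a q"
  "poly_expansion a (p + q) = poly_expansion a p + poly_expansion a q"
  "poly_expansion a 0 = 0" "poly_expansion a 1 = 1"
  by (simp_all add: poly_expansion_def pcompose_mult pcompose_add pcompose_1 fps_of_poly_mult fps_of_poly_add)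

lemma poly_expansion_eq_0_iff [simp]: "poly_expansion a p = 0 \<longleftrightarrow> p = 0"
proof -
  have "poly_expansion a p = 0 \<longleftrightarrow> pcompose p [:a, 1:] = 0"
    unfolding poly_expansion_def using fps_of_poly_eq_iff[of _ 0] by simp
  then show ?thesis by (simp add: pcompose_eq_0_iff)
qed

lemma poly_expansion_0: "poly_expansion 0 p = fps_of_poly p"
  by (simp add: poly_expansion_def)

text \<open>
  The expansion is defined through the reduced fraction. That any other representation gives the same
  series makes it a homomorphism of fields.
\<close>

lemma expansion_Fract:
  assumes "q \<noteq> 0"
  shows "expansion a (Fract p q) = fps_to_fls (poly_expansion a p) / fps_to_fls (poly_expansion a q)"
proof -
  let ?p = "fst (quot_of_fract (Fract p q))" and ?q = "snd (quot_of_fract (Fract p q))"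
  have "Fract ?p ?q = Fract p q" by (rule Fract_quot_of_fract)
  then have "?p * q = p * ?q" using assms by (simp add: eq_fract del: Fract_quot_of_fract)
  then have "poly_expansion a ?p * poly_expansion a q = poly_expansion a p * poly_expansion a ?q"
    by (simp flip: poly_expansion_simps)
  then have "fps_to_fls (poly_expansion a ?p) * fps_to_fls (poly_expansion a q) =
      fps_to_fls (poly_expansion a p) * fps_to_fls (poly_expansion a ?q)"
    by (simp flip: fls_times_fps_to_fls)
  then show ?thesis
    using assms by (simp add: expansion_def poly_expansion_def[symmetric] frac_eq_eq del: fps_to_fls_eq_0_iff) (simp add: frac_eq_eq)
qed

lemma fract_cases:
  fixes f :: ratfun
  obtains p q where "f = Fract p q" "q \<noteq> 0"
  using Fract_quot_of_fract[of f] snd_quot_of_fract_nonzero[of f] by metis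

lemma expansion_add: "expansion a (f + g) = expansion a f + expansion a g"
  by (cases f rule: fract_cases; cases g rule: fract_cases)
    (simp add: expansion_Fract poly_expansion_simps fls_times_fps_to_fls add_frac_eq)

lemma expansion_mult: "expansion a (f * g) = expansion a f * expansion a g"
  by (cases f rule: fract_cases; cases g rule: fract_cases)
    (simp add: expansion_Fract poly_expansion_simps fls_times_fps_to_fls)

lemma expansion_0 [simp]: "expansion a 0 = 0"
  by (simp add: Zero_fract_def expansion_Fract poly_expansion_simps)

lemma expansion_1 [simp]: "expansion a 1 = 1"
  by (simp add: One_fract_def expansion_Fract poly_expansion_simps)

lemma expansion_eq_0_iff: "expansion a f = 0 \<longleftrightarrow> f = 0"
proof (cases f rule: fract_cases)
  case (1 p q)
  then show ?thesis by (simp add: expansion_Fract Zero_fract_def eq_fract)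
qed

lemma expansion_uminus: "expansion a (- f) = - expansion a f"
  using expansion_add[of a f "- f"] by (simp add: eq_neg_iff_add_eq_0 add.commute)

lemma expansion_inj: "expansion a f = expansion a g \<longleftrightarrow> f = g"
  using expansion_eq_0_iff[of a "f - g"] expansion_add[of a f "- g"] expansion_uminus[of a g] by simp

lemma expansion_sum: "expansion a (\<Sum>x\<in>S. f x) = (\<Sum>x\<in>S. expansion a (f x))"
  by (induction S rule: infinite_finite_induct) (simp_all add: expansion_add)

lemma expansion_of_nat [simp]: "expansion a (of_nat n) = of_nat n"
  by (induction n) (simp_all add: expansion_add)

lemma expansion_power: "expansion a (f ^ n) = expansion a f ^ n"
  by (induction n) (simp_all add: expansion_mult)

lemma expansion_inverse: "expansion a (inverse f) = inverse (expansion a f)"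
proof (cases "f = 0")
  case False
  then have "expansion a f * expansion a (inverse f) = 1" by (simp flip: expansion_mult)
  then show ?thesis by (metis inverse_unique)
qed simp

lemma expansion_powi: "expansion a (f powi m) = expansion a f powi m"
  by (simp add: power_int_def expansion_power expansion_inverse)

lemma expansion_X: "expansion a ratfun_X = fps_to_fls (fps_const a + fps_X)"
  by (simp add: ratfun_X_def expansion_Fract poly_expansion_simps)
    (simp add: poly_expansion_def pcompose_pCons fps_of_poly_linear add.commute)

lemma ratfun_of_expansion: "ratfun_of (expansion 0 f) = f"
  unfolding ratfun_of_def by (rule the_equality) (auto simp: expansion_inj)

lemma expansion_ratfun_of: "rational_series h \<Longrightarrow> expansion 0 (ratfun_of h) = h"
  unfolding rational_series_def using ratfun_of_expansion by metis

lemma expand_vec_mult: "expand_vec a (Q *v q) = expand_matrix a Q *v expand_vec a q"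
  by (simp add: vec_eq_iff expand_vec_def expand_matrix_def matrix_vector_mult_def expansion_sum expansion_mult)

lemma expand_vec_inj: "expand_vec a q = expand_vec a q' \<longleftrightarrow> q = q'"
  by (auto simp: vec_eq_iff expand_vec_def expansion_inj)

lemma expand_matrix_mult: "expand_matrix a (Q ** R) = expand_matrix a Q ** expand_matrix a R"
  by (simp add: vec_eq_iff expand_matrix_def matrix_matrix_mult_def expansion_sum expansion_mult)

lemma expand_matrix_1: "expand_matrix a (mat 1) = mat 1"
  by (auto simp: vec_eq_iff expand_matrix_def mat_def)

section \<open>Power series vectors\<close>

definition is_power_series :: "'a::comm_ring_1 fls \<Rightarrow> bool" where
  "is_power_series h \<longleftrightarrow> h \<in> range fps_to_fls"

lemma is_power_series_fps [simp]: "is_power_series (fps_to_fls f)"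
  by (simp add: is_power_series_def)

lemma is_power_series_intros [simp]:
  "is_power_series 0" "is_power_series 1" "is_power_series fls_X"
  "is_power_series f \<Longrightarrow> is_power_series g \<Longrightarrow> is_power_series (f + g)"
  "is_power_series f \<Longrightarrow> is_power_series g \<Longrightarrow> is_power_series (f * g)"
  "is_power_series f \<Longrightarrow> is_power_series (- f)"
proof -
  show "is_power_series 0" using is_power_series_fps[of 0] by simp
  show "is_power_series 1" using is_power_series_fps[of 1] by simp
  show "is_power_series fls_X" using is_power_series_fps[of fps_X] by simp
  show "is_power_series f \<Longrightarrow> is_power_series g \<Longrightarrow> is_power_series (f + g)"
    unfolding is_power_series_def by (elim rangeE) (metis fps_to_fls_plus rangeI)
  show "is_power_series f \<Longrightarrow> is_power_series g \<Longrightarrow> is_power_series (f * g)"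
    unfolding is_power_series_def by (elim rangeE) (metis fls_times_fps_to_fls rangeI)
  show "is_power_series f \<Longrightarrow> is_power_series (- f)"
    unfolding is_power_series_def by (elim rangeE) (metis fps_to_fls_uminus rangeI)
qed

lemma is_power_series_of_nat [simp]: "is_power_series (of_nat n)"
  by (induction n) simp_all

lemma is_power_series_sum: "(\<And>x. x \<in> S \<Longrightarrow> is_power_series (f x)) \<Longrightarrow> is_power_series (\<Sum>x\<in>S. f x)"
  by (induction S rule: infinite_finite_induct) simp_all

lemma is_power_series_power: "is_power_series f \<Longrightarrow> is_power_series (f ^ n)"
  by (induction n) simp_all

lemma power_series_vecs_iff: "v \<in> power_series_vecs \<longleftrightarrow> (\<forall>i. is_power_series (v $ i))"
  by (simp add: power_series_vecs_def is_power_series_def)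

lemma expansion_1_X_powi: "is_power_series (expansion 1 (ratfun_X powi m))"
proof -
  have "(1 + fls_X) * fps_to_fls (inverse (1 + fps_X) :: rat fps) = fps_to_fls ((1 + fps_X) * inverse (1 + fps_X))"
    by (simp add: fls_times_fps_to_fls)
  also have "\<dots> = 1" by (subst inverse_mult_eq_1') simp_all
  finally have "inverse (1 + fls_X) = fps_to_fls (inverse (1 + fps_X) :: rat fps)"
    by (rule inverse_unique)
  then show ?thesis
    unfolding expansion_powi unfolding expansion_X power_int_def by (simp add: is_power_series_power)
qed

lemma power_series_vecs_closed:
  "0 \<in> power_series_vecs"
  "u \<in> power_series_vecs \<Longrightarrow> v \<in> power_series_vecs \<Longrightarrow> u + v \<in> power_series_vecs"
  "is_power_series f \<Longrightarrow> v \<in> power_series_vecs \<Longrightarrow> f *s v \<in> power_series_vecs"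
  by (auto simp: power_series_vecs_iff)

section \<open>The torsion order in the growth module\<close>

text \<open>
  The lattice is the image of the power series vectors under the inverse of \<open>C\<close>.
\<close>

lemma lattice_mem_iff:
  assumes "C ** inverse_hilbert_matrix K A e = mat 1" "inverse_hilbert_matrix K A e ** C = mat 1"
  shows "h \<in> numerator_lattice K A e \<longleftrightarrow> expand_matrix 1 C *v h \<in> power_series_vecs"
proof -
  let ?E = "expand_matrix 1 (inverse_hilbert_matrix K A e)" and ?C = "expand_matrix 1 C"
  have 1: "?C ** ?E = mat 1" "?E ** ?C = mat 1"
    using assms by (simp_all flip: expand_matrix_mult add: expand_matrix_1)
  show ?thesis
  proof
    assume "h \<in> numerator_lattice K A e"
    then obtain g where "g \<in> power_series_vecs" "h = ?E *v g" by (auto simp: numerator_lattice_def)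
    then show "?C *v h \<in> power_series_vecs" using 1 by (simp add: matrix_vector_mul_assoc)
  next
    assume "?C *v h \<in> power_series_vecs"
    moreover have "h = ?E *v (?C *v h)" using 1 by (simp add: matrix_vector_mul_assoc)
    ultimately show "h \<in> numerator_lattice K A e" unfolding numerator_lattice_def by blast
  qed
qed

lemma matrix_vector_smult: "(Q :: 'a::field ^ 'n ^ 'm) *v (c *s v) = c *s (Q *v v)"
  by (simp add: vec_eq_iff matrix_vector_mult_def sum_distrib_left algebra_simps)

text \<open>
  The class of \<open>q\<close> is killed by \<open>t\<^sup>d\<close> exactly if \<open>t\<^sup>d q\<close> lies in the lattice, that is, if \<open>t\<^sup>d C q\<close> is a
  vector of power series. The two minima are therefore taken over the same set.
\<close>

lemma torsion_order_eq_pole_order: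
  assumes "C ** inverse_hilbert_matrix K A e = mat 1" "inverse_hilbert_matrix K A e ** C = mat 1"
    and q: "expand_vec 1 q \<in> power_series_vecs"
  shows "torsion_order K A e (growth_proj K A e (expand_vec 1 q)) = pole_order (expand_vec 1 (C *v q))"
proof -
  let ?L = "power_series_vecs \<inter> numerator_lattice K A e"
  let ?M = "power_series_module :: (rat fps, rat fls ^ 'a) module"
  note lat = lattice_mem_iff[OF assms(1,2)]
  have L: "h \<in> ?L \<longleftrightarrow> h \<in> power_series_vecs \<and> expand_matrix 1 C *v h \<in> power_series_vecs" for h
    using lat by blast
  have L0: "0 \<in> ?L" unfolding L by (simp add: power_series_vecs_closed)
  have Ladd: "u + v \<in> ?L" if "u \<in> ?L" "v \<in> ?L" for u v
    using that unfolding L by (simp add: matrix_vector_right_distrib power_series_vecs_closed)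
  have Lsm: "f *s v \<in> ?L" if "is_power_series f" "v \<in> ?L" for f v
    using that unfolding L by (simp add: matrix_vector_smult power_series_vecs_closed)
  have Lneg: "- v \<in> ?L" if "v \<in> ?L" for v
    unfolding vector_sneg_minus1[of v] by (rule Lsm[OF _ that]) simp
  have coset: "?L +>\<^bsub>?M\<^esub> h = {l + h | l. l \<in> ?L}" for h
    by (auto simp: a_r_coset_def' power_series_module_def)
  have coset_eq: "?L +>\<^bsub>?M\<^esub> h = ?L \<longleftrightarrow> h \<in> ?L" for h
  proof
    assume "?L +>\<^bsub>?M\<^esub> h = ?L"
    moreover have "h \<in> ?L +>\<^bsub>?M\<^esub> h" unfolding coset using L0 by force
    ultimately show "h \<in> ?L" by simp
  next
    assume h: "h \<in> ?L"
    show "?L +>\<^bsub>?M\<^esub> h = ?L"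
    proof (intro equalityI subsetI)
      fix x assume "x \<in> ?L"
      then have "x + - h \<in> ?L" using h Ladd Lneg by blast
      moreover have "x = (x + - h) + h" by simp
      ultimately show "x \<in> ?L +>\<^bsub>?M\<^esub> h" unfolding coset by blast
    qed (use h Ladd coset in auto)
  qed
  have act: "fps_X ^ d \<odot>\<^bsub>growth_module K A e\<^esub> growth_proj K A e h = ?L +>\<^bsub>?M\<^esub> (fls_X ^ d *s h)" for d h
  proof -
    have "?L +>\<^bsub>?M\<^esub> (fls_X ^ d *s x) = ?L +>\<^bsub>?M\<^esub> (fls_X ^ d *s h)" if xh: "x \<in> ?L +>\<^bsub>?M\<^esub> h" for x
    proof -
      obtain k where k: "k \<in> ?L" "x = k + h" using xh unfolding coset by blast
      have m: "fls_X ^ d *s k \<in> ?L" using Lsm[OF is_power_series_power k(1)] by simp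
      have x: "fls_X ^ d *s x = fls_X ^ d *s k + fls_X ^ d *s h" using k by (simp add: vector_add_ldistrib)
      show ?thesis
      proof (intro equalityI subsetI)
        fix y assume "y \<in> ?L +>\<^bsub>?M\<^esub> (fls_X ^ d *s x)"
        then obtain l where "l \<in> ?L" "y = (l + fls_X ^ d *s k) + fls_X ^ d *s h"
          unfolding coset x by (auto simp: add.assoc)
        then show "y \<in> ?L +>\<^bsub>?M\<^esub> (fls_X ^ d *s h)" using Ladd m unfolding coset by blast
      next
        fix y assume "y \<in> ?L +>\<^bsub>?M\<^esub> (fls_X ^ d *s h)"
        then obtain l where "l \<in> ?L" "y = l + fls_X ^ d *s h" unfolding coset by blast
        then have "y = (l + - (fls_X ^ d *s k)) + fls_X ^ d *s x" "l + - (fls_X ^ d *s k) \<in> ?L"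
          using x Ladd Lneg m by (simp, blast)
        then show "y \<in> ?L +>\<^bsub>?M\<^esub> (fls_X ^ d *s x)" unfolding coset by blast
      qed
    qed
    moreover have "?L +>\<^bsub>?M\<^esub> h \<noteq> {}" unfolding coset using L0 by blast
    ultimately have "(\<Union>x\<in>?L +>\<^bsub>?M\<^esub> h. ?L +>\<^bsub>?M\<^esub> (fls_X ^ d *s x)) = ?L +>\<^bsub>?M\<^esub> (fls_X ^ d *s h)"
      by (intro SUP_eq_const)
    moreover have "fps_X ^ d \<odot>\<^bsub>?M\<^esub> x = fls_X ^ d *s x" for x
      by (simp add: power_series_module_def fps_to_fls_power)
    ultimately show ?thesis
      by (simp add: growth_module_def growth_proj_def quotient_module_def)
  qed
  have "(fps_X ^ d \<odot>\<^bsub>growth_module K A e\<^esub> growth_proj K A e (expand_vec 1 q) = \<zero>\<^bsub>growth_module K A e\<^esub>) \<longleftrightarrow>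
      fls_X ^ d *s expand_vec 1 (C *v q) \<in> power_series_vecs" for d
  proof -
    have zero: "\<zero>\<^bsub>growth_module K A e\<^esub> = ?L" by (simp add: growth_module_def quotient_module_def)
    show ?thesis
      unfolding act zero coset_eq L expand_vec_mult matrix_vector_smult
      using power_series_vecs_closed(3)[OF is_power_series_power q] by simp
  qed
  then show ?thesis unfolding torsion_order_def pole_order_def by simp
qed

section \<open>Hilbert series of perfect modules\<close>

lemma det_ring_hom:
  fixes h :: "'a::comm_ring_1 \<Rightarrow> 'b::comm_ring_1" and Q :: "'a ^ 'n ^ 'n"
  assumes "\<And>x y. h (x + y) = h x + h y" "\<And>x y. h (x * y) = h x * h y" "h 1 = 1" "h 0 = 0"
    "\<And>x. h (- x) = - h x"
  shows "h (det Q) = det (\<chi> i j. h (Q $ i $ j))"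
proof -
  have sum: "h (\<Sum>x\<in>S. f x) = (\<Sum>x\<in>S. h (f x))" for f :: "('n \<Rightarrow> 'n) \<Rightarrow> 'a" and S
    by (induction S rule: infinite_finite_induct) (simp_all add: assms)
  have prod: "h (\<Prod>x\<in>S. f x) = (\<Prod>x\<in>S. h (f x))" for f :: "'n \<Rightarrow> 'a" and S
    by (induction S rule: infinite_finite_induct) (simp_all add: assms)
  have sgn: "h (of_int (sign p) * x) = of_int (sign p) * h x" for p :: "'n \<Rightarrow> 'n" and x
    by (simp add: sign_def assms)
  show ?thesis by (simp add: det_def sum prod sgn)
qed

definition hilbert_ratmatrix ::
    "'k ring \<Rightarrow> ('k, 'a) graded_module \<Rightarrow> ('r::finite \<Rightarrow> 'a) \<Rightarrow> ratfun ^ 'r ^ 'r" where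
  "hilbert_ratmatrix K A e = (\<chi> i j. ratfun_of (fps_to_fls (hilbert_matrix K A e $ i $ j)))"

lemma hilbert_matrix_nth:
  "fps_nth (hilbert_matrix K A e $ i $ j) n = of_nat (subdim K A (arrow_part A e i j (int n)))"
  by (simp add: hilbert_matrix_def subdim_def arrow_part_def)

lemma expansion_hilbert_ratmatrix:
  "rational_hilbert_matrix K A e \<Longrightarrow>
     expansion 0 (hilbert_ratmatrix K A e $ i $ j) = fps_to_fls (hilbert_matrix K A e $ i $ j)"
  by (simp add: hilbert_ratmatrix_def rational_hilbert_matrix_def expansion_ratfun_of)

text \<open>
  The constant term of the determinant is the determinant of \<open>C\<^sub>A(0) = 1\<close>, because \<open>e\<^sub>i A\<^sub>0 e\<^sub>j\<close> is spanned by
  \<open>e\<^sub>i\<close> for \<open>i = j\<close> and vanishes otherwise.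
\<close>

lemma hilbert_ratmatrix_invertible:
  assumes "elementary_algebra K A e" "rational_hilbert_matrix K A e"
  shows "invertible (hilbert_ratmatrix K A e)"
proof -
  interpret elementary_algebra K A e by fact
  let ?C = "hilbert_matrix K A e"
  have "fps_nth (det ?C) 0 = det (\<chi> i j. fps_nth (?C $ i $ j) 0)"
    by (rule det_ring_hom) simp_all
  also have "(\<chi> i j. fps_nth (?C $ i $ j) 0) = mat 1"
    by (simp add: vec_eq_iff hilbert_matrix_nth mat_def arrow_dim_zero)
  finally have det: "det ?C \<noteq> 0" by auto
  have "expansion 0 (det (hilbert_ratmatrix K A e)) = det (\<chi> i j. expansion 0 (hilbert_ratmatrix K A e $ i $ j))"
    by (rule det_ring_hom) (simp_all add: expansion_add expansion_mult expansion_uminus)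
  also have "\<dots> = det (\<chi> i j. fps_to_fls (?C $ i $ j))"
    by (simp add: expansion_hilbert_ratmatrix[OF assms(2)])
  also have "\<dots> = fps_to_fls (det ?C)"
    by (rule det_ring_hom[symmetric]) (simp_all add: fls_times_fps_to_fls)
  finally have "expansion 0 (det (hilbert_ratmatrix K A e)) \<noteq> 0" using det by simp
  then show ?thesis by (simp add: invertible_det_nz expansion_eq_0_iff)
qed

lemma hilbert_series_nth:
  assumes "\<And>n. n < n0 \<Longrightarrow> graded_dim K A e M i n = 0"
  shows "fls_nth (hilbert_series K A e M $ i) n = of_nat (graded_dim K A e M i n)"
  unfolding hilbert_series_def using assms
  by (simp add: nth_Abs_fls_lower_bound[of n0 "\<lambda>n. of_nat (graded_dim K A e M i n)"])

lemma graded_dim_zero_grade: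
  assumes "elementary_algebra K A e" "graded_left_module A M" "grade M n = {\<zero>\<^bsub>M\<^esub>}"
  shows "graded_dim K A e M i n = 0"
proof -
  interpret M: projected_module K A e M "component M (grade M)"
    using graded_imp_projected[OF assms(1,2)] .
  have "vertex_part e M i n = {\<zero>\<^bsub>restrict_scalars A M\<^esub>}"
    using assms(3) M.M.smult_zero[OF M.e_carrier] by (simp add: vertex_part_def)
  then show ?thesis using subdim_zero[OF M.RM_vectorspace] by (simp add: graded_dim_subdim)
qed

lemma fls_mult_X_powi_nth: "fls_nth (h * (fls_X powi m :: rat fls)) n = fls_nth h (n - m)"
  by (simp add: fls_X_intpow_times_conv_shift)

lemma projective_hilbert_series:
  assumes A: "elementary_algebra K A e" and P: "fg_graded_projective A P"
    and rat: "rational_hilbert_matrix K A e"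
  shows "hilbert_series K A e P = expand_vec 0 (hilbert_ratmatrix K A e *v projective_numerator K A e P)"
    "expand_vec 1 (projective_numerator K A e P) \<in> power_series_vecs"
proof -
  let ?w = "graded_dim K A e (graded_quotient P (positive_part_mult A P))"
  obtain n0 where bound: "\<And>m. m < n0 \<Longrightarrow> grade P m = {\<zero>\<^bsub>P\<^esub>}"
    and w_fin: "\<And>j. finite {m. ?w j m \<noteq> 0}" and w0: "\<And>j m. m < n0 \<Longrightarrow> ?w j m = 0"
    and P_dim: "\<And>i n. graded_dim K A e P i n =
       (\<Sum>j\<in>UNIV. \<Sum>m=n0..n. subdim K A (arrow_part A e i j (n - m)) * ?w j m)"
    by (rule projective_structure[OF A P]) (rule that; assumption)
  interpret elementary_algebra K A e by (rule A)
  have gl: "graded_left_module A P" using P by (simp add: fg_graded_projective_def)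
  have C_nth: "fls_nth (fps_to_fls (hilbert_matrix K A e $ i $ j)) k = of_nat (subdim K A (arrow_part A e i j k))" for i j k
    by (simp add: hilbert_matrix_nth arrow_dim_neg)
  have num: "expansion a (projective_numerator K A e P $ j) =
      (\<Sum>m | ?w j m \<noteq> 0. of_nat (?w j m) * expansion a (ratfun_X powi m))" for a j
    by (simp add: projective_numerator_def Let_def expansion_sum expansion_mult)
  show "hilbert_series K A e P = expand_vec 0 (hilbert_ratmatrix K A e *v projective_numerator K A e P)"
  proof (unfold vec_eq_iff, rule allI, rule fls_eqI)
    fix i n
    have "fls_nth (fps_to_fls (hilbert_matrix K A e $ i $ j) * expansion 0 (projective_numerator K A e P $ j)) n =
        of_nat (\<Sum>m=n0..n. subdim K A (arrow_part A e i j (n - m)) * ?w j m)" for j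
    proof -
      have "fps_to_fls (hilbert_matrix K A e $ i $ j) * expansion 0 (projective_numerator K A e P $ j) =
          (\<Sum>m | ?w j m \<noteq> 0. of_nat (?w j m) * (fps_to_fls (hilbert_matrix K A e $ i $ j) * fls_X powi m))"
        unfolding num sum_distrib_left by (intro sum.cong) (simp_all add: expansion_powi expansion_X mult.left_commute)
      then have "fls_nth (fps_to_fls (hilbert_matrix K A e $ i $ j) * expansion 0 (projective_numerator K A e P $ j)) n =
          (\<Sum>m | ?w j m \<noteq> 0. of_nat (?w j m) * of_nat (subdim K A (arrow_part A e i j (n - m))))"
        by (simp only: fls_nth_sum fls_of_nat fls_mult_const_nth fls_mult_X_powi_nth C_nth)
      also have "\<dots> = (\<Sum>m=n0..n. of_nat (?w j m) * of_nat (subdim K A (arrow_part A e i j (n - m))))"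
      proof (rule sum.mono_neutral_cong)
        show "finite {m. ?w j m \<noteq> 0}" by (rule w_fin)
        fix m assume "m \<in> {m. ?w j m \<noteq> 0} - {n0..n}"
        then have "n - m < 0" using w0[of m j] by (cases "m < n0") auto
        then show "of_nat (?w j m) * of_nat (subdim K A (arrow_part A e i j (n - m))) = (0::rat)"
          by (simp add: arrow_dim_neg)
      qed auto
      finally show ?thesis by (simp add: mult.commute)
    qed
    moreover have "expand_vec 0 (hilbert_ratmatrix K A e *v projective_numerator K A e P) $ i =
        (\<Sum>j\<in>UNIV. fps_to_fls (hilbert_matrix K A e $ i $ j) * expansion 0 (projective_numerator K A e P $ j))"
      unfolding expand_vec_mult
      by (simp add: matrix_vector_mult_def expand_matrix_def expand_vec_def expansion_hilbert_ratmatrix[OF rat])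
    ultimately show "fls_nth (hilbert_series K A e P $ i) n =
        fls_nth (expand_vec 0 (hilbert_ratmatrix K A e *v projective_numerator K A e P) $ i) n"
      by (subst hilbert_series_nth[of n0])
        (simp_all add: graded_dim_zero_grade[OF A gl bound] fls_nth_sum P_dim)
  qed
  show "expand_vec 1 (projective_numerator K A e P) \<in> power_series_vecs"
    unfolding power_series_vecs_iff expand_vec_def
    by (auto simp: num intro!: is_power_series_sum is_power_series_intros expansion_1_X_powi)
qed

lemma resolution_hilbert_series:
  assumes A: "elementary_algebra K A e" and rat: "rational_hilbert_matrix K A e" and M: "graded_left_module A M"
    and res: "fg_projective_resolution A M P d \<epsilon>" and fin: "finite_resolution P"
  defines "q \<equiv> \<Sum>n | carrier (P n) \<noteq> {\<zero>\<^bsub>P n\<^esub>}. (-1) ^ n *s projective_numerator K A e (P n)"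
  shows "hilbert_series K A e M = expand_vec 0 (hilbert_ratmatrix K A e *v q)"
    "expand_vec 1 q \<in> power_series_vecs"
    "fd_subspace K (restrict_scalars A M) (vertex_part e M i n)"
    "fls_nth (hilbert_series K A e M $ i) n = of_nat (graded_dim K A e M i n)"
proof -
  obtain l where l: "\<And>n. n > l \<Longrightarrow> carrier (P n) = {\<zero>\<^bsub>P n\<^esub>}" using fin by (auto simp: finite_resolution_def)
  have pr: "fg_graded_projective A (P k)" for k using res by (simp add: fg_projective_resolution_def)
  then have gl: "graded_left_module A (P k)" for k by (simp add: fg_graded_projective_def)
  note euler = resolution_euler[OF A M res l]
  show fd: "fd_subspace K (restrict_scalars A M) (vertex_part e M i n)" for i n by (rule euler(1))
  have "\<exists>b. \<forall>m<b. grade (P k) m = {\<zero>\<^bsub>P k\<^esub>}" for k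
    using projective_structure[OF A pr] by metis
  then obtain b where b: "\<And>k m. m < b k \<Longrightarrow> grade (P k) m = {\<zero>\<^bsub>P k\<^esub>}" by metis
  have P_nth: "fls_nth (hilbert_series K A e (P k) $ i) n = of_nat (graded_dim K A e (P k) i n)" for k i n
    by (rule hilbert_series_nth[of "b k"]) (simp add: graded_dim_zero_grade[OF A gl b])
  show M_nth: "fls_nth (hilbert_series K A e M $ i) n = of_nat (graded_dim K A e M i n)" for i n
  proof (rule hilbert_series_nth[of "b 0"])
    fix m assume m: "m < b 0"
    have z: "zero (restrict_scalars A M) = \<zero>\<^bsub>M\<^esub>" by (simp add: restrict_scalars_def)
    interpret P0: projected_module K A e "P 0" "component (P 0) (grade (P 0))"
      using graded_imp_projected[OF A gl] .
    have "\<epsilon> \<in> graded_hom A (P 0) M" using res by (simp add: fg_projective_resolution_def)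
    then interpret \<epsilon>: projected_hom K A e "P 0" "component (P 0) (grade (P 0))" M "component M (grade M)" \<epsilon>
      using graded_imp_projected[OF A gl] graded_imp_projected[OF A M]
      by (simp add: projected_hom_def projected_hom_axioms_def)
    have "vertex_part e (P 0) i m = {\<zero>\<^bsub>P 0\<^esub>}"
      using b[OF m] P0.M.smult_zero[OF P0.e_carrier] by (simp add: vertex_part_def)
    then have "vertex_part e M i m = {\<zero>\<^bsub>M\<^esub>}" using euler(3)[where i = i and n = m] \<epsilon>.hom_zero by simp
    then show "graded_dim K A e M i m = 0" using subdim_zero[OF \<epsilon>.N.RM_vectorspace] by (simp add: graded_dim_subdim z)
  qed
  have zero: "projective_numerator K A e (P k) = 0" if "carrier (P k) = {\<zero>\<^bsub>P k\<^esub>}" for k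
  proof -
    interpret Pk: projected_module K A e "P k" "component (P k) (grade (P k))"
      using graded_imp_projected[OF A gl] .
    have "grade (P k) n = {\<zero>\<^bsub>P k\<^esub>}" for n using that Pk.grade_carrier Pk.grade_M_zero by blast
    then have "hilbert_series K A e (P k) = 0"
      by (simp add: vec_eq_iff fls_eq_iff P_nth graded_dim_zero_grade[OF A gl])
    then have "expand_vec 0 (hilbert_ratmatrix K A e *v projective_numerator K A e (P k)) = expand_vec 0 0"
      using projective_hilbert_series(1)[OF A pr rat, of k] by (simp add: vec_eq_iff expand_vec_def)
    then have "hilbert_ratmatrix K A e *v projective_numerator K A e (P k) = 0" by (simp only: expand_vec_inj)
    then show ?thesis
      using hilbert_ratmatrix_invertible[OF A rat] matrix_left_invertible_ker[of "hilbert_ratmatrix K A e"]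
      by (auto simp: invertible_def)
  qed
  have q: "q = (\<Sum>k\<le>l. (-1) ^ k *s projective_numerator K A e (P k))"
    unfolding q_def using l zero by (intro sum.mono_neutral_left) (auto simp: not_less[symmetric])
  have "hilbert_series K A e M $ i = (\<Sum>k\<le>l. (-1) ^ k * hilbert_series K A e (P k) $ i)" for i
  proof (rule fls_eqI)
    fix n
    have "(of_nat (graded_dim K A e M i n) :: rat) = of_int (int (graded_dim K A e M i n))" by simp
    also have "\<dots> = of_int (\<Sum>k\<le>l. (-1) ^ k * int (graded_dim K A e (P k) i n))"
      by (rule arg_cong[OF euler(2)]) simp
    also have "\<dots> = (\<Sum>k\<le>l. (-1) ^ k * of_nat (graded_dim K A e (P k) i n))" by simp
    also have "\<dots> = fls_nth (\<Sum>k\<le>l. (-1) ^ k * hilbert_series K A e (P k) $ i) n"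
      unfolding fls_nth_sum
    proof (rule sum.cong[OF refl])
      fix k
      show "(-1) ^ k * of_nat (graded_dim K A e (P k) i n) = fls_nth ((-1) ^ k * hilbert_series K A e (P k) $ i) n"
        by (cases "even k") (simp_all add: P_nth)
    qed
    finally show "fls_nth (hilbert_series K A e M $ i) n = fls_nth (\<Sum>k\<le>l. (-1) ^ k * hilbert_series K A e (P k) $ i) n"
      by (simp add: M_nth)
  qed
  moreover have "expansion a ((-1) ^ k) = (-1) ^ k" for a k
    using expansion_power[of a "-1" k] expansion_uminus[of a 1] by simp
  then have ev: "expand_vec a ((-1) ^ k *s v) = (-1) ^ k *s expand_vec a v" for a k and v :: "ratfun ^ 'n"
    by (simp add: vec_eq_iff expand_vec_def expansion_mult)
  have es: "expand_vec a (\<Sum>k\<le>l. v k) = (\<Sum>k\<le>l. expand_vec a (v k))" for a and v :: "nat \<Rightarrow> ratfun ^ 'n"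
    by (simp add: vec_eq_iff expand_vec_def expansion_sum)
  have mv: "hilbert_ratmatrix K A e *v q = (\<Sum>k\<le>l. (-1) ^ k *s (hilbert_ratmatrix K A e *v projective_numerator K A e (P k)))"
    unfolding q by (simp add: vec.linear_sum[OF matrix_vector_mul_linear_gen] matrix_vector_smult)
  ultimately show "hilbert_series K A e M = expand_vec 0 (hilbert_ratmatrix K A e *v q)"
    unfolding mv es ev projective_hilbert_series(1)[OF A pr rat, symmetric] by (simp add: vec_eq_iff)
  show "expand_vec 1 q \<in> power_series_vecs"
    unfolding q es ev
    using projective_hilbert_series(2)[OF A pr rat]
    by (auto simp: power_series_vecs_iff intro!: is_power_series_sum is_power_series_intros is_power_series_power)
qed

text \<open>
  The Euler numerators of two finite resolutions have the same image \<open>Hilb\<^sub>M\<close> under the invertible matrix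
  \<open>C\<^sub>A\<close>, so the definite description in the definition of the Euler numerator is met.
\<close>

lemma euler_numerator_properties:
  assumes A: "elementary_algebra K A e" and rat: "rational_hilbert_matrix K A e" and M: "graded_left_module A M"
    and perf: "perfect A M"
  shows "hilbert_series K A e M = expand_vec 0 (hilbert_ratmatrix K A e *v euler_numerator K A e M)"
    "hilbert_ratfun K A e M = hilbert_ratmatrix K A e *v euler_numerator K A e M"
    "expand_vec 1 (euler_numerator K A e M) \<in> power_series_vecs"
    "fd_subspace K (restrict_scalars A M) (vertex_part e M i n)"
    "fls_nth (hilbert_series K A e M $ i) n = of_nat (graded_dim K A e M i n)"
proof -
  from perf obtain P :: "nat \<Rightarrow> ('b, nat \<Rightarrow> 'b) graded_module" and d \<epsilon> where
    P: "fg_projective_resolution A M P d \<epsilon>" "finite_resolution P" unfolding perfect_def by blast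
  let ?q = "\<lambda>P :: nat \<Rightarrow> ('b, nat \<Rightarrow> 'b) graded_module.
      \<Sum>n | carrier (P n) \<noteq> {\<zero>\<^bsub>P n\<^esub>}. (-1) ^ n *s projective_numerator K A e (P n)"
  note series = resolution_hilbert_series[OF A rat M]
  have unique: "?q P' = ?q P" if "fg_projective_resolution A M P' d' \<epsilon>'" "finite_resolution P'" for P' d' \<epsilon>'
  proof -
    have "hilbert_ratmatrix K A e *v ?q P' = hilbert_ratmatrix K A e *v ?q P"
      using series(1)[OF that] series(1)[OF P] by (simp add: expand_vec_inj)
    then have "hilbert_ratmatrix K A e *v (?q P' - ?q P) = 0" by (simp add: matrix_vector_mult_diff_distrib)
    then have "?q P' - ?q P = 0"
      using hilbert_ratmatrix_invertible[OF A rat] matrix_left_invertible_ker[of "hilbert_ratmatrix K A e"]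
      by (auto simp: invertible_def)
    then show ?thesis by simp
  qed
  have q: "euler_numerator K A e M = ?q P"
    unfolding euler_numerator_def
  proof (rule the_equality)
    fix q assume "\<exists>P' d' \<epsilon>'. fg_projective_resolution A M P' d' \<epsilon>' \<and> finite_resolution P' \<and> q = ?q P'"
    then obtain P' d' \<epsilon>' where P': "fg_projective_resolution A M P' d' \<epsilon>'" "finite_resolution P'" "q = ?q P'"
      by blast
    then show "q = ?q P" using unique[OF P'(1,2)] by simp
  qed (use P in blast)
  show 1: "hilbert_series K A e M = expand_vec 0 (hilbert_ratmatrix K A e *v euler_numerator K A e M)"
    unfolding q by (rule series(1)[OF P])
  show "hilbert_ratfun K A e M = hilbert_ratmatrix K A e *v euler_numerator K A e M"
    unfolding hilbert_ratfun_def 1 by (simp add: vec_eq_iff expand_vec_def ratfun_of_expansion)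
  show "expand_vec 1 (euler_numerator K A e M) \<in> power_series_vecs" unfolding q by (rule series(2)[OF P])
  show "fd_subspace K (restrict_scalars A M) (vertex_part e M i n)" by (rule series(3)[OF P])
  show "fls_nth (hilbert_series K A e M $ i) n = of_nat (graded_dim K A e M i n)" by (rule series(4)[OF P])
qed

lemma pole_order_torsion_order:
  assumes A: "elementary_algebra K A e" and rat: "rational_hilbert_matrix K A e" and M: "graded_left_module A M"
    and perf: "perfect A M"
  shows "pole_order (expand_vec 1 (hilbert_ratfun K A e M)) =
             torsion_order K A e (growth_proj K A e (expand_vec 1 (euler_numerator K A e M)))"
proof -
  have inv: "inverse_hilbert_matrix K A e = matrix_inv (hilbert_ratmatrix K A e)"
    by (simp add: inverse_hilbert_matrix_def hilbert_ratmatrix_def)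
  have "\<exists>B. hilbert_ratmatrix K A e ** B = mat 1 \<and> B ** hilbert_ratmatrix K A e = mat 1"
    using hilbert_ratmatrix_invertible[OF A rat] by (simp add: invertible_def)
  then have m: "hilbert_ratmatrix K A e ** matrix_inv (hilbert_ratmatrix K A e) = mat 1"
    "matrix_inv (hilbert_ratmatrix K A e) ** hilbert_ratmatrix K A e = mat 1"
    unfolding matrix_inv_def by (metis (mono_tags, lifting) someI_ex)+
  show ?thesis
    unfolding euler_numerator_properties(2)[OF assms]
    by (rule torsion_order_eq_pole_order[symmetric]) (simp_all add: inv m euler_numerator_properties(3)[OF assms])
qed

section \<open>Growth of nonnegative power series with a pole at 1\<close>

text \<open>
  Let \<open>f\<close> be the sum function, so that \<open>f (1 - 1/K)\<close> is of the exact order \<open>K\<^sup>p\<close>. The partial sum up to \<open>N\<close>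
  is at most a constant times \<open>f (1 - 1/N)\<close>, since \<open>(1 - 1/N)\<^sup>N\<close> stays away from 0. Conversely, the tail
  of \<open>f (1 - 1/K)\<close> beyond \<open>N = T K\<close> is compared with \<open>f (1 - 1/(2K))\<close>: it is smaller than the whole by a
  factor that decays exponentially in \<open>T\<close>, so for a large constant \<open>T\<close> the first \<open>N\<close> terms carry a
  fixed share of the value.
\<close>

lemma partial_sums_bounds:
  fixes c :: "nat \<Rightarrow> real" and p :: nat
  assumes nonneg: "\<And>n. c n \<ge> 0" and summ: "\<And>x. 0 < x \<Longrightarrow> x < 1 \<Longrightarrow> summable (\<lambda>n. c n * x ^ n)"
    and lim: "((\<lambda>x. (1 - x) ^ p * (\<Sum>n. c n * x ^ n)) \<longlongrightarrow> \<alpha>) (at_left 1)" and pos: "\<alpha> > 0"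
  shows "\<exists>c1>0. \<exists>c2>0. eventually (\<lambda>N. c1 * real N ^ p \<le> (\<Sum>n\<le>N. c n) \<and> (\<Sum>n\<le>N. c n) \<le> c2 * real N ^ p) sequentially"
proof -
  define f where "f x = (\<Sum>n. c n * x ^ n)" for x
  let ?S = "\<lambda>N. \<Sum>n\<le>N. c n"
  have "eventually (\<lambda>x. \<alpha> / 2 < (1 - x) ^ p * f x \<and> (1 - x) ^ p * f x < 2 * \<alpha>) (at_left 1)"
    unfolding f_def using order_tendstoD[OF lim, of "\<alpha> / 2"] order_tendstoD[OF lim, of "2 * \<alpha>"] pos
    by (intro eventually_conj) auto
  moreover have "filterlim (\<lambda>K. 1 - 1 / real K) (at_left 1) sequentially" by real_asymp
  ultimately have "eventually (\<lambda>K. \<alpha> / 2 < (1 - (1 - 1 / real K)) ^ p * f (1 - 1 / real K) \<and>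
      (1 - (1 - 1 / real K)) ^ p * f (1 - 1 / real K) < 2 * \<alpha>) sequentially"
    using filterlim_iff by fastforce
  then have "eventually (\<lambda>K. \<alpha> / 2 * real K ^ p \<le> f (1 - 1 / real K) \<and> f (1 - 1 / real K) \<le> 2 * \<alpha> * real K ^ p) sequentially"
    using eventually_gt_at_top[of 0]
    by eventually_elim (auto simp: field_simps power_divide)
  then obtain K0 where K0: "\<And>K. K \<ge> K0 \<Longrightarrow> \<alpha> / 2 * real K ^ p \<le> f (1 - 1 / real K)"
      "\<And>K. K \<ge> K0 \<Longrightarrow> f (1 - 1 / real K) \<le> 2 * \<alpha> * real K ^ p"
    unfolding eventually_sequentially by blast
  have head: "(\<Sum>n\<le>N. c n * x ^ n) \<le> f x" if "0 < x" "x < 1" for x N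
    unfolding f_def using nonneg that by (intro sum_le_suminf summ) auto
  have upper: "eventually (\<lambda>N. ?S N \<le> 8 * \<alpha> * real N ^ p) sequentially"
  proof -
    have "exp (1::real) \<le> 3" by (rule exp_le)
    then have "exp (-1) > (1 / 4 :: real)" by (simp add: exp_minus field_simps)
    then have "eventually (\<lambda>N. (1 + (-1) / real N) ^ N > 1 / 4) sequentially"
      using order_tendstoD(1)[OF tendsto_exp_limit_sequentially[of "-1"]] by blast
    then have "eventually (\<lambda>N. (1 - 1 / real N) ^ N \<ge> 1 / 4) sequentially"
      by eventually_elim simp
    then show ?thesis using eventually_ge_at_top[of K0] eventually_ge_at_top[of 2]
    proof eventually_elim
      case (elim N)
      let ?x = "1 - 1 / real N"
      have x: "0 < ?x" "?x < 1" using elim by auto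
      have "?S N * (1 / 4) \<le> ?S N * ?x ^ N"
        using elim nonneg by (intro mult_left_mono sum_nonneg) auto
      also have "\<dots> \<le> (\<Sum>n\<le>N. c n * ?x ^ n)"
        unfolding sum_distrib_right using nonneg x by (intro sum_mono mult_left_mono power_decreasing) auto
      also have "\<dots> \<le> f ?x" by (rule head[OF x])
      also have "\<dots> \<le> 2 * \<alpha> * real N ^ p" using K0(2) elim by blast
      finally show ?case by simp
    qed
  qed
  \<comment> \<open>The factor \<open>2 ^ p\<close> is the loss in passing from \<open>K\<close> to \<open>2 * K\<close>; the bound \<open>\<alpha> / 4\<close> is half of the lower bound for \<open>f\<close>.\<close>
  have "((\<lambda>T. exp (- real T / 2) * (2 * \<alpha> * 2 ^ p)) \<longlongrightarrow> 0) sequentially" by real_asymp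
  then have "eventually (\<lambda>T. exp (- real T / 2) * (2 * \<alpha> * 2 ^ p) < \<alpha> / 4) sequentially"
    by (rule order_tendstoD(2)) (use pos in simp)
  then obtain T where T: "exp (- real T / 2) * (2 * \<alpha> * 2 ^ p) < \<alpha> / 4" "T \<ge> 1"
    using eventually_conj[OF _ eventually_ge_at_top[of 1]] eventually_sequentially by (metis (no_types, lifting) order_refl)
  have lower: "?S N \<ge> \<alpha> / 4 * real K ^ p" if K: "K \<ge> K0" "K \<ge> 2" "N \<ge> T * K" for N K
  proof -
    let ?x = "1 - 1 / real K" and ?y = "1 - 1 / real (2 * K)"
    have x: "0 < ?x" "?x < 1" and y: "0 < ?y" "?y < 1" using K by (auto simp: field_simps)
    have xy: "?x / ?y \<le> exp (- 1 / real (2 * K))"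
    proof -
      have "?x / ?y \<le> 1 - 1 / real (2 * K)" using K y by (simp add: divide_simps) (simp add: algebra_simps)
      also have "\<dots> \<le> exp (- 1 / real (2 * K))" using exp_ge_add_one_self[of "- 1 / real (2 * K)"] by simp
      finally show ?thesis .
    qed
    have xy0: "0 \<le> ?x / ?y" "?x / ?y \<le> 1" using x y K by (auto simp: field_simps)
    have tail: "c n * ?x ^ n \<le> (if n \<le> N then c n else 0) + (?x / ?y) ^ N * (c n * ?y ^ n)" for n
    proof (cases "n \<le> N")
      case True
      have "c n * ?x ^ n \<le> c n * 1" using nonneg x by (intro mult_left_mono power_le_one) auto
      then show ?thesis using True nonneg[of n] xy0 y by (simp add: add_increasing2)
    next
      case False
      have "?x ^ n = (?x / ?y) ^ n * ?y ^ n" using y by (simp add: power_divide)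
      also have "\<dots> \<le> (?x / ?y) ^ N * ?y ^ n"
        using False by (intro mult_right_mono power_decreasing xy0 zero_le_power less_imp_le[OF y(1)]) simp
      finally show ?thesis using nonneg[of n] False by (simp add: mult_left_mono mult.left_commute)
    qed
    have s1: "(\<lambda>n. if n \<le> N then c n else 0) sums ?S N"
      using sums_If_finite_set[of "{..N}" c] by simp
    have s2: "(\<lambda>n. (?x / ?y) ^ N * (c n * ?y ^ n)) sums ((?x / ?y) ^ N * f ?y)"
      unfolding f_def by (intro sums_mult summable_sums summ y)
    have "f ?x \<le> ?S N + (?x / ?y) ^ N * f ?y"
      unfolding f_def
      by (rule sums_le[OF tail summable_sums[OF summ[OF x]] sums_add[OF s1 s2, unfolded f_def]])
    moreover have "(?x / ?y) ^ N * f ?y \<le> exp (- real T / 2) * (2 * \<alpha> * real (2 * K) ^ p)"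
    proof (rule mult_mono)
      have "(?x / ?y) ^ N \<le> exp (- 1 / real (2 * K)) ^ N" using xy xy0 by (intro power_mono) auto
      also have "\<dots> = exp (real N * (- 1 / real (2 * K)))" by (rule exp_of_nat_mult[symmetric])
      also have "\<dots> \<le> exp (- real T / 2)"
      proof -
        have "real T * real K \<le> real N" using K(3) by (metis of_nat_le_iff of_nat_mult)
        then show ?thesis using K(2) by (simp add: field_simps)
      qed
      finally show "(?x / ?y) ^ N \<le> exp (- real T / 2)" .
      show "f ?y \<le> 2 * \<alpha> * real (2 * K) ^ p" using K0(2)[of "2 * K"] K by simp
      show "0 \<le> f ?y" using head[OF y, of 0] nonneg[of 0] by simp
    qed simp
    moreover have "exp (- real T / 2) * (2 * \<alpha> * real (2 * K) ^ p) \<le> \<alpha> / 4 * real K ^ p"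
      using mult_right_mono[OF less_imp_le[OF T(1)], of "real K ^ p"] by (simp add: power_mult_distrib algebra_simps)
    moreover have "\<alpha> / 2 * real K ^ p \<le> f ?x" using K0(1) K by blast
    ultimately have "\<alpha> / 2 * real K ^ p \<le> ?S N + \<alpha> / 4 * real K ^ p" by linarith
    then show ?thesis by (simp add: algebra_simps)
  qed
  have "eventually (\<lambda>N. \<alpha> / 4 * (1 / (2 * real T)) ^ p * real N ^ p \<le> ?S N) sequentially"
    using eventually_ge_at_top[of "T * (K0 + 2)"]
  proof eventually_elim
    case (elim N)
    let ?K = "N div T"
    have K: "?K \<ge> K0 + 2" using elim T(2) by (metis div_le_mono nonzero_mult_div_cancel_left not_one_le_zero)
    have "T * ?K \<le> N" by simp
    have "N < T * ?K + T" using T(2) by (metis add.commute dividend_less_times_div mult.commute mult_Suc_right not_one_le_zero zero_less_iff_neq_zero)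
    also have "\<dots> \<le> T * ?K + T * ?K" using K T(2) by simp
    finally have "real N \<le> 2 * real T * real ?K" 
      by (metis mult_2 less_imp_le mult.assoc of_nat_le_iff of_nat_mult of_nat_numeral)
    then have "1 / (2 * real T) * real N \<le> real ?K" using T(2) by (simp add: field_simps)
    then have "(1 / (2 * real T) * real N) ^ p \<le> real ?K ^ p" by (intro power_mono) auto
    then have "\<alpha> / 4 * (1 / (2 * real T)) ^ p * real N ^ p \<le> \<alpha> / 4 * real ?K ^ p"
      using pos by (simp only: power_mult_distrib mult.assoc) (simp add: mult_left_mono)
    also have "\<dots> \<le> ?S N" using K by (intro lower) auto
    finally show ?case .
  qed
  then have "eventually (\<lambda>N. \<alpha> / 4 * (1 / (2 * real T)) ^ p * real N ^ p \<le> ?S N \<and> ?S N \<le> 8 * \<alpha> * real N ^ p) sequentially"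
    using upper by (rule eventually_conj)
  moreover have "\<alpha> / 4 * (1 / (2 * real T)) ^ p > 0" "8 * \<alpha> > 0" using pos T(2) by auto
  ultimately show ?thesis by blast
qed

text \<open>
  The shift \<open>a\<close> accounts for Laurent series, whose partial sums begin in negative degrees.
\<close>

lemma log_growth_limit:
  fixes S :: "nat \<Rightarrow> real" and p a :: nat
  assumes "c1 > 0" "c2 > 0" "eventually (\<lambda>N. c1 * real N ^ p \<le> S N \<and> S N \<le> c2 * real N ^ p) sequentially"
  shows "((\<lambda>N. ln (S (N + a)) / ln (real N)) \<longlongrightarrow> real p) sequentially"
proof (rule tendsto_sandwich)
  have ev: "eventually (\<lambda>N. c1 * real (N + a) ^ p \<le> S (N + a) \<and> S (N + a) \<le> c2 * real (N + a) ^ p) sequentially"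
    using assms(3) eventually_sequentially_seg[of "\<lambda>N. c1 * real N ^ p \<le> S N \<and> S N \<le> c2 * real N ^ p" a] by blast
  show "((\<lambda>N. (ln c1 + p * ln (real (N + a))) / ln (real N)) \<longlongrightarrow> real p) sequentially" by real_asymp
  show "((\<lambda>N. (ln c2 + p * ln (real (N + a))) / ln (real N)) \<longlongrightarrow> real p) sequentially" by real_asymp
  show "eventually (\<lambda>N. (ln c1 + p * ln (real (N + a))) / ln (real N) \<le> ln (S (N + a)) / ln (real N)) sequentially"
    using ev eventually_gt_at_top[of 1]
  proof eventually_elim
    case (elim N)
    have "ln c1 + p * ln (real (N + a)) = ln (c1 * real (N + a) ^ p)"
      using assms(1) elim by (simp add: ln_mult ln_realpow)
    also have "\<dots> \<le> ln (S (N + a))" using elim assms(1) by (subst ln_le_cancel_iff) (auto intro: less_le_trans[of 0 "c1 * real (N + a) ^ p"])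
    finally show ?case using elim by (intro divide_right_mono) auto
  qed
  show "eventually (\<lambda>N. ln (S (N + a)) / ln (real N) \<le> (ln c2 + p * ln (real (N + a))) / ln (real N)) sequentially"
    using ev eventually_gt_at_top[of 1]
  proof eventually_elim
    case (elim N)
    have pos: "0 < c1 * real (N + a) ^ p" using assms(1) elim by simp
    have "ln (S (N + a)) \<le> ln (c2 * real (N + a) ^ p)"
      using elim pos assms(2) by (subst ln_le_cancel_iff) auto
    also have "\<dots> = ln c2 + p * ln (real (N + a))"
      using assms(2) elim by (simp add: ln_mult ln_realpow)
    finally show ?case using elim by (intro divide_right_mono) auto
  qed
qed

section \<open>Integer power series with poles outside the open unit disc\<close>

abbreviation rat_poly :: "rat poly \<Rightarrow> 'a::field_char_0 poly" where
  "rat_poly \<equiv> map_poly of_rat"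

text \<open>
  Base change from the rational numbers, needed for the complex numbers (poles and radii of convergence)
  and for the real numbers (limits at 1).
\<close>

definition rat_fps :: "rat fps \<Rightarrow> 'a::field_char_0 fps" where
  "rat_fps f = Abs_fps (\<lambda>n. of_rat (fps_nth f n))"

lemma rat_fps_nth [simp]: "fps_nth (rat_fps f) n = of_rat (fps_nth f n)"
  by (simp add: rat_fps_def)

lemma rat_fps_mult: "rat_fps (f * g) = rat_fps f * rat_fps g"
  by (simp add: fps_eq_iff fps_mult_nth of_rat_sum of_rat_mult)

lemma rat_fps_of_poly: "rat_fps (fps_of_poly p) = fps_of_poly (rat_poly p)"
  by (simp add: fps_eq_iff coeff_map_poly)

lemma rat_poly_mult: "rat_poly (p * q) = rat_poly p * rat_poly q"
  by (rule poly_eqI) (simp add: coeff_map_poly coeff_mult of_rat_sum of_rat_mult)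

lemma rat_poly_add: "rat_poly (p + q) = rat_poly p + rat_poly q"
  by (rule poly_eqI) (simp add: coeff_map_poly of_rat_add)

lemma rat_poly_pderiv: "rat_poly (pderiv p) = pderiv (rat_poly p)"
  by (rule poly_eqI) (simp add: coeff_map_poly coeff_pderiv of_rat_mult of_rat_add)

lemma rat_poly_eq_0_iff [simp]: "(rat_poly p :: 'a::field_char_0 poly) = 0 \<longleftrightarrow> p = 0"
  by (simp add: poly_eq_iff coeff_map_poly)

lemma rat_poly_smult: "rat_poly (Polynomial.smult c p) = Polynomial.smult (of_rat c) (rat_poly p)"
  by (rule poly_eqI) (simp add: coeff_map_poly of_rat_mult)

lemma rat_poly_1 [simp]: "rat_poly 1 = 1"
  by (rule poly_eqI) (simp add: coeff_map_poly)

lemma poly_rat_poly_of_rat: "poly (rat_poly p) (of_rat x) = of_rat (poly p x)"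
  by (induction p) (simp_all add: map_poly_pCons of_rat_add of_rat_mult)

lemma rat_poly_power: "rat_poly (p ^ n) = rat_poly p ^ n"
  by (induction n) (simp_all add: rat_poly_mult)

lemma eval_rational_series:
  fixes z :: "'a::{banach, real_normed_field}"
  assumes "fps_of_poly q * F = fps_of_poly P" "norm z < fps_conv_radius (rat_fps F :: 'a fps)"
  shows "poly (rat_poly q) z * eval_fps (rat_fps F) z = poly (rat_poly P) z"
proof -
  have "fps_of_poly (rat_poly q) * rat_fps F = (fps_of_poly (rat_poly P) :: 'a fps)"
    unfolding rat_fps_of_poly[symmetric] rat_fps_mult[symmetric] assms(1) ..
  then have "eval_fps (fps_of_poly (rat_poly q) * rat_fps F) z = poly (rat_poly P) z" by simp
  then show ?thesis using assms(2) by (simp add: eval_fps_mult)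
qed

definition bounded_fps :: "complex fps \<Rightarrow> bool" where
  "bounded_fps f \<longleftrightarrow> (\<exists>B. \<forall>n. norm (fps_nth f n) \<le> B)"

lemma bounded_fps_add: "bounded_fps f \<Longrightarrow> bounded_fps g \<Longrightarrow> bounded_fps (f + g)"
proof -
  assume "bounded_fps f" "bounded_fps g"
  then obtain B C where "\<And>n. norm (fps_nth f n) \<le> B" "\<And>n. norm (fps_nth g n) \<le> C"
    unfolding bounded_fps_def by blast
  then have "\<And>n. norm (fps_nth (f + g) n) \<le> B + C" by (simp add: norm_triangle_mono)
  then show ?thesis unfolding bounded_fps_def by blast
qed

lemma bounded_fps_poly_mult: "bounded_fps f \<Longrightarrow> bounded_fps (fps_of_poly p * f)"
proof (induction p)
  case 0 then show ?case by (auto simp: bounded_fps_def)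
next
  case (pCons a p)
  have "fps_of_poly (pCons a p) * f = fps_const a * f + fps_X * (fps_of_poly p * f)"
    by (simp add: fps_of_poly_pCons algebra_simps)
  moreover have "bounded_fps (fps_const a * f)"
  proof -
    obtain B where "\<And>n. norm (fps_nth f n) \<le> B" using pCons.prems unfolding bounded_fps_def by blast
    then have "\<And>n. norm (fps_nth (fps_const a * f) n) \<le> norm a * B" by (simp add: norm_mult mult_left_mono)
    then show ?thesis unfolding bounded_fps_def by blast
  qed
  moreover have "bounded_fps (fps_X * g)" if g: "bounded_fps g" for g
  proof -
    obtain B where B: "\<And>n. norm (fps_nth g n) \<le> B" using g unfolding bounded_fps_def by blast
    then have "\<And>n. norm (fps_nth (fps_X * g) n) \<le> B" using order_trans[OF norm_ge_zero B[of 0]] by simp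
    then show ?thesis unfolding bounded_fps_def by blast
  qed
  ultimately show ?case using pCons by (simp add: bounded_fps_add)
qed

lemma bounded_fps_inverse_linear:
  assumes "norm z \<ge> 1"
  shows "bounded_fps (inverse (fps_of_poly [:-z, 1:]))"
proof -
  have z: "z \<noteq> 0" using assms by auto
  have "fps_of_poly [:-z, 1:] * Abs_fps (\<lambda>n. - (inverse z ^ Suc n)) = 1"
  proof (rule fps_ext)
    fix n
    show "fps_nth (fps_of_poly [:-z, 1:] * Abs_fps (\<lambda>n. - (inverse z ^ Suc n))) n = fps_nth 1 n"
      using z by (cases n) (simp_all add: fps_of_poly_linear algebra_simps)
  qed
  then have "inverse (fps_of_poly [:-z, 1:]) = Abs_fps (\<lambda>n. - (inverse z ^ Suc n))"
    by (metis fps_inverse_unique)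
  moreover have "norm (fps_nth (Abs_fps (\<lambda>n. - (inverse z ^ Suc n))) n) \<le> 1" for n
    using power_le_one[of "inverse (norm z)" "Suc n"] assms
    by (simp add: norm_inverse norm_power norm_mult inverse_le_1_iff)
  ultimately show ?thesis unfolding bounded_fps_def by metis
qed

text \<open>
  A partial fraction decomposition in disguise: a linear factor \<open>L\<close> and the product \<open>W\<close> of the others
  satisfy \<open>1 = c W + s L\<close> with a constant \<open>c\<close> and a polynomial \<open>s\<close>, so that \<open>1/(L W) = c/L + s/W\<close>.
\<close>

lemma bounded_fps_inverse_prod:
  assumes "finite Z" "\<And>z. z \<in> Z \<Longrightarrow> norm z \<ge> 1"
  shows "bounded_fps (inverse (fps_of_poly (\<Prod>z\<in>Z. [:-z, 1:])))"
  using assms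
proof (induction Z rule: finite_induct)
  case empty
  have "norm (fps_nth (1 :: complex fps) n) \<le> 1" for n by simp
  then show ?case unfolding bounded_fps_def by auto
next
  case (insert z Z)
  let ?W = "\<Prod>z\<in>Z. [:-z, 1:]" and ?L = "[:-z, 1:]"
  have "poly ?W z = (\<Prod>x\<in>Z. z - x)" by (simp add: poly_prod)
  then have w: "poly ?W z \<noteq> 0" using insert.hyps by auto
  define c where "c = inverse (poly ?W z)"
  have "?L dvd ?W - [:poly ?W z:]" by (simp add: poly_eq_0_iff_dvd[symmetric])
  then obtain Q where Q: "?W - [:poly ?W z:] = ?L * Q" by (elim dvdE)
  have bez: "1 = [:c:] * ?W + Polynomial.smult (-c) Q * ?L"
  proof (rule poly_ext)
    fix x
    have "poly ?W x - poly ?W z = (x - z) * poly Q x"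
      using arg_cong[OF Q, of "\<lambda>p. poly p x"] by (simp add: algebra_simps)
    moreover have "poly ([:c:] * ?W + Polynomial.smult (-c) Q * ?L) x = c * poly ?W x - c * ((x - z) * poly Q x)"
      by (simp add: algebra_simps)
    ultimately have "poly ([:c:] * ?W + Polynomial.smult (-c) Q * ?L) x = c * poly ?W x - c * (poly ?W x - poly ?W z)"
      by simp
    also have "\<dots> = 1" using w by (simp add: c_def algebra_simps)
    finally show "poly 1 x = poly ([:c:] * ?W + Polynomial.smult (-c) Q * ?L) x" by simp
  qed
  let ?w = "fps_of_poly ?W" and ?l = "fps_of_poly ?L"
  have "coeff ?W 0 = poly ?W 0" by (simp add: poly_0_coeff_0)
  also have "\<dots> \<noteq> 0" using insert.prems[of 0] insert.hyps(1) by (auto simp: poly_prod)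
  finally have w0: "fps_nth ?w 0 \<noteq> 0" by simp
  have l0: "fps_nth ?l 0 \<noteq> 0" using insert.prems[of z] by auto
  let ?X = "fps_of_poly [:c:] * inverse ?l + fps_of_poly (Polynomial.smult (-c) Q) * inverse ?w"
  have "(?l * ?w) * ?X = fps_of_poly [:c:] * ?w * (?l * inverse ?l) +
      fps_of_poly (Polynomial.smult (-c) Q) * ?l * (?w * inverse ?w)"
    by (simp only: algebra_simps)
  also have "\<dots> = fps_of_poly ([:c:] * ?W + Polynomial.smult (-c) Q * ?L)"
    using inverse_mult_eq_1'[OF w0] inverse_mult_eq_1'[OF l0] by (simp only: fps_of_poly_add fps_of_poly_mult mult_1_right)
  also have "\<dots> = 1" unfolding bez[symmetric] by simp
  finally have "inverse (?l * ?w) = ?X" by (rule fps_inverse_unique)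
  then have "inverse (fps_of_poly (?L * ?W)) = ?X" by (simp only: fps_of_poly_mult)
  moreover have "bounded_fps (inverse ?l)" using insert.prems by (intro bounded_fps_inverse_linear) auto
  moreover have "bounded_fps (inverse ?w)" using insert by auto
  ultimately show ?case
    unfolding prod.insert[OF insert.hyps] by (simp only: bounded_fps_add bounded_fps_poly_mult)
qed

lemma bounded_fps_inverse_rsquarefree:
  assumes "rsquarefree W" "\<And>z. poly W z = 0 \<Longrightarrow> norm z \<ge> 1"
  shows "bounded_fps (inverse (fps_of_poly W))"
proof -
  have W0: "W \<noteq> 0" using assms(1) by (auto simp: rsquarefree_def)
  let ?Q = "\<Prod>z|poly W z = 0. [:-z, 1:]"
  have W: "W = Polynomial.smult (lead_coeff W) ?Q" using complex_poly_decompose_rsquarefree[OF assms(1)] by simp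
  have fin: "finite {z. poly W z = 0}" using poly_roots_finite[OF W0] .
  have "inverse (fps_of_poly W) = fps_const (inverse (lead_coeff W)) * inverse (fps_of_poly ?Q)"
    by (subst W) (simp add: fps_of_poly_smult fps_inverse_mult fps_const_inverse)
  also have "\<dots> = fps_of_poly [:inverse (lead_coeff W):] * inverse (fps_of_poly ?Q)"
    by (simp add: fps_of_poly_const)
  finally show ?thesis using bounded_fps_poly_mult[OF bounded_fps_inverse_prod[OF fin]] assms(2) by simp
qed

text \<open>
  Only finitely many windows of \<open>d\<close> consecutive values are possible, so some window occurs twice, and a
  window determines all later values.
\<close>

lemma recurrence_eventually_periodic:
  fixes v :: "nat \<Rightarrow> 'a::field" and r :: "nat \<Rightarrow> 'a"
  assumes "r 0 \<noteq> 0" "n0 \<ge> d" "\<And>n. n \<ge> n0 \<Longrightarrow> (\<Sum>i\<le>d. r i * v (n - i)) = 0" "finite (range v)"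
  shows "\<exists>p>0. \<exists>m. \<forall>k\<ge>m. v (k + p) = v k"
proof -
  define w where "w n = map (\<lambda>i. v (n + i)) [0..<d]" for n
  have "finite {xs. set xs \<subseteq> range v \<and> length xs = d}" using assms(4) by (rule finite_lists_length_eq)
  moreover have "w ` {n0..} \<subseteq> {xs. set xs \<subseteq> range v \<and> length xs = d}" by (auto simp: w_def)
  ultimately have "finite (w ` {n0..})" by (rule rev_finite_subset)
  then have "\<not> inj_on w {n0..}" using finite_imageD infinite_Ici by blast
  then obtain m m' where m: "m \<ge> n0" "m < m'" "w m = w m'"
    unfolding inj_on_def by (metis atLeast_iff linorder_neqE_nat)
  have win: "v (m + i) = v (m' + i)" if "i < d" for i
  proof -
    have "w m ! i = w m' ! i" using m(3) by simp
    then show ?thesis using that by (simp add: w_def)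
  qed
  have rec: "v n = - (\<Sum>i=1..d. r i * v (n - i)) / r 0" if "n \<ge> n0" for n
  proof -
    have "(\<Sum>i\<le>d. r i * v (n - i)) = r 0 * v n + (\<Sum>i=1..d. r i * v (n - i))"
      by (simp add: atMost_atLeast0 sum.atLeast_Suc_atMost)
    then show ?thesis using assms(3)[OF that] assms(1) by (simp add: field_simps eq_neg_iff_add_eq_0)
  qed
  have "v (m + k) = v (m' + k)" for k
  proof (induction k rule: less_induct)
    case (less k)
    show ?case
    proof (cases "k < d")
      case False
      have "v (m + k - i) = v (m' + k - i)" if "i \<in> {1..d}" for i
        using less[of "k - i"] that False by simp
      then have "(\<Sum>i=1..d. r i * v (m + k - i)) = (\<Sum>i=1..d. r i * v (m' + k - i))" by simp
      then show ?thesis using rec[of "m + k"] rec[of "m' + k"] m by simp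
    qed (rule win)
  qed
  then have "v (k + (m' - m)) = v k" if "k \<ge> m" for k
    using that m(2) by (metis (no_types, lifting) add.commute add_diff_inverse_nat diff_add_assoc2 less_imp_le not_less le_add_diff_inverse)
  then show ?thesis using m(2) by (intro exI[of _ "m' - m"]) auto
qed

lemma common_denominator:
  fixes p :: "rat poly"
  shows "\<exists>N. N \<noteq> 0 \<and> N \<in> \<int> \<and> (\<forall>i. N * coeff p i \<in> \<int>)"
proof (induction p)
  case 0 then show ?case by (intro exI[of _ 1]) simp
next
  case (pCons a p)
  then obtain N where N: "N \<noteq> 0" "N \<in> \<int>" "\<And>i. N * coeff p i \<in> \<int>" by blast
  obtain x y where "quotient_of a = (x, y)" by fastforce
  then have xy: "a = of_int x / of_int y" "y > 0"
    using quotient_of_div quotient_of_denom_pos by blast+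
  have "(N * of_int y) * coeff (pCons a p) i \<in> \<int>" for i
  proof (cases i)
    case 0
    have "(N * of_int y) * a = N * of_int x" using xy by simp
    moreover have "N * of_int x \<in> \<int>" using N(2) by simp
    ultimately show ?thesis using 0 by (metis coeff_pCons_0)
  next
    case (Suc j)
    have "(N * of_int y) * coeff p j = of_int y * (N * coeff p j)" by simp
    also have "\<dots> \<in> \<int>" by (intro Ints_mult N(3) Ints_of_int)
    finally show ?thesis using Suc by simp
  qed
  then show ?case using N xy(2) by (intro exI[of _ "N * of_int y"]) simp
qed

text \<open>
  The square-free part \<open>R\<close> of the denominator has the same roots, and \<open>R\<close> is the denominator of a series
  \<open>v\<close> with integer coefficients, namely of a constant multiple of \<open>G F\<close> with \<open>G\<close> the cofactor of \<open>R\<close>. As the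
  poles of \<open>v\<close> are simple, \<open>v\<close> is bounded, hence eventually periodic, and the roots of \<open>R\<close> are roots of
  some \<open>1 - X\<^sup>p\<close>.
\<close>

lemma integer_series_poles:
  assumes eq: "fps_of_poly q * F = fps_of_poly P" and "q \<noteq> 0"
    and int: "\<And>n. fps_nth F n \<in> \<int>"
    and common: "\<And>z :: complex. poly (rat_poly q) z = 0 \<Longrightarrow> z \<noteq> 0 \<Longrightarrow> poly (rat_poly P) z \<noteq> 0"
    and rad: "fps_conv_radius (rat_fps F :: complex fps) \<ge> 1"
    and z0: "poly (rat_poly q) (z0 :: complex) = 0" "z0 \<noteq> 0"
  shows "\<exists>n>0. z0 ^ n = 1"
proof -
  have outside: "norm z \<ge> 1" if "poly (rat_poly q) z = 0" "z \<noteq> 0" for z :: complex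
  proof (rule ccontr)
    assume "\<not> norm z \<ge> 1"
    then have "ereal (norm z) < fps_conv_radius (rat_fps F :: complex fps)"
      using rad by (metis ereal_less(3) not_le order.strict_trans2)
    from eval_rational_series[OF eq this] that common[of z] show False by simp
  qed
  obtain q1 where q1: "q = [:0, 1:] ^ Polynomial.order 0 q * q1" "\<not> [:0, 1:] dvd q1"
    using order_decomp[OF \<open>q \<noteq> 0\<close>, of 0] by auto
  define b where "b = Polynomial.order 0 q"
  have q1_0: "coeff q1 0 \<noteq> 0" using q1(2) poly_eq_0_iff_dvd[of q1 0] by (simp add: poly_0_coeff_0)
  have q1_nz: "q1 \<noteq> 0" using q1_0 by auto
  have qX: "fps_of_poly q = fps_X ^ b * fps_of_poly q1"
    by (subst q1(1)) (simp add: fps_of_poly_mult fps_of_poly_power b_def)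
  \<comment> \<open>A possible pole at 0 is divided out, since the recurrence needs a nonzero constant coefficient.\<close>
  define P1 where "P1 = poly_shift b P"
  have eq1: "fps_of_poly q1 * F = fps_of_poly P1"
  proof -
    have "fps_of_poly P1 = fps_shift b (fps_X ^ b * (fps_of_poly q1 * F))"
      unfolding P1_def fps_of_poly_shift eq[symmetric] qX by (simp add: mult.assoc)
    moreover have "fps_shift b (fps_X ^ b * (fps_of_poly q1 * F)) = fps_of_poly q1 * F"
      by (rule fps_ext) (simp add: fps_X_power_mult_nth)
    ultimately show ?thesis by simp
  qed
  have P_eq: "P = [:0, 1:] ^ b * P1"
  proof -
    have "fps_of_poly P = fps_of_poly ([:0, 1:] ^ b * P1)"
      unfolding eq[symmetric] qX fps_of_poly_mult fps_of_poly_power eq1[symmetric] by (simp add: mult.assoc)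
    then show ?thesis by (simp add: fps_of_poly_eq_iff)
  qed
  have root1: "poly (rat_poly q) z = 0" if "poly (rat_poly q1) z = 0" for z :: complex
    using that by (subst q1(1)) (simp add: rat_poly_mult)
  have root1_nz: "z \<noteq> 0" if "poly (rat_poly q1) z = 0" for z :: complex
    using that q1_0 by (auto simp: poly_0_coeff_0 coeff_map_poly)
  have P1_nz: "poly (rat_poly P1) z \<noteq> 0" if "poly (rat_poly q1) z = 0" for z :: complex
    using common[OF root1[OF that] root1_nz[OF that]] by (subst (asm) P_eq) (simp add: rat_poly_mult)
  have z0_root: "poly (rat_poly q1) z0 = 0"
    using z0 by (subst (asm) (1) q1(1)) (simp add: rat_poly_mult rat_poly_power poly_power map_poly_pCons)
  have "pderiv q1 \<noteq> 0"
  proof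
    assume "pderiv q1 = 0"
    then have "degree q1 = 0" by (simp add: pderiv_eq_0_iff)
    then obtain c where "q1 = [:c:]" by (elim degree_eq_zeroE)
    then show False using q1_nz z0_root by (simp add: map_poly_pCons)
  qed
  \<comment> \<open>The polynomial \<open>R = q1 / G\<close> is the square-free part of \<open>q1\<close>.\<close>
  define G where "G = gcd q1 (pderiv q1)"
  define R where "R = q1 div G"
  obtain e where e: "pderiv q1 = e * G" using gcd_dvd2[of q1 "pderiv q1"] unfolding G_def by (metis dvdE mult.commute)
  have R: "q1 = R * G" unfolding R_def G_def by simp
  obtain x y where xy: "G = x * q1 + y * pderiv q1"
    unfolding G_def by (metis bezout_coefficients_fst_snd)
  have "rsquarefree (rat_poly R :: complex poly) \<and> (\<forall>a. poly (rat_poly R) a = 0 \<longleftrightarrow> poly (rat_poly q1) (a :: complex) = 0)"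
  proof (rule poly_squarefree_decomp)
    show "pderiv (rat_poly q1 :: complex poly) \<noteq> 0"
      using \<open>pderiv q1 \<noteq> 0\<close> by (simp flip: rat_poly_pderiv)
    show "(rat_poly q1 :: complex poly) = rat_poly R * rat_poly G" by (subst R) (rule rat_poly_mult)
    show "pderiv (rat_poly q1 :: complex poly) = rat_poly e * rat_poly G"
      unfolding rat_poly_pderiv[symmetric] by (subst e) (rule rat_poly_mult)
    show "(rat_poly G :: complex poly) = rat_poly x * rat_poly q1 + rat_poly y * pderiv (rat_poly q1)"
      unfolding rat_poly_pderiv[symmetric] by (subst xy) (simp add: rat_poly_add rat_poly_mult)
  qed
  then have sqf: "rsquarefree (rat_poly R :: complex poly)"
    and R_root: "\<And>a. poly (rat_poly R) a = 0 \<longleftrightarrow> poly (rat_poly q1) (a :: complex) = 0" by auto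
  obtain N where N: "N \<noteq> 0" "\<And>i. N * coeff G i \<in> \<int>" using common_denominator by metis
  define v where "v = fps_of_poly (Polynomial.smult N G) * F"
  define T where "T = Polynomial.smult N P1"
  have v_int: "fps_nth v n \<in> \<int>" for n
    unfolding v_def fps_mult_nth using N(2) int by (intro Ints_sum Ints_mult) simp_all
  have Rv: "fps_of_poly R * v = fps_of_poly T"
  proof -
    have "fps_of_poly R * v = fps_const N * (fps_of_poly (R * G) * F)"
      by (simp add: v_def fps_of_poly_smult fps_of_poly_mult mult_ac)
    then show ?thesis using eq1 R by (simp add: T_def fps_of_poly_smult)
  qed
  have R0: "coeff R 0 \<noteq> 0"
  proof -
    have "coeff q1 0 = coeff R 0 * coeff G 0" by (subst R) (simp add: coeff_mult)
    then show ?thesis using q1_0 by auto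
  qed
  have "bounded_fps (rat_fps v)"
  proof -
    let ?r = "fps_of_poly (rat_poly R) :: complex fps"
    have rv: "?r * rat_fps v = fps_of_poly (rat_poly T)"
      unfolding rat_fps_of_poly[symmetric] rat_fps_mult[symmetric] Rv ..
    have "fps_nth ?r 0 \<noteq> 0" using R0 by (simp add: coeff_map_poly)
    then have "rat_fps v = (inverse ?r * ?r) * rat_fps v" by (simp add: inverse_mult_eq_1)
    also have "\<dots> = (?r * rat_fps v) * inverse ?r" by (simp only: mult_ac)
    finally have "rat_fps v = fps_of_poly (rat_poly T) * inverse ?r" unfolding rv .
    moreover have "bounded_fps (inverse (fps_of_poly (rat_poly R)))"
      using sqf R_root outside root1 root1_nz by (intro bounded_fps_inverse_rsquarefree) auto
    ultimately show ?thesis by (simp add: bounded_fps_poly_mult)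
  qed
  then obtain B where B: "\<And>n. norm (of_rat (fps_nth v n) :: complex) \<le> B" unfolding bounded_fps_def by auto
  have "finite (range (fps_nth v))"
  proof (rule finite_subset[OF _ finite_abs_int_segment[of "of_int \<lceil>B\<rceil>"]], safe)
    fix n
    show "fps_nth v n \<in> \<int>" by (rule v_int)
    then obtain k where k: "fps_nth v n = of_int k" by (elim Ints_cases)
    have "norm (of_int k :: complex) \<le> B" using B[of n] k by simp
    then have "\<bar>of_int k :: real\<bar> \<le> B" by simp
    then have "\<bar>k\<bar> \<le> \<lceil>B\<rceil>" by linarith
    then show "\<bar>fps_nth v n\<bar> \<le> of_int \<lceil>B\<rceil>" unfolding k by (metis of_int_abs of_int_le_iff)
  qed
  moreover have "(\<Sum>i\<le>degree R. coeff R i * fps_nth v (n - i)) = 0" if n: "n \<ge> max (degree R) (Suc (degree T))" for n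
  proof -
    have "(\<Sum>i\<le>degree R. coeff R i * fps_nth v (n - i)) = (\<Sum>i=0..n. coeff R i * fps_nth v (n - i))"
      using n by (intro sum.mono_neutral_left) (auto simp: coeff_eq_0)
    also have "\<dots> = fps_nth (fps_of_poly R * v) n" by (simp add: fps_mult_nth)
    also have "\<dots> = 0" unfolding Rv using n by (simp add: coeff_eq_0)
    finally show ?thesis .
  qed
  ultimately obtain p m where p: "p > 0" "\<And>k. k \<ge> m \<Longrightarrow> fps_nth v (k + p) = fps_nth v k"
    using recurrence_eventually_periodic[of "coeff R" "degree R" "max (degree R) (Suc (degree T))" "fps_nth v"] R0
    by auto
  \<comment> \<open>Periodicity makes \<open>(1 - X ^ p) * v\<close> a polynomial.\<close>
  define U where "U = truncate_fps (m + p) ((1 - fps_X ^ p) * v)"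
  have U: "fps_of_poly U = (1 - fps_X ^ p) * v"
    unfolding U_def fps_of_poly_truncate
  proof (rule fps_ext)
    fix n
    show "fps_nth (fps_cutoff (m + p) ((1 - fps_X ^ p) * v)) n = fps_nth ((1 - fps_X ^ p) * v) n"
      using p(2)[of "n - p"] by (auto simp: left_diff_distrib fps_X_power_mult_nth)
  qed
  have "fps_of_poly (R * U) = fps_of_poly ((1 - [:0, 1:] ^ p) * T)"
    unfolding fps_of_poly_mult U Rv[symmetric]
    by (simp add: fps_of_poly_diff fps_of_poly_power mult.left_commute)
  then have "R * U = (1 - [:0, 1:] ^ p) * T" by (simp add: fps_of_poly_eq_iff)
  then have "poly (rat_poly (R * U)) z0 = poly (rat_poly ((1 - [:0, 1:] ^ p) * T)) z0" by simp
  moreover have "rat_poly (1 - [:0, 1:] ^ p) = (1 - [:0, 1:] ^ p :: complex poly)"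
    by (rule poly_eqI) (simp add: coeff_map_poly of_rat_diff monom_altdef[of 1, simplified, symmetric])
  ultimately have "(1 - z0 ^ p) * poly (rat_poly T) z0 = 0"
    using z0_root R_root[of z0] by (simp add: rat_poly_mult)
  moreover have "poly (rat_poly T) z0 \<noteq> 0" using P1_nz[OF z0_root] N(1) by (simp add: T_def rat_poly_smult)
  ultimately show ?thesis using p(1) by auto
qed

section \<open>Poles and expansions\<close>

abbreviation "num \<equiv> \<lambda>g :: ratfun. fst (quot_of_fract g)"
abbreviation "den \<equiv> \<lambda>g :: ratfun. snd (quot_of_fract g)"

lemma num_den_no_common_root:
  "poly (rat_poly (den g)) z = 0 \<Longrightarrow> poly (rat_poly (num g)) z \<noteq> 0"
proof
  assume z: "poly (rat_poly (den g)) z = 0" "poly (rat_poly (num g)) z = 0"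
  obtain x y where "x * num g + y * den g = gcd (num g) (den g)"
    by (metis bezout_coefficients_fst_snd)
  moreover have "coprime (num g) (den g)" by (rule coprime_quot_of_fract)
  ultimately have xy: "x * num g + y * den g = 1" by (simp add: coprime_iff_gcd_eq_1)
  have "1 = poly (rat_poly (x * num g + y * den g)) z" unfolding xy by simp
  also have "\<dots> = 0" using z by (simp add: rat_poly_add rat_poly_mult)
  finally show False by simp
qed

text \<open>
  Numerator and denominator are coprime over the rational numbers, hence have no common complex root.
\<close>

lemma is_pole_ratfun_eval: "is_pole (ratfun_eval g) z \<longleftrightarrow> poly (rat_poly (den g)) z = 0"
proof
  assume z: "poly (rat_poly (den g)) z = 0"
  let ?d = "rat_poly (den g) :: complex poly"
  have d0: "?d \<noteq> 0" by simp
  have "filterlim (poly ?d) (at 0) (at z)"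
  proof (rule filterlim_atI)
    have "(poly ?d \<longlongrightarrow> poly ?d z) (at z)" by (intro isContD) simp
    then show "(poly ?d \<longlongrightarrow> 0) (at z)" using z by simp
    have "finite ({w. poly ?d w = 0} - {z})" using poly_roots_finite[OF d0] by simp
    then have "open (- ({w. poly ?d w = 0} - {z}))" by (intro open_Compl finite_imp_closed)
    then have "eventually (\<lambda>w. w \<in> - ({w. poly ?d w = 0} - {z})) (at z)"
      by (rule eventually_at_in_open') simp
    then show "eventually (\<lambda>w. poly ?d w \<noteq> 0) (at z)"
      using eventually_neq_at_within[of z z UNIV] by eventually_elim auto
  qed
  then show "is_pole (ratfun_eval g) z"
    unfolding ratfun_eval_def using num_den_no_common_root[OF z] by (intro is_pole_divide) simp_all
next
  assume p: "is_pole (ratfun_eval g) z"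
  show "poly (rat_poly (den g)) z = 0"
  proof (rule ccontr)
    assume "poly (rat_poly (den g)) z \<noteq> 0"
    then have "isCont (ratfun_eval g) z" unfolding ratfun_eval_def by (intro isCont_divide) simp_all
    then have "(ratfun_eval g \<longlongrightarrow> ratfun_eval g z) (at z)" by (rule isContD)
    moreover have "filterlim (ratfun_eval g) at_infinity (at z)" using p by (simp add: is_pole_def)
    ultimately show False using not_tendsto_and_filterlim_at_infinity[of "at z"] by simp
  qed
qed

text \<open>
  Multiplication by a power of \<open>X\<close> turns the Laurent series into a power series. Its numerator picks up
  the same power, which leaves the nonzero poles unchanged.
\<close>

lemma expansion_shift:
  assumes "\<And>n. n < - int a \<Longrightarrow> fls_nth (expansion 0 g) n = 0"
  defines "F \<equiv> Abs_fps (\<lambda>n. fls_nth (expansion 0 g) (int n - int a))"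
  shows "fps_of_poly (den g) * F = fps_of_poly ([:0, 1:] ^ a * num g)"
proof -
  have F: "fps_to_fls F = expansion 0 g * fls_X powi (int a)"
  proof (rule fls_eqI)
    fix n
    show "fls_nth (fps_to_fls F) n = fls_nth (expansion 0 g * fls_X powi int a) n"
      unfolding fls_mult_X_powi_nth using assms(1)[of "n - int a"] by (auto simp: F_def)
  qed
  have den0: "fps_to_fls (fps_of_poly (den g)) \<noteq> 0" using poly_expansion_eq_0_iff[of 0 "den g"] by (simp add: poly_expansion_0)
  have "fps_to_fls (fps_of_poly (den g)) * expansion 0 g = fps_to_fls (fps_of_poly (num g))"
    unfolding expansion_def using den0 by simp
  then have "fps_to_fls (fps_of_poly (den g)) * fps_to_fls F = fps_to_fls (fps_of_poly (num g)) * fls_X ^ a"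
    unfolding F by (simp only: power_int_of_nat flip: mult.assoc)
  also have "\<dots> = fps_to_fls (fps_of_poly ([:0, 1:] ^ a * num g))"
    by (simp add: fps_of_poly_mult fps_of_poly_power fls_times_fps_to_fls fps_to_fls_power mult.commute)
  finally show ?thesis by (simp only: fls_times_fps_to_fls[symmetric] fps_to_fls_eq_iff)
qed

text \<open>
  The order of the pole at 1, as the fraction \<open>num g / den g\<close> is reduced.
\<close>

definition order_at_1 :: "ratfun \<Rightarrow> nat" where
  "order_at_1 g = Polynomial.order 1 (den g)"

lemma den_factor:
  obtains d where "den g = [:-1, 1:] ^ order_at_1 g * d" "poly d 1 \<noteq> 0"
  using order_decomp[OF snd_quot_of_fract_nonzero[of g], of 1] that
  by (auto simp: order_at_1_def poly_eq_0_iff_dvd)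

lemma is_power_series_expansion_iff:
  "is_power_series (fls_X ^ d * expansion 1 g) \<longleftrightarrow> order_at_1 g \<le> d"
proof -
  let ?b = "order_at_1 g" and ?E = "poly_expansion 1"
  obtain q where q: "den g = [:-1, 1:] ^ ?b * q" "poly q 1 \<noteq> 0" by (rule den_factor)
  have X: "?E [:-1, 1:] = fps_X" by (simp add: poly_expansion_def pcompose_pCons)
  have Epow: "?E (p ^ n) = ?E p ^ n" for p n by (induction n) (simp_all add: poly_expansion_simps)
  have Eden: "?E (den g) = fps_X ^ ?b * ?E q" by (subst q(1)) (simp add: poly_expansion_simps Epow X)
  have const: "fps_nth (?E p) 0 = poly p 1" for p
    by (simp add: poly_expansion_def poly_0_coeff_0[symmetric] poly_pcompose)
  have unit: "?E q * inverse (?E q) = 1" using q(2) by (intro inverse_mult_eq_1') (simp add: const)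
  have ex: "expansion 1 g = fps_to_fls (?E (num g)) / fps_to_fls (?E (den g))"
    by (simp add: expansion_def poly_expansion_def)
  have den0: "fps_to_fls (?E (den g)) \<noteq> 0" by simp
  show ?thesis
  proof
    assume le: "?b \<le> d"
    have "fls_X ^ d * expansion 1 g = fps_to_fls (fps_X ^ (d - ?b) * ?E (num g) * inverse (?E q))"
    proof -
      have "fps_X ^ d * ?E (num g) = fps_X ^ (d - ?b) * ?E (num g) * inverse (?E q) * ?E (den g)"
      proof -
        have "fps_X ^ (d - ?b) * ?E (num g) * inverse (?E q) * ?E (den g) =
            (fps_X ^ (d - ?b) * fps_X ^ ?b) * ?E (num g) * (?E q * inverse (?E q))"
          unfolding Eden by (simp only: mult_ac)
        also have "\<dots> = fps_X ^ d * ?E (num g)" using le unit by (simp flip: power_add)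
        finally show ?thesis by (rule sym)
      qed
      then have "fps_to_fls (fps_X ^ d * ?E (num g)) =
          fps_to_fls (fps_X ^ (d - ?b) * ?E (num g) * inverse (?E q) * ?E (den g))" by (simp only:)
      then have "fls_X ^ d * fps_to_fls (?E (num g)) =
          fps_to_fls (fps_X ^ (d - ?b) * ?E (num g) * inverse (?E q)) * fps_to_fls (?E (den g))"
        by (simp add: fls_times_fps_to_fls fps_to_fls_power)
      then show ?thesis unfolding ex using den0 by (simp only: times_divide_eq_right nonzero_divide_eq_eq[OF den0])
    qed
    then show "is_power_series (fls_X ^ d * expansion 1 g)" by simp
  next
    assume "is_power_series (fls_X ^ d * expansion 1 g)"
    then obtain u where u: "fls_X ^ d * expansion 1 g = fps_to_fls u" by (auto simp: is_power_series_def)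
    then have "fls_X ^ d * fps_to_fls (?E (num g)) = fps_to_fls u * fps_to_fls (?E (den g))"
      unfolding ex using den0 by (simp only: times_divide_eq_right nonzero_divide_eq_eq[OF den0])
    then have "fps_to_fls (fps_X ^ d * ?E (num g)) = fps_to_fls (u * ?E (den g))"
      by (simp add: fls_times_fps_to_fls fps_to_fls_power)
    then have eq: "fps_X ^ d * ?E (num g) = u * ?E (den g)" by (simp only: fps_to_fls_eq_iff)
    show "?b \<le> d"
    proof (rule ccontr)
      assume "\<not> ?b \<le> d"
      then have b: "fps_X ^ ?b = (fps_X ^ d * fps_X ^ (?b - d) :: rat fps)" by (simp flip: power_add)
      have "fps_X ^ d * ?E (num g) = fps_X ^ d * (fps_X ^ (?b - d) * (u * ?E q))"
        unfolding eq Eden b by (simp only: mult_ac)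
      then have "?E (num g) = fps_X ^ (?b - d) * (u * ?E q)" by simp
      then have "fps_nth (?E (num g)) 0 = fps_nth (fps_X ^ (?b - d) * (u * ?E q)) 0" by simp
      also have "\<dots> = 0" using \<open>\<not> ?b \<le> d\<close> by (simp add: fps_X_power_mult_nth)
      finally have "poly (num g) 1 = 0" by (simp add: const)
      moreover have "poly (den g) 1 = 0" using \<open>\<not> ?b \<le> d\<close> by (subst q(1)) (simp add: power_0_left)
      ultimately show False
        using num_den_no_common_root[of g "1::rat"] poly_rat_poly_of_rat[of _ 1, where ?'a = rat] by simp
    qed
  qed
qed

lemma pole_order_expand_vec:
  "order_at_1 (f $ i) \<le> pole_order (expand_vec 1 f)"
  "pole_order (expand_vec 1 f) > 0 \<Longrightarrow> \<exists>i. order_at_1 (f $ i) = pole_order (expand_vec 1 f)"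
proof -
  have iff: "fls_X ^ d *s expand_vec 1 f \<in> power_series_vecs \<longleftrightarrow> (\<forall>i. order_at_1 (f $ i) \<le> d)" for d
    by (simp add: power_series_vecs_iff expand_vec_def is_power_series_expansion_iff)
  have "\<exists>d. \<forall>i. order_at_1 (f $ i) \<le> d"
    by (rule exI[of _ "Max (range (\<lambda>i. order_at_1 (f $ i)))"]) simp
  then have le: "\<forall>i. order_at_1 (f $ i) \<le> pole_order (expand_vec 1 f)"
    unfolding pole_order_def iff by (rule LeastI_ex)
  then show "order_at_1 (f $ i) \<le> pole_order (expand_vec 1 f)" by blast
  assume "pole_order (expand_vec 1 f) > 0"
  then have "\<not> (\<forall>i. order_at_1 (f $ i) \<le> pole_order (expand_vec 1 f) - 1)"
    unfolding pole_order_def iff by (intro not_less_Least) simp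
  then obtain i where "\<not> order_at_1 (f $ i) \<le> pole_order (expand_vec 1 f) - 1" by blast
  then show "\<exists>i. order_at_1 (f $ i) = pole_order (expand_vec 1 f)"
    using le by (intro exI[of _ i]) (simp add: le_antisym)
qed

section \<open>The growth dichotomy\<close>

lemma conv_radius_of_poles:
  assumes eq: "fps_of_poly q * F = fps_of_poly P" and "q \<noteq> 0"
    and poles: "\<And>z :: complex. poly (rat_poly q) z = 0 \<Longrightarrow> z \<noteq> 0 \<Longrightarrow> norm z \<ge> 1"
  shows "fps_conv_radius (rat_fps F :: complex fps) \<ge> 1"
proof (cases "F = 0")
  case True
  then have "rat_fps F = (0 :: complex fps)" by (simp add: fps_eq_iff)
  then show ?thesis by simp
next
  case False
  let ?q = "fps_of_poly (rat_poly q) :: complex fps" and ?P = "fps_of_poly (rat_poly P) :: complex fps"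
  let ?F = "rat_fps F :: complex fps"
  have eq': "?q * ?F = ?P" unfolding rat_fps_of_poly[symmetric] rat_fps_mult[symmetric] eq ..
  have q0: "?q \<noteq> 0" using \<open>q \<noteq> 0\<close> fps_of_poly_eq_iff[of "rat_poly q :: complex poly" 0] by simp
  have F0: "?F \<noteq> 0" using False by (auto simp: fps_eq_iff)
  have F: "?F = ?P / ?q" unfolding eq'[symmetric] using q0 by simp
  have "subdegree ?q \<le> subdegree ?P" unfolding eq'[symmetric] using q0 F0 by simp
  then have "fps_conv_radius (?P / ?q) \<ge> Min {1, fps_conv_radius ?P, fps_conv_radius ?q}"
  proof (rule fps_conv_radius_divide)
    fix z :: complex assume z: "z \<in> eball 0 1" "z \<noteq> 0"
    then have "norm z < 1" by (simp add: one_ereal_def)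
    then show "eval_fps ?q z \<noteq> 0" using poles[of z] z by auto
  qed simp_all
  then show ?thesis unfolding F by simp
qed

lemma partial_sum_shift:
  assumes "\<And>n. n < - int a \<Longrightarrow> fls_nth H n = 0" "\<And>k. fls_nth H (int k - int a) = of_nat (C k)"
  shows "partial_sum H N = (\<Sum>k\<le>N + a. real (C k))"
proof -
  have "(\<Sum>n = fls_subdegree H..int N. fls_nth H n) = (\<Sum>n = - int a..int N. fls_nth H n)"
  proof (rule sum.mono_neutral_cong)
    show "fls_nth H n = 0" if "n \<in> {fls_subdegree H..int N} - {- int a..int N}" for n using that assms(1) by auto
    show "fls_nth H n = 0" if "n \<in> {- int a..int N} - {fls_subdegree H..int N}" for n using that by auto
  qed auto
  also have "\<dots> = (\<Sum>k\<le>N + a. fls_nth H (int k - int a))"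
    by (rule sum.reindex_bij_witness[of _ "\<lambda>k. int k - int a" "\<lambda>n. nat (n + int a)"]) auto
  also have "\<dots> = of_nat (\<Sum>k\<le>N + a. C k)" by (simp add: assms(2))
  finally show ?thesis by (simp add: partial_sum_def of_rat_sum)
qed

lemma not_exponential_imp_summable:
  fixes C :: "nat \<Rightarrow> nat"
  assumes "\<not> series_exponential_growth H" "\<And>N. partial_sum H N = (\<Sum>k\<le>N + a. real (C k))"
    and r: "0 < r" "r < 1"
  shows "summable (\<lambda>n. real (C n) * r ^ n)"
proof -
  \<comment> \<open>A radius strictly between \<open>r\<close> and 1 turns the bound on the roots into a geometric majorant.\<close>
  define \<rho> where "\<rho> = (r + 1) / 2"
  have \<rho>: "r < \<rho>" "\<rho> < 1" "0 < \<rho>" using r by (auto simp: \<rho>_def)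
  have "limsup (\<lambda>N. ereal (root N (partial_sum H N))) \<le> 1"
    using assms(1) by (simp add: series_exponential_growth_def not_less)
  also have "(1::ereal) < ereal (1 / \<rho>)" using \<rho> by (simp add: one_ereal_def)
  finally have "eventually (\<lambda>N. ereal (root N (partial_sum H N)) < ereal (1 / \<rho>)) sequentially"
    by (rule Limsup_lessD)
  then have "eventually (\<lambda>N. norm (real (C (N + a)) * r ^ N) \<le> (r / \<rho>) ^ N) sequentially"
    using eventually_gt_at_top[of 0]
  proof eventually_elim
    case (elim N)
    have S0: "partial_sum H N \<ge> 0" unfolding assms(2) by (intro sum_nonneg) simp
    have "real (C (N + a)) \<le> partial_sum H N" unfolding assms(2) by (intro member_le_sum) auto
    also have "\<dots> = root N (partial_sum H N) ^ N" using elim S0 by simp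
    also have "\<dots> \<le> (1 / \<rho>) ^ N" using elim S0 by (intro power_mono) auto
    finally have "real (C (N + a)) * r ^ N \<le> (1 / \<rho>) ^ N * r ^ N" using r by (intro mult_right_mono) auto
    then show ?case using r by (simp add: power_divide power_one_over mult.commute divide_inverse power_mult_distrib)
  qed
  moreover have "summable (\<lambda>N. (r / \<rho>) ^ N)" using r \<rho> by (intro summable_geometric) auto
  ultimately have "summable (\<lambda>N. real (C (N + a)) * r ^ N)" by (rule summable_comparison_test_ev)
  then have "summable (\<lambda>N. r ^ a * (real (C (N + a)) * r ^ N))" by (rule summable_mult)
  then have "summable (\<lambda>N. real (C (N + a)) * r ^ (N + a))" by (simp add: power_add mult_ac)
  then show ?thesis by (subst (asm) summable_iff_shift)
qed

text \<open>
  A vector of rational functions whose expansions at 0 have natural numbers as coefficients. All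
  coordinates are shifted by the same amount to obtain power series, so that the shifted total series is
  the sum of the shifted coordinates.
\<close>

locale hilbert_series_vector =
  fixes f :: "ratfun ^ 'r::finite" and c :: "'r \<Rightarrow> int \<Rightarrow> nat"
  assumes coeffs: "fls_nth (expansion 0 (f $ i)) n = of_nat (c i n)"
    and nonzero: "\<exists>i n. c i n \<noteq> 0"
begin

definition "total_series = (\<Sum>i\<in>UNIV. expansion 0 (f $ i))"

definition "shift = (\<Sum>i\<in>UNIV. nat (- fls_subdegree (expansion 0 (f $ i))))"

definition "shifted_coeff i k = c i (int k - int shift)"

definition "total_coeff k = (\<Sum>i\<in>UNIV. shifted_coeff i k)"

definition "shifted_series i = Abs_fps (\<lambda>n. of_nat (shifted_coeff i n) :: rat)"

lemma below_shift: "n < - int shift \<Longrightarrow> fls_nth (expansion 0 (f $ i)) n = 0"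
proof -
  assume n: "n < - int shift"
  have "nat (- fls_subdegree (expansion 0 (f $ i))) \<le> shift" unfolding shift_def by (rule member_le_sum) auto
  then have "n < fls_subdegree (expansion 0 (f $ i))" using n by linarith
  then show ?thesis by (rule fls_eq0_below_subdegree)
qed

lemma coeff_below_shift: "n < - int shift \<Longrightarrow> c i n = 0"
  using below_shift[of n i] by (simp add: coeffs)

lemma shifted_series_eq: "fps_of_poly (den (f $ i)) * shifted_series i = fps_of_poly ([:0, 1:] ^ shift * num (f $ i))"
proof -
  have "shifted_series i = Abs_fps (\<lambda>n. fls_nth (expansion 0 (f $ i)) (int n - int shift))"
    by (simp add: shifted_series_def coeffs shifted_coeff_def)
  then show ?thesis using expansion_shift[OF below_shift] by simp
qed

lemma partial_sum_total: "partial_sum total_series N = (\<Sum>k\<le>N + shift. real (total_coeff k))"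
  by (rule partial_sum_shift) (simp_all add: total_series_def fls_nth_sum coeff_below_shift coeffs total_coeff_def shifted_coeff_def)

lemma shifted_coeff_le_total: "shifted_coeff i k \<le> total_coeff k"
  unfolding total_coeff_def by (rule member_le_sum) auto

lemma total_coeff_nonzero: "\<exists>k. total_coeff k > 0"
proof -
  obtain i n where n: "c i n \<noteq> 0" using nonzero by blast
  have "n \<ge> - int shift"
  proof (rule ccontr)
    assume "\<not> n \<ge> - int shift"
    then show False using below_shift[of n i] n by (simp add: coeffs)
  qed
  then have "shifted_coeff i (nat (n + int shift)) = c i n" by (simp add: shifted_coeff_def)
  then show ?thesis using shifted_coeff_le_total[of i "nat (n + int shift)"] n by (intro exI[of _ "nat (n + int shift)"]) simp
qed

lemma numerator_nonzero_at_pole: "poly (rat_poly (den (f $ i))) z = 0 \<Longrightarrow> z \<noteq> 0 \<Longrightarrow>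
    poly (rat_poly ([:0, 1:] ^ shift * num (f $ i))) z \<noteq> (0 :: 'a :: field_char_0)"
  using num_den_no_common_root[of "f $ i" z]
  by (simp add: rat_poly_mult rat_poly_power map_poly_pCons poly_power)

text \<open>
  Without exponential growth the total series, and by nonnegativity each coordinate, converges in the open
  unit disc; then \<open>integer_series_poles\<close> applies to every coordinate.
\<close>

lemma exponential_growth_of_pole:
  assumes "some_pole_not_root_of_unity f"
  shows "series_exponential_growth total_series"
proof (rule ccontr)
  assume not: "\<not> series_exponential_growth total_series"
  from assms obtain i z where z: "z \<noteq> 0" "is_pole (ratfun_eval (f $ i)) z" "\<not> root_of_unity z"
    by (auto simp: some_pole_not_root_of_unity_def)
  have "fps_conv_radius (rat_fps (shifted_series i) :: complex fps) \<ge> 1"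
    unfolding fps_conv_radius_def
  proof (rule conv_radius_geI_ex)
    fix r :: real assume r: "0 < r" "ereal r < 1"
    then have "summable (\<lambda>n. real (total_coeff n) * r ^ n)"
      by (intro not_exponential_imp_summable[OF not partial_sum_total]) (simp_all add: one_ereal_def)
    then have "summable (\<lambda>n. fps_nth (rat_fps (shifted_series i)) n * complex_of_real r ^ n)"
    proof (rule summable_comparison_test'[of _ 0])
      fix n
      show "norm (fps_nth (rat_fps (shifted_series i)) n * complex_of_real r ^ n) \<le> real (total_coeff n) * r ^ n"
        using r shifted_coeff_le_total[of i n] by (simp add: shifted_series_def norm_mult norm_power mult_right_mono)
    qed
    then show "\<exists>z. norm z = r \<and> summable (\<lambda>n. fps_nth (rat_fps (shifted_series i)) n * z ^ n :: complex)"
      using r by (intro exI[of _ "complex_of_real r"]) simp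
  qed
  then have "\<exists>n>0. z ^ n = 1"
    using z numerator_nonzero_at_pole by (intro integer_series_poles[OF shifted_series_eq[of i]]) (auto simp: is_pole_ratfun_eval shifted_series_def)
  then show False using z(3) by (simp add: root_of_unity_def)
qed

text \<open>
  With \<open>p\<close> the pole order, \<open>(1 - x)\<^sup>p\<close> times a coordinate has a limit \<open>\<alpha> i \<ge> 0\<close> at 1. Some \<open>\<alpha> i\<close> is nonzero:
  for \<open>p > 0\<close> at a coordinate where the pole order is attained, and for \<open>p = 0\<close> because a nonnegative
  nonzero series cannot tend to 0 as \<open>x\<close> increases.
\<close>

lemma gk_dim_of_poles:
  assumes "all_poles_roots_of_unity f"
  shows "series_gk_dim total_series = ereal (real (pole_order (expand_vec 1 f)))"
proof -
  define p where "p = pole_order (expand_vec 1 f)"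
  have roots: "\<exists>n>0. z ^ n = 1" if "poly (rat_poly (den (f $ i))) z = 0" "z \<noteq> 0" for i and z :: complex
  proof -
    have "is_pole (ratfun_eval (f $ i)) z" using that by (simp add: is_pole_ratfun_eval)
    moreover have "f $ i \<noteq> 0" using that(1) by auto
    ultimately have "root_of_unity z" using assms that(2) unfolding all_poles_roots_of_unity_def by blast
    then show ?thesis by (simp add: root_of_unity_def)
  qed
  have norm1: "norm z = 1" if z: "poly (rat_poly (den (f $ i))) z = 0" "z \<noteq> 0" for i and z :: complex
  proof -
    obtain n where n: "n > 0" "z ^ n = 1" using roots[OF z] by blast
    then have "norm z ^ n = 1" by (metis norm_one norm_power)
    then show ?thesis using power_eq_imp_eq_base[of "norm z" n 1] n(1) by simp
  qed
  have rad: "fps_conv_radius (rat_fps (shifted_series i) :: complex fps) \<ge> 1" for i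
    by (rule conv_radius_of_poles[OF shifted_series_eq]) (use norm1 in auto)
  have den_nz: "poly (rat_poly (den (f $ i))) x \<noteq> 0" if "0 < x" "x < 1" for x :: real and i
  proof
    assume "poly (rat_poly (den (f $ i))) x = 0"
    moreover have "poly (rat_poly q) (complex_of_real x) = complex_of_real (poly (rat_poly q) x)" for q
    proof -
      have "of_rat b = complex_of_real (of_rat b)" for b by (cases b) (simp add: of_rat_rat)
      then show ?thesis by (induction q) (simp_all add: map_poly_pCons)
    qed
    ultimately have "norm (complex_of_real x) = 1" using that by (intro norm1) auto
    then show False using that by simp
  qed
  have summ: "summable (\<lambda>n. real (shifted_coeff i n) * x ^ n)" if "0 < x" "x < 1" for x i
  proof -
    have "ereal (norm (complex_of_real x)) < 1" using that by (simp add: one_ereal_def)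
    then have "ereal (norm (complex_of_real x)) < fps_conv_radius (rat_fps (shifted_series i) :: complex fps)"
      using rad[of i] by (rule less_le_trans)
    then have "summable (\<lambda>n. norm (fps_nth (rat_fps (shifted_series i)) n * complex_of_real x ^ n))"
      unfolding fps_conv_radius_def by (rule abs_summable_in_conv_radius)
    then show ?thesis using that by (simp add: shifted_series_def norm_mult norm_power)
  qed
  have radR: "fps_conv_radius (rat_fps (shifted_series i) :: real fps) \<ge> 1" for i
    unfolding fps_conv_radius_def
  proof (rule conv_radius_geI_ex)
    fix r :: real assume r: "0 < r" "ereal r < 1"
    then show "\<exists>z::real. norm z = r \<and> summable (\<lambda>n. fps_nth (rat_fps (shifted_series i)) n * z ^ n)"
      using summ[of r i] by (intro exI[of _ r]) (simp add: shifted_series_def one_ereal_def)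
  qed
  define \<phi> where "\<phi> i x = (\<Sum>n. real (shifted_coeff i n) * x ^ n)" for i x
  have \<phi>_eq: "poly (rat_poly (den (f $ i))) x * \<phi> i x = x ^ shift * poly (rat_poly (num (f $ i))) x" if "0 < x" "x < 1" for i x
  proof -
    have "ereal (norm x) < fps_conv_radius (rat_fps (shifted_series i) :: real fps)"
      using that less_le_trans[OF _ radR[of i], of "ereal (norm x)"] by (simp add: one_ereal_def)
    from eval_rational_series[OF shifted_series_eq[of i] this] show ?thesis
      by (simp add: \<phi>_def eval_fps_def shifted_series_def rat_poly_mult rat_poly_power map_poly_pCons poly_power)
  qed
  have "\<exists>\<alpha>. ((\<lambda>x. (1 - x) ^ p * \<phi> i x) \<longlongrightarrow> \<alpha>) (at_left 1) \<and> (order_at_1 (f $ i) = p \<longrightarrow> p > 0 \<longrightarrow> \<alpha> \<noteq> 0)" for i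
  proof -
    let ?b = "order_at_1 (f $ i)"
    obtain d where d: "den (f $ i) = [:-1, 1:] ^ ?b * d" "poly d 1 \<noteq> 0" by (rule den_factor)
    let ?d = "poly (rat_poly d) :: real \<Rightarrow> real" and ?n = "poly (rat_poly (num (f $ i))) :: real \<Rightarrow> real"
    have den_eq: "poly (rat_poly (den (f $ i))) x = (x - 1) ^ ?b * ?d x" for x :: real
      by (subst d(1)) (simp add: rat_poly_mult rat_poly_power map_poly_pCons poly_power of_rat_minus)
    have d1: "?d 1 \<noteq> 0" using d(2) poly_rat_poly_of_rat[of d 1, where ?'a = real] by simp
    have bp: "?b \<le> p" unfolding p_def by (rule pole_order_expand_vec(1))
    \<comment> \<open>The closed form of \<open>(1 - x) ^ p * \<phi> i x\<close>; it is continuous at 1 because the root of the denominator at 1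
      is cancelled.\<close>
    let ?g = "\<lambda>x. (-1) ^ ?b * (1 - x) ^ (p - ?b) * x ^ shift * ?n x / ?d x"
    have "(?g \<longlongrightarrow> ?g 1) (at_left 1)"
      using d1 by (intro tendsto_intros poly_isCont[THEN isCont_tendsto_compose]) auto
    moreover have "eventually (\<lambda>x. ?g x = (1 - x) ^ p * \<phi> i x) (at_left 1)"
      using eventually_at_left_real[of 0 1]
    proof (rule eventually_mono)
      fix x :: real assume x: "x \<in> {0<..<1}"
      then have x': "0 < x" "x < 1" by auto
      have nz: "(x - 1) ^ ?b \<noteq> 0" "?d x \<noteq> 0" using den_nz[OF x', of i] unfolding den_eq by auto
      have "\<phi> i x = x ^ shift * ?n x / ((x - 1) ^ ?b * ?d x)"
        using \<phi>_eq[OF x', of i] nz unfolding den_eq by (simp add: field_simps)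
      moreover have "(1 - x) ^ p = (1 - x) ^ (p - ?b) * ((-1) ^ ?b * (x - 1) ^ ?b)"
      proof -
        have "(-1) ^ ?b * (x - 1) ^ ?b = (1 - x) ^ ?b" by (simp flip: power_mult_distrib)
        then show ?thesis using bp by (simp flip: power_add)
      qed
      ultimately show "?g x = (1 - x) ^ p * \<phi> i x" using nz by (simp add: field_simps)
    qed simp
    ultimately have "((\<lambda>x. (1 - x) ^ p * \<phi> i x) \<longlongrightarrow> ?g 1) (at_left 1)"
      by (rule Lim_transform_eventually)
    moreover have "?g 1 \<noteq> 0" if "?b = p" "p > 0"
    proof -
      have "poly (rat_poly (den (f $ i))) (1::real) = 0" using that by (simp add: den_eq)
      then have "?n 1 \<noteq> 0" by (rule num_den_no_common_root)
      then show ?thesis using that d1 by simp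
    qed
    ultimately show ?thesis by blast
  qed
  then obtain \<alpha> where \<alpha>: "\<And>i. ((\<lambda>x. (1 - x) ^ p * \<phi> i x) \<longlongrightarrow> \<alpha> i) (at_left 1)"
    and \<alpha>_nz: "\<And>i. order_at_1 (f $ i) = p \<Longrightarrow> p > 0 \<Longrightarrow> \<alpha> i \<noteq> 0" by metis
  have ev01: "eventually (\<lambda>x::real. 0 < x \<and> x < 1) (at_left 1)"
    using eventually_at_left_real[of 0 1] by (rule eventually_mono) auto
  have \<phi>_nonneg: "\<phi> i x \<ge> 0" if "0 < x" "x < 1" for i x
    unfolding \<phi>_def using that by (intro suminf_nonneg summ) auto
  have \<alpha>_nonneg: "\<alpha> i \<ge> 0" for i
    using ev01 \<phi>_nonneg by (intro tendsto_lowerbound[OF \<alpha>[of i]]) (auto elim!: eventually_mono)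
  have sum_\<phi>: "(\<Sum>n. real (total_coeff n) * x ^ n) = (\<Sum>i\<in>UNIV. \<phi> i x)" if "0 < x" "x < 1" for x
    unfolding \<phi>_def total_coeff_def using summ[OF that] by (simp add: sum_distrib_right suminf_sum)
  have summable_total: "summable (\<lambda>n. real (total_coeff n) * x ^ n)" if "0 < x" "x < 1" for x
    unfolding total_coeff_def using summ[OF that] by (simp add: sum_distrib_right summable_sum)
  have "((\<lambda>x. \<Sum>i\<in>UNIV. (1 - x) ^ p * \<phi> i x) \<longlongrightarrow> (\<Sum>i\<in>UNIV. \<alpha> i)) (at_left 1)"
    using \<alpha> by (intro tendsto_sum) auto
  moreover have "eventually (\<lambda>x. (\<Sum>i\<in>UNIV. (1 - x) ^ p * \<phi> i x) = (1 - x) ^ p * (\<Sum>n. real (total_coeff n) * x ^ n)) (at_left 1)"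
    using ev01 by (rule eventually_mono) (simp add: sum_\<phi> sum_distrib_left)
  ultimately have lim: "((\<lambda>x. (1 - x) ^ p * (\<Sum>n. real (total_coeff n) * x ^ n)) \<longlongrightarrow> (\<Sum>i\<in>UNIV. \<alpha> i)) (at_left 1)"
    by (rule Lim_transform_eventually)
  have pos: "(\<Sum>i\<in>UNIV. \<alpha> i) > 0"
  proof (cases "p > 0")
    case True
    then obtain i where "order_at_1 (f $ i) = p" using pole_order_expand_vec(2)[of f] unfolding p_def by blast
    then have "\<alpha> i > 0" using \<alpha>_nz[of i] True \<alpha>_nonneg[of i] by simp
    then show ?thesis using \<alpha>_nonneg by (intro sum_pos2[of _ i]) auto
  next
    case False
    obtain k where k: "total_coeff k > 0" using total_coeff_nonzero by blast
    have "((\<lambda>x::real. real (total_coeff k) * x ^ k) \<longlongrightarrow> real (total_coeff k) * 1 ^ k) (at_left 1)"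
      by (intro tendsto_intros)
    moreover have "eventually (\<lambda>x. real (total_coeff k) * x ^ k \<le> (1 - x) ^ p * (\<Sum>n. real (total_coeff n) * x ^ n)) (at_left 1)"
      using ev01
    proof (rule eventually_mono)
      fix x :: real assume x: "0 < x \<and> x < 1"
      have "(\<Sum>n\<in>{k}. real (total_coeff n) * x ^ n) \<le> (\<Sum>n. real (total_coeff n) * x ^ n)"
        using x by (intro sum_le_suminf summable_total) auto
      then show "real (total_coeff k) * x ^ k \<le> (1 - x) ^ p * (\<Sum>n. real (total_coeff n) * x ^ n)" using False by simp
    qed
    ultimately have "real (total_coeff k) * 1 ^ k \<le> (\<Sum>i\<in>UNIV. \<alpha> i)"
      by (intro tendsto_le[OF _ lim]) auto
    then show ?thesis using k by simp
  qed
  from partial_sums_bounds[of "\<lambda>n. real (total_coeff n)", OF _ summable_total lim pos]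
  obtain c1 c2 where "c1 > 0" "c2 > 0"
    "eventually (\<lambda>N. c1 * real N ^ p \<le> (\<Sum>n\<le>N. real (total_coeff n)) \<and> (\<Sum>n\<le>N. real (total_coeff n)) \<le> c2 * real N ^ p) sequentially"
    by auto
  from log_growth_limit[OF this, of shift]
  have "((\<lambda>N. ereal (ln (partial_sum total_series N) / ln (real N))) \<longlongrightarrow> ereal (real p)) sequentially"
    unfolding partial_sum_total by (intro tendsto_ereal)
  then show ?thesis
    unfolding series_gk_dim_def p_def[symmetric] by (intro lim_imp_Limsup) simp_all
qed

end

theorem theorem5p3:
  fixes K :: "'k ring"
    and A :: "('k, 'a) graded_module"
    and e :: "'r::finite \<Rightarrow> 'a"
    and M :: "('a, 'm) graded_module"
  assumes "elementary_algebra K A e"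
    and "\<And>j. graded_FP_infinity A (vertex_simple A e j)"
    and "rational_hilbert_matrix K A e"
    and "graded_left_module A M"
    and "carrier M \<noteq> {\<zero>\<^bsub>M\<^esub>}"
    and "perfect A M"
  shows "(all_poles_roots_of_unity (hilbert_ratfun K A e M) \<noteq>
          some_pole_not_root_of_unity (hilbert_ratfun K A e M)) \<and>
         (all_poles_roots_of_unity (hilbert_ratfun K A e M) \<longrightarrow>
           \<bar>gk_dim K A e M\<bar> \<noteq> \<infinity> \<and>
           gk_dim K A e M = ereal (real (pole_order (expand_vec 1 (hilbert_ratfun K A e M)))) \<and>
           pole_order (expand_vec 1 (hilbert_ratfun K A e M)) =
             torsion_order K A e (growth_proj K A e (expand_vec 1 (euler_numerator K A e M)))) \<and>
         (some_pole_not_root_of_unity (hilbert_ratfun K A e M) \<longrightarrow> exponential_growth K A e M)"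
proof -
  note props = euler_numerator_properties[OF assms(1,3,4,6)]
  let ?f = "hilbert_ratfun K A e M"
  have series: "hilbert_series K A e M $ i = expansion 0 (?f $ i)" for i
    using props(1,2) by (simp add: expand_vec_def)
  interpret hilbert_series_vector ?f "graded_dim K A e M"
    using props(5) nonzero_graded_dim[OF assms(1,4,5) props(4)]
    by (simp add: hilbert_series_vector_def series[symmetric])
  have total_series: "(\<Sum>i\<in>UNIV. hilbert_series K A e M $ i) = total_series" by (simp add: total_series_def series)
  have dichotomy: "all_poles_roots_of_unity ?f \<noteq> some_pole_not_root_of_unity ?f"
  proof -
    have "?f $ i \<noteq> 0" if "is_pole (ratfun_eval (?f $ i)) z" for i z
      using that by (auto simp: is_pole_ratfun_eval)
    then show ?thesis unfolding all_poles_roots_of_unity_def some_pole_not_root_of_unity_def by blast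
  qed
  show ?thesis
    using dichotomy gk_dim_of_poles exponential_growth_of_pole pole_order_torsion_order[OF assms(1,3,4,6)]
    by (simp add: gk_dim_def exponential_growth_def total_series)
qed

end
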